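(* Let $\varphi$ be a free holomorphic self-map of the noncommutative ball $[B(\mathcal H)^n]_1$ and let $C_\varphi$ be the composition operator on $H^2_{\bf ball}$. Then the spectral radius of $C_\varphi$ satisfies the relation $$r(C_\varphi)=\lim_{k\to\infty}\left(1-\|\varphi^{[k]}(0)\|\right)^{-1/(2k)}.$$ Moreover, $$r(C_\varphi)=\lim_{k\to\infty}\left(\frac{1-\|\varphi^{[k]}(0)\|}{1-\|\varphi^{[k+1]}(0)\|}\right)^{1/2}$$ if the latter limit exists.
   Context: $n\ge1$; $\mathcal H$ is a separable infinite dimensional complex Hilbert space. $\mathbb F_n^+$ is the free semigroup with generators $g_1,\ldots,g_n$ and identity $g_0$; $|g_0|=0$, $|\alpha|=k$ if $\alpha=g_{i_1}\cdots g_{i_k}$; $X_\alpha:=X_{i_1}\cdots X_{i_k}$, $X_{g_0}:=I$. $[B(\mathcal H)^n]_1:=\{(X_1,\ldots,X_n)\in B(\mathcal H)^n:\ \|X_1X_1^*+\cdots+X_nX_n^*\|^{1/2}<1\}$. A free holomorphic function $f:[B(\mathcal H)^n]_1\to B(\mathcal H)$ is a map $f(X)=\sum_{k=0}^\infty\sum_{|\alpha|=k}a_\alpha X_\alpha$ (series over $k$ converging in operator norm) with $a_\alpha\in\mathbb C$ and $\limsup_{k\to\infty}(\sum_{|\alpha|=k}|a_\alpha|^2)^{1/2k}\le1$. A free holomorphic self-map $\varphi=(\varphi_1,\ldots,\varphi_n)$ of $[B(\mathcal H)^n]_1$ has each $\varphi_i$ free holomorphic and maps $[B(\mathcal H)^n]_1$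 into itself; $\varphi^{[k]}:=\varphi\circ\cdots\circ\varphi$ ($k$ times) is its $k$-th iterate. $\varphi^{[k]}(0)$ is identified with a point of the open Euclidean unit ball of $\mathbb C^n$, and its norm is Euclidean. With $\varphi_\alpha:=\varphi_{i_1}\cdots\varphi_{i_k}$, the composition is $(f\circ\varphi)(X)=\sum_{k=0}^\infty\sum_{|\alpha|=k}a_\alpha\varphi_\alpha(X)$. $H^2_{\bf ball}$ is the Hilbert space of free holomorphic functions $f=\sum_\alpha a_\alpha X_\alpha$ on $[B(\mathcal H)^n]_1$ with $\|f\|_2^2:=\sum_\alpha|a_\alpha|^2<\infty$; $C_\varphi f:=f\circ\varphi$ is a bounded operator on $H^2_{\bf ball}$. *)

theory Defs
  imports "HOL-Analysis.Analysis"
begin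

text \<open>Complex Hilbert spaces. The inner product is linear in its first argument; the underlying
  real inner product, and hence the norm, is determined by \<open>inner_eq_Re_cinner\<close>.\<close>

class complex_hilbert = real_inner + complete_space +
  fixes scaleC :: "complex \<Rightarrow> 'a \<Rightarrow> 'a"
    and cinner :: "'a \<Rightarrow> 'a \<Rightarrow> complex"
  assumes scaleC_add_right: "scaleC c (x + y) = scaleC c x + scaleC c y"
    and scaleC_add_left: "scaleC (c + d) x = scaleC c x + scaleC d x"
    and scaleC_scaleC: "scaleC c (scaleC d x) = scaleC (c * d) x"
    and scaleC_of_real: "scaleC (complex_of_real r) x = scaleR r x"
    and cinner_add_left: "cinner (x + y) z = cinner x z + cinner y z"
    and cinner_scaleC_left: "cinner (scaleC c x) y = c * cinner x y"
    and cinner_commute: "cinner x y = cnj (cinner y x)"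
    and inner_eq_Re_cinner: "inner x y = Re (cinner x y)"

lemma scaleC_one: "scaleC 1 x = (x :: 'a::complex_hilbert)"
  using scaleC_of_real[of 1 x] by simp

lemma vector_space_scaleC: "vector_space (scaleC :: complex \<Rightarrow> 'a \<Rightarrow> 'a::complex_hilbert)"
  by unfold_locales (simp_all add: scaleC_add_right scaleC_add_left scaleC_scaleC scaleC_one)

lemma norm_scaleC: "norm (scaleC c x) = cmod c * norm (x :: 'a::complex_hilbert)"
proof -
  have "cinner (scaleC c x) (scaleC c x) = c * (cnj c * cinner x x)"
    using cinner_commute[of x "scaleC c x"] cinner_commute[of x x]
    by (simp add: cinner_scaleC_left)
  also have "\<dots> = of_real ((cmod c)\<^sup>2) * cinner x x"
    by (simp add: complex_norm_square mult.assoc del: of_real_power)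
  finally have "(norm (scaleC c x))\<^sup>2 = (cmod c * norm x)\<^sup>2"
    by (simp add: power2_norm_eq_inner inner_eq_Re_cinner power_mult_distrib del: of_real_power)
  then show ?thesis by (simp add: power2_eq_iff_nonneg)
qed

text \<open>The algebra $B(H)$ is the set of those (real) bounded linear maps that are complex linear.\<close>

definition complex_ops :: "('a::complex_hilbert \<Rightarrow>\<^sub>L 'a) set" where
  "complex_ops = {A. \<forall>c x. blinfun_apply A (scaleC c x) = scaleC c (blinfun_apply A x)}"

lift_definition scale_op :: "complex \<Rightarrow> ('a::complex_hilbert \<Rightarrow>\<^sub>L 'a) \<Rightarrow> ('a \<Rightarrow>\<^sub>L 'a)"
  is "\<lambda>c A x. scaleC c (A x)"
proof -
  fix c :: complex and A :: "'a \<Rightarrow> 'a"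
  assume "bounded_linear A"
  then interpret A: bounded_linear A .
  obtain K where K: "\<And>x. norm (A x) \<le> norm x * K" using A.bounded by blast
  have eq: "scaleC c (scaleR r y) = scaleR r (scaleC c y)" for r and y :: 'a
    by (simp add: scaleC_of_real[symmetric] scaleC_scaleC mult.commute)
  show "bounded_linear (\<lambda>x. scaleC c (A x))"
  proof (rule bounded_linear_intro[where K = "cmod c * K"])
    show "norm (scaleC c (A x)) \<le> norm x * (cmod c * K)" for x
      using mult_left_mono[OF K[of x], of "cmod c"] by (simp add: norm_scaleC mult_ac)
  qed (simp_all add: A.add A.scaleR scaleC_add_right eq)
qed

text \<open>The Hilbert space adjoint.\<close>

definition cadjoint :: "('a::complex_hilbert \<Rightarrow>\<^sub>L 'a) \<Rightarrow> ('a \<Rightarrow>\<^sub>L 'a)" where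
  "cadjoint A = (THE B. \<forall>x y. cinner (blinfun_apply A x) y = cinner x (blinfun_apply B y))"

text \<open>Throughout, \<open>n\<close> is the cardinality of the finite type \<open>'n\<close>; \<open>n\<close>-tuples of operators are functions
  on \<open>'n\<close>, and the free semigroup on \<open>n\<close> generators is \<open>'n list\<close>.\<close>

type_synonym ('n, 'a) op_tuple = "'n \<Rightarrow> 'a \<Rightarrow>\<^sub>L 'a"

definition nc_ball :: "('n::finite, 'a::complex_hilbert) op_tuple set" where
  "nc_ball = {X. (\<forall>i. X i \<in> complex_ops) \<and> sqrt (norm (\<Sum>i\<in>UNIV. X i o\<^sub>L cadjoint (X i))) < 1}"

primrec word_op :: "('n, 'a::real_normed_vector) op_tuple \<Rightarrow> 'n list \<Rightarrow> 'a \<Rightarrow>\<^sub>L 'a" where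
  "word_op X [] = id_blinfun"
| "word_op X (i # \<alpha>) = X i o\<^sub>L word_op X \<alpha>"

definition has_free_expansion ::
  "(('n::finite, 'a::complex_hilbert) op_tuple \<Rightarrow> 'a \<Rightarrow>\<^sub>L 'a) \<Rightarrow> ('n list \<Rightarrow> complex) \<Rightarrow> bool" where
  "has_free_expansion f a \<longleftrightarrow>
     limsup (\<lambda>k. ereal (root (2 * k) (\<Sum>\<alpha> | length \<alpha> = k. (cmod (a \<alpha>))\<^sup>2))) \<le> 1 \<and>
     (\<forall>X\<in>nc_ball. (\<lambda>k. \<Sum>\<alpha> | length \<alpha> = k. scale_op (a \<alpha>) (word_op X \<alpha>)) sums f X)"

definition free_holomorphic ::
  "(('n::finite, 'a::complex_hilbert) op_tuple \<Rightarrow> 'a \<Rightarrow>\<^sub>L 'a) \<Rightarrow> bool" where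
  "free_holomorphic f \<longleftrightarrow> (\<exists>a. has_free_expansion f a)"

definition free_holomorphic_self_map ::
  "(('n::finite, 'a::complex_hilbert) op_tuple \<Rightarrow> ('n, 'a) op_tuple) \<Rightarrow> bool" where
  "free_holomorphic_self_map \<phi> \<longleftrightarrow>
     (\<forall>i. free_holomorphic (\<lambda>X. \<phi> X i)) \<and> \<phi> \<in> nc_ball \<rightarrow> nc_ball"

text \<open>The point of $\mathbb{C}^n$ identified with a tuple of scalar multiples of the identity.\<close>

definition scalar_point :: "('n::finite, 'a::complex_hilbert) op_tuple \<Rightarrow> complex ^ 'n" where
  "scalar_point Y = (THE z. \<forall>i. Y i = scale_op (z $ i) id_blinfun)"

text \<open>The Hardy space. Its elements are functions with domain \<open>nc_ball\<close>, rendered as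
  \<open>extensional\<close> total functions, so that equality of functions is equality on the ball.\<close>

definition free_coeffs ::
  "(('n::finite, 'a::complex_hilbert) op_tuple \<Rightarrow> 'a \<Rightarrow>\<^sub>L 'a) \<Rightarrow> 'n list \<Rightarrow> complex" where
  "free_coeffs f = (THE a. has_free_expansion f a)"

definition H2_ball :: "(('n::finite, 'a::complex_hilbert) op_tuple \<Rightarrow> 'a \<Rightarrow>\<^sub>L 'a) set" where
  "H2_ball = {f \<in> extensional nc_ball.
     free_holomorphic f \<and> (\<lambda>\<alpha>. (cmod (free_coeffs f \<alpha>))\<^sup>2) summable_on UNIV}"

definition H2_norm :: "(('n::finite, 'a::complex_hilbert) op_tuple \<Rightarrow> 'a \<Rightarrow>\<^sub>L 'a) \<Rightarrow> real" where
  "H2_norm f = sqrt (\<Sum>\<^sub>\<infinity>\<alpha>. (cmod (free_coeffs f \<alpha>))\<^sup>2)"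

definition H2_add ::
  "(('n::finite, 'a::complex_hilbert) op_tuple \<Rightarrow> 'a \<Rightarrow>\<^sub>L 'a) \<Rightarrow>
   (('n, 'a) op_tuple \<Rightarrow> 'a \<Rightarrow>\<^sub>L 'a) \<Rightarrow> ('n, 'a) op_tuple \<Rightarrow> 'a \<Rightarrow>\<^sub>L 'a" where
  "H2_add f g = (\<lambda>X\<in>nc_ball. f X + g X)"

definition H2_scale ::
  "complex \<Rightarrow> (('n::finite, 'a::complex_hilbert) op_tuple \<Rightarrow> 'a \<Rightarrow>\<^sub>L 'a) \<Rightarrow>
   ('n, 'a) op_tuple \<Rightarrow> 'a \<Rightarrow>\<^sub>L 'a" where
  "H2_scale c f = (\<lambda>X\<in>nc_ball. scale_op c (f X))"

text \<open>Operators on the Hardy space; their values outside \<open>H2_ball\<close> are irrelevant.\<close>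

type_synonym ('n, 'a) H2_op =
  "(('n, 'a) op_tuple \<Rightarrow> 'a \<Rightarrow>\<^sub>L 'a) \<Rightarrow> (('n, 'a) op_tuple \<Rightarrow> 'a \<Rightarrow>\<^sub>L 'a)"

definition H2_bounded_operator :: "('n::finite, 'a::complex_hilbert) H2_op \<Rightarrow> bool" where
  "H2_bounded_operator T \<longleftrightarrow>
     T \<in> H2_ball \<rightarrow> H2_ball \<and>
     (\<forall>f\<in>H2_ball. \<forall>g\<in>H2_ball. T (H2_add f g) = H2_add (T f) (T g)) \<and>
     (\<forall>c. \<forall>f\<in>H2_ball. T (H2_scale c f) = H2_scale c (T f)) \<and>
     (\<exists>K. \<forall>f\<in>H2_ball. H2_norm (T f) \<le> K * H2_norm f)"

definition H2_invertible :: "('n::finite, 'a::complex_hilbert) H2_op \<Rightarrow> bool" where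
  "H2_invertible T \<longleftrightarrow>
     (\<exists>S. H2_bounded_operator S \<and> (\<forall>f\<in>H2_ball. S (T f) = f \<and> T (S f) = f))"

definition H2_spectrum :: "('n::finite, 'a::complex_hilbert) H2_op \<Rightarrow> complex set" where
  "H2_spectrum T =
     {c. \<not> H2_invertible (\<lambda>f. H2_add (H2_scale c f) (H2_scale (- 1) (T f)))}"

definition H2_spectral_radius :: "('n::finite, 'a::complex_hilbert) H2_op \<Rightarrow> real" where
  "H2_spectral_radius T = (SUP c\<in>H2_spectrum T. cmod c)"

text \<open>For a self-map \<open>\<phi>\<close> of the ball, substituting $\varphi_\alpha(X)$ for $X_\alpha$ in the expansion of
  \<open>f\<close> gives \<open>f (\<phi> X)\<close>.\<close>

definition composition_operator ::
  "(('n::finite, 'a::complex_hilbert) op_tuple \<Rightarrow> ('n, 'a) op_tuple) \<Rightarrow> ('n, 'a) H2_op" where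
  "composition_operator \<phi> f = compose nc_ball f \<phi>"

end

theory Submission
  imports Defs "HOL-Complex_Analysis.Cauchy_Integral_Formula"
begin

text \<open>The norms of the powers of \<open>C\<^sub>\<phi>\<close> are governed by the points $\lambda_k = \varphi^{[k]}(0)$:
  up to a factor $\sqrt 2$, \<open>C\<^sub>\<phi>\<close> to the power $k$, which is the composition operator of
  $\varphi^{[k]}$, has norm $(1 - |\lambda_k|)^{-1/2}$. The lower estimate comes from testing on the
  reproducing kernel at $\lambda_k$. For the upper estimate let $e_\alpha$ be an orthonormal family in
  \<open>H\<close> indexed by words, with shifts $S_i e_\alpha = e_{i\alpha}$, and put
  $M_i = \psi_i(sS)$, where $s < 1$. This is a row contraction with
  $M_i^* e_\emptyset = \bar\lambda_i e_\emptyset$. Dividing $f$ on the right by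
  $1 - \sum \bar\lambda_i X_i$ gives $g$ with $\|g\| \le \|f\| / (1 - |\lambda|)$ and
  $f(M) e_\emptyset = \sum g_\alpha M_\alpha D e_\emptyset$, where
  $D = 1 - \sum M_i M_i^*$; since $\sum M_\alpha D M_\alpha^* \le 1$ by telescoping, this vector has
  norm at most $\|g\| (1 - |\lambda|^2)^{1/2}$. The claim then is Gelfand's formula.

  That compositions are again free holomorphic follows from a characterisation of free holomorphic
  functions as those maps that respect intertwining operators, \<open>T X\<^sub>i = Y\<^sub>i T\<close> for all \<open>i\<close> implying
  \<open>T F(X) = F(Y) T\<close>: the operator $e_\alpha \mapsto s^{-|\alpha|} X_\alpha h$ intertwines $sS$
  and $X$, so that $F(X) h$ is read off from $F(sS) e_\emptyset$.\<close>

section \<open>Complex Hilbert spaces\<close>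

text \<open>The Hardy space is a set of functions, not a Banach space type. It is therefore
  identified with the closed span of the e_\<alpha> in H, and a bounded operator on it is extended
  to H by zero on the orthogonal complement. This respects positive powers and, away from 0, the
  spectrum. The value 0 does no harm: composition operators fix the constants, so 1 lies in the
  spectrum and the spectral radius is at least 1.

  The scalar s < 1 is there because the unscaled shifts form a row of norm 1, outside the open ball,
  where nothing is known of \<psi>. The estimate is uniform in s, and s tends to 1 only after
  restriction to finitely many coefficients. The relation for M_i^* comes from \<open>e []\<close>
  being orthogonal to the ranges of all shifts. The factor sqrt 2 is the room between 1 -
  |\<lambda>|^2 and 1 - |\<lambda>|, whose quotient 1 + |\<lambda>| lies between 1 and 2; it
  disappears under the k-th root.\<close>

instance complex_hilbert \<subseteq> banach ..

lemma cinner_add_right: "cinner x (y + z) = cinner x y + cinner x z"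
  by (metis cinner_add_left cinner_commute complex_cnj_add)

lemma cinner_scaleC_right: "cinner x (scaleC c y) = cnj c * cinner x y"
  by (metis cinner_scaleC_left cinner_commute complex_cnj_mult)

lemma cinner_self: "cinner x x = of_real ((norm x)\<^sup>2)"
proof -
  have "Im (cinner x x) = 0"
    using arg_cong[OF cinner_commute[of x x], of Im] by simp
  moreover have "Re (cinner x x) = (norm x)\<^sup>2"
    by (simp add: power2_norm_eq_inner inner_eq_Re_cinner)
  ultimately show ?thesis by (simp add: complex_eq_iff)
qed

lemma cinner_scaleR_left: "cinner (scaleR r x) y = scaleR r (cinner x y)"
  using cinner_scaleC_left[of "of_real r" x y] by (simp add: scaleC_of_real scaleR_conv_of_real)

lemma cinner_scaleR_right: "cinner x (scaleR r y) = scaleR r (cinner x y)"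
  using cinner_scaleC_right[of x "of_real r" y] by (simp add: scaleC_of_real scaleR_conv_of_real)

lemma cinner_Cauchy_Schwarz: "cmod (cinner x y) \<le> norm x * norm y"
proof -
  \<comment> \<open>Rotating x by this phase makes the inner product real and nonnegative, so the
    real inequality applies.\<close>
  let ?u = "cnj (sgn (cinner x y))"
  have "complex_of_real (cmod (cinner x y)) = ?u * cinner x y"
    by (cases "cinner x y = 0")
      (simp_all add: sgn_eq complex_norm_square[symmetric] power2_eq_square field_simps flip: complex_norm_square)
  then have "cmod (cinner x y) = inner (scaleC ?u x) y"
    by (metis Re_complex_of_real cinner_scaleC_left inner_eq_Re_cinner)
  also have "\<dots> \<le> norm (scaleC ?u x) * norm y" by (rule norm_cauchy_schwarz)
  also have "\<dots> \<le> norm x * norm y"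
    by (intro mult_right_mono) (auto simp: norm_scaleC norm_sgn)
  finally show ?thesis .
qed

lemma real_cinner_le:
  assumes "complex_of_real S = cinner x y"
  shows "S \<le> norm x * norm y"
proof -
  have "\<bar>S\<bar> \<le> norm x * norm y"
    using cinner_Cauchy_Schwarz[of x y] by (simp flip: assms)
  then show ?thesis by linarith
qed

interpretation cinner: bounded_bilinear cinner
  by (rule bounded_bilinear.intro)
    (auto simp: cinner_add_left cinner_add_right cinner_scaleR_left cinner_scaleR_right
      intro!: exI[of _ 1] cinner_Cauchy_Schwarz)

interpretation scaleC: bounded_bilinear "scaleC :: complex \<Rightarrow> 'a \<Rightarrow> 'a::complex_hilbert"
proof (rule bounded_bilinear.intro)
  show "scaleC (scaleR r c) x = scaleR r (scaleC c x)" for r c and x :: 'a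
    by (simp add: scaleC_of_real[symmetric] scaleC_scaleC scaleR_conv_of_real)
  show "scaleC c (scaleR r x) = scaleR r (scaleC c x)" for r c and x :: 'a
    by (simp add: scaleC_of_real[symmetric] scaleC_scaleC mult.commute)
qed (auto simp: scaleC_add_left scaleC_add_right norm_scaleC intro!: exI[of _ 1])

section \<open>Riesz representation and adjoints\<close>

lemma cinner_eqI: "(\<And>z. cinner z x = cinner z y) \<Longrightarrow> x = y"
proof -
  assume "\<And>z. cinner z x = cinner z y"
  then have "cinner (x - y) (x - y) = 0" by (simp add: cinner.diff_right)
  then show "x = y" by (simp add: cinner_self)
qed

text \<open>Variational argument: z minimises |x|^2 - 2 g(x). The parallelogram identity makes a
  minimising sequence Cauchy, and the first-order condition at the minimum is g(x) = <z, x>.\<close>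

lemma real_Riesz:
  fixes g :: "'a::{real_inner, complete_space} \<Rightarrow> real"
  assumes "bounded_linear g"
  shows "\<exists>z. \<forall>x. g x = inner z x"
proof -
  interpret g: bounded_linear g by fact
  obtain K where K: "\<And>x. norm (g x) \<le> norm x * K" using g.bounded by blast
  define J where "J x = (norm x)\<^sup>2 - 2 * g x" for x
  have Jb: "J x \<ge> - K\<^sup>2" for x
  proof -
    have "0 \<le> (norm x - K)\<^sup>2" by simp
    then show ?thesis using K[of x] by (simp add: J_def power2_diff algebra_simps abs_le_iff)
  qed
  then have bdd: "bdd_below (range J)" by (rule bdd_belowI2)
  define m where "m = Inf (range J)"
  have m: "m \<le> J x" for x unfolding m_def by (rule cInf_lower) (use bdd in auto)
  have "\<exists>x. J x < m + 1 / (real n + 1)" for n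
    using cInf_lessD[of "range J" "m + 1 / (real n + 1)"] by (auto simp: m_def)
  then obtain X where X: "\<And>n. J (X n) < m + 1 / (real n + 1)" by metis
  have par: "(norm (x - y))\<^sup>2 = 2 * J x + 2 * J y - 4 * J ((1/2) *\<^sub>R (x + y))" for x y
    unfolding J_def g.scaleR g.add power2_norm_eq_inner
    by (simp add: inner_add inner_diff algebra_simps inner_commute)
  have "Cauchy X"
  proof (rule metric_CauchyI)
    fix e :: real assume "e > 0"
    then obtain N where N: "1 / (real N + 1) < e\<^sup>2 / 4"
      by (metis nat_approx_posE of_nat_Suc add.commute divide_pos_pos zero_less_numeral zero_less_power)
    have "dist (X i) (X j) < e" if "i \<ge> N" "j \<ge> N" for i j
    proof -
      have le: "1 / (real k + 1) \<le> 1 / (real N + 1)" if "k \<ge> N" for k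
        using that by (simp add: frac_le)
      have "(norm (X i - X j))\<^sup>2 < 4 * (1 / (real N + 1))"
        using par[of "X i" "X j"] m[of "(1/2) *\<^sub>R (X i + X j)"] X[of i] X[of j]
          le[OF that(1)] le[OF that(2)] by linarith
      then have "(norm (X i - X j))\<^sup>2 < e\<^sup>2" using N by linarith
      then show ?thesis using \<open>e > 0\<close> by (simp add: dist_norm power2_less_imp_less)
    qed
    then show "\<exists>M. \<forall>i\<ge>M. \<forall>j\<ge>M. dist (X i) (X j) < e" by blast
  qed
  then obtain z where z: "X \<longlonglongrightarrow> z" using Cauchy_convergent_iff convergent_def by blast
  have "(\<lambda>n. J (X n)) \<longlonglongrightarrow> J z"
    unfolding J_def by (intro tendsto_intros z g.tendsto)
  moreover have "(\<lambda>n. m + 1 / (real n + 1)) \<longlonglongrightarrow> m + 0"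
    by (intro tendsto_intros) (use LIMSEQ_inverse_real_of_nat in \<open>simp add: inverse_eq_divide add.commute\<close>)
  ultimately have "J z \<le> m"
    using LIMSEQ_le[of "\<lambda>n. J (X n)" "J z" _ "m + 0"] X by (auto intro: less_imp_le)
  then have min: "J z \<le> J x" for x using m[of x] by linarith
  have "g x = inner z x" for x
  proof (rule ccontr)
    assume "g x \<noteq> inner z x"
    define d where "d = g x - inner z x"
    have d: "d \<noteq> 0" using \<open>g x \<noteq> inner z x\<close> by (simp add: d_def)
    have q: "2 * t * d \<le> t\<^sup>2 * (norm x)\<^sup>2" for t
      using min[of "z + t *\<^sub>R x"]
      unfolding J_def g.scaleR g.add power2_norm_eq_inner d_def
      by (simp add: inner_add algebra_simps inner_commute power2_eq_square)
    \<comment> \<open>The best t would be d / |x|^2; adding 1 avoids division by zero and still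
      leads to the contradiction.\<close>
    define N where "N = (norm x)\<^sup>2 + 1"
    have N: "N > 0" by (simp add: N_def add_nonneg_pos)
    have "2 * (d / N) * d \<le> (d / N)\<^sup>2 * (norm x)\<^sup>2" by (rule q)
    also have "\<dots> \<le> (d / N)\<^sup>2 * N" by (intro mult_left_mono) (auto simp: N_def)
    also have "\<dots> = (d / N) * d" using N by (simp add: power2_eq_square)
    finally have "d * d / N \<le> 0" by (simp)
    moreover have "d * d / N > 0" using d N not_real_square_gt_zero[of d] by (intro divide_pos_pos) blast+
    ultimately show False by linarith
  qed
  then show ?thesis by blast
qed

text \<open>A complex linear functional is determined by its real part, since Im f(x) = - Re f(\<i>
  x).\<close>

lemma complex_Riesz:
  fixes f :: "'a::complex_hilbert \<Rightarrow> complex"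
  assumes "bounded_linear f" and hom: "\<And>c x. f (scaleC c x) = c * f x"
  shows "\<exists>y. \<forall>x. f x = cinner x y"
proof -
  have "bounded_linear (\<lambda>x. Re (f x))"
    by (rule bounded_linear_compose[OF bounded_linear_Re assms(1)])
  then obtain y where y: "\<And>x. Re (f x) = inner y x" using real_Riesz by blast
  have "f x = cinner x y" for x
  proof (rule complex_eqI)
    have re: "Re (f z) = Re (cinner z y)" for z
      using y[of z] inner_eq_Re_cinner[of z y] by (simp add: inner_commute)
    show "Re (f x) = Re (cinner x y)" by (rule re)
    show "Im (f x) = Im (cinner x y)"
      using re[of "scaleC \<i> x"] by (simp add: hom cinner_scaleC_left)
  qed
  then show ?thesis by blast
qed

lemma complex_opsD: "A \<in> complex_ops \<Longrightarrow> A (scaleC c x) = scaleC c (A x)"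
  by (simp add: complex_ops_def)

text \<open>\<open>cadjoint\<close> is a definite description, so existence has to come first. Riesz
  supplies B y for each y, and |B y|^2 = <A B y, y> bounds B by the norm of A.\<close>

lemma adjoint_exists:
  fixes A :: "'a::complex_hilbert \<Rightarrow>\<^sub>L 'a"
  assumes A: "A \<in> complex_ops"
  shows "\<exists>B\<in>complex_ops. \<forall>x y. cinner (A x) y = cinner x (blinfun_apply B y)"
proof -
  have "\<exists>z. \<forall>x. cinner (A x) y = cinner x z" for y
  proof (rule complex_Riesz)
    show "bounded_linear (\<lambda>x. cinner (A x) y)"
      using bounded_linear_compose[OF cinner.bounded_linear_left blinfun.bounded_linear_right] by blast
  qed (simp add: complex_opsD[OF A] cinner_scaleC_left)
  then obtain B where B: "\<And>x y. cinner (A x) y = cinner x (B y)" by metis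
  have sc: "B (scaleC c y) = scaleC c (B y)" for c y
    by (rule cinner_eqI) (simp add: B[symmetric] cinner_scaleC_right)
  have "bounded_linear B"
  proof (rule bounded_linear_intro[where K = "norm A"])
    show "B (x + y) = B x + B y" for x y
      by (rule cinner_eqI) (simp add: B[symmetric] cinner_add_right)
    show "B (scaleR r x) = scaleR r (B x)" for r x
      using sc[of "of_real r"] by (simp add: scaleC_of_real)
    show "norm (B y) \<le> norm y * norm A" for y
    proof -
      have "(norm (B y))\<^sup>2 = cmod (cinner (A (B y)) y)"
        by (simp add: B cinner_self norm_power)
      also have "\<dots> \<le> norm (A (B y)) * norm y" by (rule cinner_Cauchy_Schwarz)
      also have "\<dots> \<le> (norm A * norm (B y)) * norm y"
        by (intro mult_right_mono norm_blinfun) auto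
      finally have "norm (B y) * norm (B y) \<le> norm (B y) * (norm y * norm A)"
        by (simp add: power2_eq_square mult_ac)
      then show ?thesis
        by (cases "norm (B y) = 0") (auto simp: mult_le_cancel_left)
    qed
  qed
  then show ?thesis
    by (intro bexI[of _ "Blinfun B"]) (auto simp: bounded_linear_Blinfun_apply B complex_ops_def sc)
qed

lemma cadjoint_eqI:
  assumes "\<And>x y. cinner (blinfun_apply A x) y = cinner x (blinfun_apply B y)"
  shows "cadjoint A = B"
  unfolding cadjoint_def
proof (rule the_equality)
  fix B' assume "\<forall>x y. cinner (blinfun_apply A x) y = cinner x (blinfun_apply B' y)"
  then show "B' = B" using assms by (intro blinfun_eqI cinner_eqI) metis
qed (use assms in blast)

lemma
  assumes "A \<in> complex_ops"
  shows cinner_cadjoint: "cinner (blinfun_apply A x) y = cinner x (blinfun_apply (cadjoint A) y)"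
    and cadjoint_complex_ops: "cadjoint A \<in> complex_ops"
  using adjoint_exists[OF assms] cadjoint_eqI[of A] by auto

section \<open>Complex linear operators and row contractions\<close>

lemma scale_op_apply [simp]: "blinfun_apply (scale_op c A) x = scaleC c (blinfun_apply A x)"
  by (simp add: scale_op.rep_eq)

lemma norm_scale_op: "norm (scale_op c A) = cmod c * norm (A :: 'a::complex_hilbert \<Rightarrow>\<^sub>L 'a)"
proof (rule antisym)
  have le: "norm (scale_op d B) \<le> cmod d * norm B" for d and B :: "'a \<Rightarrow>\<^sub>L 'a"
    by (rule norm_blinfun_bound)
      (auto simp: norm_scaleC mult.assoc intro!: mult_left_mono norm_blinfun)
  show "norm (scale_op c A) \<le> cmod c * norm A" by (rule le)
  show "cmod c * norm A \<le> norm (scale_op c A)"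
  proof (cases "c = 0")
    case False
    have "scale_op (inverse c) (scale_op c A) = A"
      using False by (intro blinfun_eqI) (simp add: scaleC_scaleC scaleC_one)
    then have "norm A \<le> inverse (cmod c) * norm (scale_op c A)"
      using le[of "inverse c" "scale_op c A"] by (simp only: norm_inverse)
    then have "cmod c * norm A \<le> cmod c * (inverse (cmod c) * norm (scale_op c A))"
      by (rule mult_left_mono) simp
    then show ?thesis using False by (simp only: mult.assoc[symmetric]) simp
  qed simp
qed

lemma id_complex_ops: "id_blinfun \<in> complex_ops"
  by (simp add: complex_ops_def)

lemma zero_complex_ops: "0 \<in> complex_ops"
  by (simp add: complex_ops_def scaleC.zero_right)

lemma compose_complex_ops: "A \<in> complex_ops \<Longrightarrow> B \<in> complex_ops \<Longrightarrow> A o\<^sub>L B \<in> complex_ops"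
  by (simp add: complex_ops_def)

lemma add_complex_ops: "A \<in> complex_ops \<Longrightarrow> B \<in> complex_ops \<Longrightarrow> A + B \<in> complex_ops"
  by (simp add: complex_ops_def blinfun.add_left scaleC_add_right)

lemma diff_complex_ops: "A \<in> complex_ops \<Longrightarrow> B \<in> complex_ops \<Longrightarrow> A - B \<in> complex_ops"
  by (simp add: complex_ops_def blinfun.diff_left scaleC.diff_right)

lemma scale_complex_ops: "A \<in> complex_ops \<Longrightarrow> scale_op c A \<in> complex_ops"
  by (simp add: complex_ops_def scaleC_scaleC mult.commute)

lemma sum_complex_ops: "(\<And>i. i \<in> I \<Longrightarrow> A i \<in> complex_ops) \<Longrightarrow> sum A I \<in> complex_ops"
  by (induction I rule: infinite_finite_induct) (auto intro: zero_complex_ops add_complex_ops)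

text \<open>Neumann series converge in the real Banach space of all bounded maps; closedness keeps
  their sums complex linear.\<close>

lemma closed_complex_ops: "closed (complex_ops :: ('a::complex_hilbert \<Rightarrow>\<^sub>L 'a) set)"
proof -
  have eq: "(complex_ops :: ('a \<Rightarrow>\<^sub>L 'a) set) = (\<Inter>c x. {A. blinfun_apply A (scaleC c x) = scaleC c (blinfun_apply A x)})"
    by (auto simp: complex_ops_def)
  have "closed {A. blinfun_apply A (scaleC c x) = scaleC c (blinfun_apply A x)}" for c :: complex and x :: 'a
    by (intro closed_Collect_eq continuous_intros scaleC.continuous_on)
  then show ?thesis unfolding eq by (intro closed_INT ballI)
qed

lemma sums_complex_ops:
  assumes "\<And>k. A k \<in> complex_ops" "A sums S"
  shows "S \<in> complex_ops"
  using closed_sequentially[OF closed_complex_ops _ assms(2)[unfolded sums_def]]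
  by (simp add: sum_complex_ops assms(1))

lemma word_op_append: "word_op X (\<alpha> @ \<beta>) = word_op X \<alpha> o\<^sub>L word_op X \<beta>"
  by (induction \<alpha>) (auto intro: blinfun_eqI)

lemma word_op_complex_ops: "(\<And>i. X i \<in> complex_ops) \<Longrightarrow> word_op X \<alpha> \<in> complex_ops"
  by (induction \<alpha>) (auto intro: id_complex_ops compose_complex_ops)

section \<open>Sums over words graded by length\<close>

lemma finite_words [simp]: "finite {\<alpha> :: 'n::finite list. length \<alpha> = k}"
  using finite_lists_length_eq[of "UNIV :: 'n set" k] by simp

lemma finite_words_le [simp]: "finite {\<alpha> :: 'n::finite list. length \<alpha> \<le> k}"
  using finite_lists_length_le[of "UNIV :: 'n set" k] by simp

lemma words_0 [simp]: "{\<alpha> :: 'n list. length \<alpha> = 0} = {[]}"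
  by auto

lemma sum_words_Suc:
  fixes f :: "'n::finite list \<Rightarrow> 'b::comm_monoid_add"
  shows "(\<Sum>\<alpha> | length \<alpha> = Suc k. f \<alpha>) = (\<Sum>i\<in>UNIV. \<Sum>\<alpha> | length \<alpha> = k. f (i # \<alpha>))"
proof -
  have "(\<Sum>i\<in>UNIV. \<Sum>\<alpha> | length \<alpha> = k. f (i # \<alpha>)) = (\<Sum>(i, \<alpha>)\<in>UNIV \<times> {\<alpha>. length \<alpha> = k}. f (i # \<alpha>))"
    by (simp add: sum.cartesian_product)
  also have "\<dots> = (\<Sum>\<alpha> | length \<alpha> = Suc k. f \<alpha>)"
    by (rule sum.reindex_bij_witness[of _ "\<lambda>\<alpha>. (hd \<alpha>, tl \<alpha>)" "\<lambda>(i, \<alpha>). i # \<alpha>"])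
      (auto simp: length_Suc_conv)
  finally show ?thesis by simp
qed

text \<open>Peeling off the last letter is the right recursion where factors are added on the right
  of M_\<alpha>: in the telescoping sum for adjoints and in right division.\<close>

lemma sum_words_Suc_snoc:
  fixes f :: "'n::finite list \<Rightarrow> 'b::comm_monoid_add"
  shows "(\<Sum>\<alpha> | length \<alpha> = Suc k. f \<alpha>) = (\<Sum>\<alpha> | length \<alpha> = k. \<Sum>i\<in>UNIV. f (\<alpha> @ [i]))"
proof -
  have "(\<Sum>\<alpha> | length \<alpha> = k. \<Sum>i\<in>UNIV. f (\<alpha> @ [i])) = (\<Sum>(\<alpha>, i)\<in>{\<alpha>. length \<alpha> = k} \<times> UNIV. f (\<alpha> @ [i]))"
    by (simp add: sum.cartesian_product)
  also have "\<dots> = (\<Sum>\<alpha> | length \<alpha> = Suc k. f \<alpha>)"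
    by (rule sum.reindex_bij_witness[of _ "\<lambda>\<alpha>. (butlast \<alpha>, last \<alpha>)" "\<lambda>(\<alpha>, i). \<alpha> @ [i]"])
      (auto intro!: append_butlast_last_id)
  finally show ?thesis by simp
qed

lemma sum_words_le:
  fixes f :: "'n::finite list \<Rightarrow> 'b::comm_monoid_add"
  shows "(\<Sum>\<alpha> | length \<alpha> \<le> m. f \<alpha>) = (\<Sum>k\<le>m. \<Sum>\<alpha> | length \<alpha> = k. f \<alpha>)"
proof (induction m)
  case (Suc m)
  have "{\<alpha> :: 'n list. length \<alpha> \<le> Suc m} = {\<alpha>. length \<alpha> \<le> m} \<union> {\<alpha>. length \<alpha> = Suc m}" by auto
  then have "(\<Sum>\<alpha> | length \<alpha> \<le> Suc m. f \<alpha>)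
      = (\<Sum>\<alpha> | length \<alpha> \<le> m. f \<alpha>) + (\<Sum>\<alpha> | length \<alpha> = Suc m. f \<alpha>)"
    by (simp only:) (rule sum.union_disjoint, auto)
  then show ?case by (simp add: Suc)
qed simp

text \<open>The row (X_1, ..., X_n), as an operator from the n-fold direct sum of H to H, has norm
  at most |r|. The inequality between quadratic sums spares a type for the direct sum.\<close>

definition row_bound :: "('n::finite, 'a::complex_hilbert) op_tuple \<Rightarrow> real \<Rightarrow> bool" where
  "row_bound X r \<longleftrightarrow> (\<forall>x. (norm (\<Sum>i\<in>UNIV. blinfun_apply (X i) (x i)))\<^sup>2 \<le> r\<^sup>2 * (\<Sum>i\<in>UNIV. (norm (x i))\<^sup>2))"

lemma row_boundD:
  "row_bound X r \<Longrightarrow> (norm (\<Sum>i\<in>UNIV. blinfun_apply (X i) (x i)))\<^sup>2 \<le> r\<^sup>2 * (\<Sum>i\<in>UNIV. (norm (x i))\<^sup>2)"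
  by (simp add: row_bound_def)

text \<open>The row operator and the column of the adjoints are adjoint to each other, hence have
  the same norm. In both directions Cauchy-Schwarz bounds a square and one factor is
  cancelled.\<close>

lemma row_bound_iff_column:
  fixes X :: "('n::finite, 'a::complex_hilbert) op_tuple"
  assumes X: "\<And>i. X i \<in> complex_ops"
  shows "row_bound X r \<longleftrightarrow> (\<forall>y. (\<Sum>i\<in>UNIV. (norm (cadjoint (X i) y))\<^sup>2) \<le> r\<^sup>2 * (norm y)\<^sup>2)"
proof safe
  fix y assume r: "row_bound X r"
  define S where "S = (\<Sum>i\<in>UNIV. (norm (cadjoint (X i) y))\<^sup>2)"
  define z where "z = (\<Sum>i\<in>UNIV. X i (cadjoint (X i) y))"
  have "complex_of_real S = cinner z y"
    by (simp add: S_def z_def cinner.sum_left cinner_cadjoint[OF X] cinner_self)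
  then have "S \<le> norm z * norm y" by (rule real_cinner_le)
  moreover have "S \<ge> 0" by (simp add: S_def sum_nonneg)
  ultimately have "S\<^sup>2 \<le> (norm z)\<^sup>2 * (norm y)\<^sup>2"
    using power_mono[of S "norm z * norm y" 2] by (simp add: power_mult_distrib)
  also have "\<dots> \<le> (r\<^sup>2 * S) * (norm y)\<^sup>2"
    unfolding z_def S_def by (intro mult_right_mono row_boundD[OF r]) auto
  finally have "S * S \<le> S * (r\<^sup>2 * (norm y)\<^sup>2)" by (simp add: power2_eq_square mult_ac)
  then show "S \<le> r\<^sup>2 * (norm y)\<^sup>2"
    using \<open>S \<ge> 0\<close> by (cases "S = 0") (simp_all add: mult_le_cancel_left_pos del: mult_le_cancel_left)
next
  assume c: "\<forall>y. (\<Sum>i\<in>UNIV. (norm (cadjoint (X i) y))\<^sup>2) \<le> r\<^sup>2 * (norm y)\<^sup>2"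
  show "row_bound X r" unfolding row_bound_def
  proof
    fix x :: "'n \<Rightarrow> 'a"
    define z where "z = (\<Sum>i\<in>UNIV. X i (x i))"
    have "(norm z)\<^sup>2 = cmod (cinner z z)" by (simp add: cinner_self norm_power)
    also have "cinner z z = (\<Sum>i\<in>UNIV. cinner (x i) (cadjoint (X i) z))"
      by (subst (1) z_def) (simp add: cinner.sum_left cinner_cadjoint[OF X])
    also have "cmod \<dots> \<le> (\<Sum>i\<in>UNIV. norm (x i) * norm (cadjoint (X i) z))"
      by (intro order_trans[OF norm_sum] sum_mono cinner_Cauchy_Schwarz)
    finally have "(norm z)\<^sup>2 \<le> (\<Sum>i\<in>UNIV. norm (x i) * norm (cadjoint (X i) z))" .
    then have "((norm z)\<^sup>2)\<^sup>2 \<le> (\<Sum>i\<in>UNIV. norm (x i) * norm (cadjoint (X i) z))\<^sup>2"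
      by (intro power_mono) auto
    also have "\<dots> \<le> (\<Sum>i\<in>UNIV. (norm (x i))\<^sup>2) * (\<Sum>i\<in>UNIV. (norm (cadjoint (X i) z))\<^sup>2)"
      by (rule Cauchy_Schwarz_ineq_sum)
    also have "\<dots> \<le> (\<Sum>i\<in>UNIV. (norm (x i))\<^sup>2) * (r\<^sup>2 * (norm z)\<^sup>2)"
      using c by (intro mult_left_mono) (auto intro: sum_nonneg)
    finally have "(norm z)\<^sup>2 * (norm z)\<^sup>2 \<le> (norm z)\<^sup>2 * (r\<^sup>2 * (\<Sum>i\<in>UNIV. (norm (x i))\<^sup>2))"
      by (simp add: power2_eq_square mult_ac)
    then show "(norm (\<Sum>i\<in>UNIV. X i (x i)))\<^sup>2 \<le> r\<^sup>2 * (\<Sum>i\<in>UNIV. (norm (x i))\<^sup>2)"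
      unfolding z_def[symmetric]
      by (cases "norm z = 0") (simp add: sum_nonneg, subst (asm) mult_le_cancel_left_pos, simp_all)
  qed
qed

lemma nc_ball_complex_ops: "X \<in> nc_ball \<Longrightarrow> X i \<in> complex_ops"
  by (simp add: nc_ball_def)

text \<open>The strict inequality that defines the ball leaves room for a radius r < 1, on which the
  geometric series below rest.\<close>

lemma nc_ball_row_bound:
  fixes X :: "('n::finite, 'a::complex_hilbert) op_tuple"
  assumes "X \<in> nc_ball"
  obtains r where "0 \<le> r" "r < 1" "row_bound X r"
proof
  let ?A = "\<Sum>i\<in>UNIV. X i o\<^sub>L cadjoint (X i)"
  have X: "X i \<in> complex_ops" for i using assms by (simp add: nc_ball_def)
  show "0 \<le> sqrt (norm ?A)" by simp
  show "sqrt (norm ?A) < 1" using assms by (simp add: nc_ball_def)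
  show "row_bound X (sqrt (norm ?A))" unfolding row_bound_iff_column[OF X]
  proof
    fix y
    have "complex_of_real (\<Sum>i\<in>UNIV. (norm (cadjoint (X i) y))\<^sup>2) = cinner (?A y) y"
      by (simp add: blinfun.sum_left cinner.sum_left cinner_cadjoint[OF X] cinner_self)
    then have "(\<Sum>i\<in>UNIV. (norm (cadjoint (X i) y))\<^sup>2) \<le> norm (?A y) * norm y"
      by (rule real_cinner_le)
    also have "\<dots> \<le> (norm ?A * norm y) * norm y"
      by (intro mult_right_mono norm_blinfun) auto
    finally show "(\<Sum>i\<in>UNIV. (norm (cadjoint (X i) y))\<^sup>2) \<le> (sqrt (norm ?A))\<^sup>2 * (norm y)\<^sup>2"
      by (simp add: power2_eq_square mult.assoc)
  qed
qed

lemma nc_ballI: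
  fixes X :: "('n::finite, 'a::complex_hilbert) op_tuple"
  assumes X: "\<And>i. X i \<in> complex_ops" and r: "0 \<le> r" "r < 1" "row_bound X r"
  shows "X \<in> nc_ball"
proof -
  let ?A = "\<Sum>i\<in>UNIV. X i o\<^sub>L cadjoint (X i)"
  have "norm ?A \<le> r\<^sup>2"
  proof (rule norm_blinfun_bound)
    fix y
    have "(norm (?A y))\<^sup>2 \<le> r\<^sup>2 * (\<Sum>i\<in>UNIV. (norm (cadjoint (X i) y))\<^sup>2)"
      using row_boundD[OF r(3)] by (simp add: blinfun.sum_left)
    also have "\<dots> \<le> r\<^sup>2 * (r\<^sup>2 * (norm y)\<^sup>2)"
      using r(3) unfolding row_bound_iff_column[OF X] by (intro mult_left_mono) auto
    also have "\<dots> = (r\<^sup>2 * norm y)\<^sup>2" by (simp add: power_mult_distrib power2_eq_square)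
    finally show "norm (?A y) \<le> r\<^sup>2 * norm y"
      by (rule power2_le_imp_le) auto
  qed simp
  also have "r\<^sup>2 < 1" using r by (simp add: power_less_one_iff)
  finally show ?thesis using X by (simp add: nc_ball_def)
qed

text \<open>The X_\<alpha> with |\<alpha>| = k form a row themselves, a k-fold iteration of the
  original one, whence the bound r^k. A triangle inequality over all words of length k would lose
  this.\<close>

lemma row_bound_words:
  fixes X :: "('n::finite, 'a::complex_hilbert) op_tuple"
  assumes r: "row_bound X r"
  shows "(norm (\<Sum>\<alpha> | length \<alpha> = k. word_op X \<alpha> (x \<alpha>)))\<^sup>2
    \<le> r ^ (2 * k) * (\<Sum>\<alpha> | length \<alpha> = k. (norm (x \<alpha>))\<^sup>2)"
proof (induction k arbitrary: x)
  case (Suc k)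
  have "(\<Sum>\<alpha> | length \<alpha> = Suc k. word_op X \<alpha> (x \<alpha>))
      = (\<Sum>i\<in>UNIV. X i (\<Sum>\<alpha> | length \<alpha> = k. word_op X \<alpha> (x (i # \<alpha>))))"
    by (simp add: sum_words_Suc blinfun.sum_right)
  also have "(norm \<dots>)\<^sup>2 \<le> r\<^sup>2 * (\<Sum>i\<in>UNIV. (norm (\<Sum>\<alpha> | length \<alpha> = k. word_op X \<alpha> (x (i # \<alpha>))))\<^sup>2)"
    by (rule row_boundD[OF r])
  also have "\<dots> \<le> r\<^sup>2 * (\<Sum>i\<in>UNIV. r ^ (2 * k) * (\<Sum>\<alpha> | length \<alpha> = k. (norm (x (i # \<alpha>)))\<^sup>2))"
    by (intro mult_left_mono sum_mono Suc) auto
  also have "\<dots> = r ^ (2 * Suc k) * (\<Sum>\<alpha> | length \<alpha> = Suc k. (norm (x \<alpha>))\<^sup>2)"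
    by (simp add: sum_words_Suc sum_distrib_left power2_eq_square mult_ac)
  finally show ?case .
qed simp

abbreviation level_norm :: "('n::finite list \<Rightarrow> complex) \<Rightarrow> nat \<Rightarrow> real" where
  "level_norm a k \<equiv> L2_set (\<lambda>\<alpha>. cmod (a \<alpha>)) {\<alpha>. length \<alpha> = k}"

text \<open>The row bound is applied to the column with entries
  \<open>scaleC (a \<alpha>) h\<close>.\<close>

lemma norm_level_apply_le:
  fixes X :: "('n::finite, 'a::complex_hilbert) op_tuple"
  assumes r: "row_bound X r" "0 \<le> r" and X: "\<And>i. X i \<in> complex_ops"
  shows "norm (\<Sum>\<alpha> | length \<alpha> = k. scaleC (a \<alpha>) (word_op X \<alpha> h)) \<le> level_norm a k * r ^ k * norm h"
proof (rule power2_le_imp_le)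
  have *: "word_op X \<alpha> (scaleC c x) = scaleC c (word_op X \<alpha> x)" for \<alpha> c x
    by (rule complex_opsD[OF word_op_complex_ops]) (rule X)
  have "(norm (\<Sum>\<alpha> | length \<alpha> = k. word_op X \<alpha> (scaleC (a \<alpha>) h)))\<^sup>2
      \<le> r ^ (2 * k) * (\<Sum>\<alpha> | length \<alpha> = k. (norm (scaleC (a \<alpha>) h))\<^sup>2)"
    by (rule row_bound_words[OF r(1)])
  then show "(norm (\<Sum>\<alpha> | length \<alpha> = k. scaleC (a \<alpha>) (word_op X \<alpha> h)))\<^sup>2
      \<le> (level_norm a k * r ^ k * norm h)\<^sup>2"
    by (simp add: * norm_scaleC power_mult_distrib L2_set_def sum_nonneg sum_distrib_left[symmetric]
        power_mult[symmetric] mult_ac)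
qed (use r in auto)

lemma norm_level_le:
  fixes X :: "('n::finite, 'a::complex_hilbert) op_tuple"
  assumes "row_bound X r" "0 \<le> r" "\<And>i. X i \<in> complex_ops"
  shows "norm (\<Sum>\<alpha> | length \<alpha> = k. scale_op (a \<alpha>) (word_op X \<alpha>)) \<le> level_norm a k * r ^ k"
  using norm_level_apply_le[OF assms] assms(2)
  by (intro norm_blinfun_bound) (auto simp: blinfun.sum_left)

section \<open>Orthonormal families indexed by words\<close>

text \<open>Gram-Schmidt: finitely many vectors never span, so a vector outside their span minus its
  projection is nonzero.\<close>

lemma exists_orthonormal_sequence:
  assumes inf: "\<not> (\<exists>B :: 'a::complex_hilbert set. finite B \<and> module.span scaleC B = UNIV)"
  shows "\<exists>f :: nat \<Rightarrow> 'a. \<forall>m n. cinner (f m) (f n) = (if m = n then 1 else 0)"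
proof -
  interpret V: vector_space "scaleC :: complex \<Rightarrow> 'a \<Rightarrow> 'a" by (rule vector_space_scaleC)
  \<comment> \<open>Orthogonality is asked only against earlier members, because the choice
    principle wants a predicate that looks at f below n only.\<close>
  define P where "P f n v \<longleftrightarrow> norm v = 1 \<and> (\<forall>m<n. cinner v (f m) = 0)" for f :: "nat \<Rightarrow> 'a" and n v
  have "\<exists>f. \<forall>n. P f n (f n)"
  proof (rule dependent_wellorder_choice)
    fix n and f :: "nat \<Rightarrow> 'a"
    assume f: "\<And>m. m < n \<Longrightarrow> P f m (f m)"
    have orth: "cinner (f i) (f j) = (if i = j then 1 else 0)" if "i < n" "j < n" for i j
    proof (cases i j rule: linorder_cases)
      case less
      then show ?thesis using f[OF that(2)] cinner_commute[of "f i" "f j"] by (simp add: P_def)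
    next
      case equal
      then show ?thesis using f[OF that(2)] by (simp add: P_def cinner_self)
    next
      case greater
      then show ?thesis using f[OF that(1)] by (simp add: P_def)
    qed
    have "V.span (f ` {..<n}) \<noteq> UNIV" using inf by (metis finite_imageI finite_lessThan)
    then obtain x where x: "x \<notin> V.span (f ` {..<n})" by blast
    define u where "u = x - (\<Sum>m<n. scaleC (cinner x (f m)) (f m))"
    have "(\<Sum>m<n. scaleC (cinner x (f m)) (f m)) \<in> V.span (f ` {..<n})"
      by (intro V.span_sum V.span_scale V.span_base) auto
    then have "u \<noteq> 0" using x by (auto simp: u_def)
    have "cinner u (f k) = 0" if "k < n" for k
    proof -
      have "(\<Sum>m<n. cinner x (f m) * cinner (f m) (f k)) = (\<Sum>m<n. if m = k then cinner x (f k) else 0)"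
        by (intro sum.cong) (auto simp: orth that)
      then show ?thesis
        using that by (simp add: u_def cinner.diff_left cinner.sum_left cinner_scaleC_left)
    qed
    then have "P f n (scaleR (1 / norm u) u)"
      using \<open>u \<noteq> 0\<close> by (simp add: P_def cinner_scaleR_left)
    then show "\<exists>r. P f n r" ..
  qed (simp add: P_def)
  then obtain f where f: "\<And>n. P f n (f n)" by blast
  have "cinner (f m) (f n) = (if m = n then 1 else 0)" for m n
    using f[of m] f[of n] cinner_commute[of "f m" "f n"]
    by (cases m n rule: linorder_cases) (auto simp: P_def cinner_self)
  then show ?thesis by blast
qed

section \<open>Square-summable families and Bessel bounds\<close>

abbreviation ell2 :: "('b \<Rightarrow> complex) \<Rightarrow> bool" where
  "ell2 a \<equiv> (\<lambda>\<alpha>. (cmod (a \<alpha>))\<^sup>2) summable_on UNIV"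

definition ell2_norm :: "('b \<Rightarrow> complex) \<Rightarrow> real" where
  "ell2_norm a = sqrt (\<Sum>\<^sub>\<infinity>\<alpha>. (cmod (a \<alpha>))\<^sup>2)"

lemma ell2_norm_nonneg [simp]: "0 \<le> ell2_norm a"
  by (simp add: ell2_norm_def infsum_nonneg)

lemma L2_set_le_ell2_norm: "ell2 a \<Longrightarrow> L2_set (\<lambda>\<alpha>. cmod (a \<alpha>)) F \<le> ell2_norm a"
  by (cases "finite F") (auto simp: L2_set_def ell2_norm_def intro!: finite_sum_le_infsum infsum_nonneg)

lemma
  assumes K: "\<And>F. finite F \<Longrightarrow> L2_set (\<lambda>\<alpha>. cmod (a \<alpha>)) F \<le> K"
  shows ell2I: "ell2 a" and ell2_norm_leI: "ell2_norm a \<le> K"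
proof -
  have K0: "0 \<le> K" using K[of "{}"] by simp
  have le: "(\<Sum>\<alpha>\<in>F. (cmod (a \<alpha>))\<^sup>2) \<le> K\<^sup>2" if "finite F" for F
    using sqrt_le_D[OF K[OF that, unfolded L2_set_def]] .
  show 1: "ell2 a"
    by (rule nonneg_bdd_above_summable_on) (auto intro!: bdd_aboveI le)
  have "(\<Sum>\<^sub>\<infinity>\<alpha>. (cmod (a \<alpha>))\<^sup>2) \<le> K\<^sup>2"
    by (rule infsum_le_finite_sums[OF 1]) (auto intro: le)
  then show "ell2_norm a \<le> K" unfolding ell2_norm_def by (rule real_le_lsqrt[OF K0])
qed

text \<open>Synthesis form of Bessel's inequality: forming the sum of c_\<alpha> v_\<alpha> is
  bounded by K in the ell2 norm of c. This is what lets an assignment of v_\<alpha> to e_\<alpha>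
  extend to a bounded operator.\<close>

definition bessel_bound :: "('b \<Rightarrow> 'a::complex_hilbert) \<Rightarrow> real \<Rightarrow> bool" where
  "bessel_bound v K \<longleftrightarrow> 0 \<le> K \<and>
     (\<forall>F c. finite F \<longrightarrow> norm (\<Sum>\<alpha>\<in>F. scaleC (c \<alpha>) (v \<alpha>)) \<le> K * L2_set (\<lambda>\<alpha>. cmod (c \<alpha>)) F)"

lemma
  fixes v :: "'b \<Rightarrow> 'a::complex_hilbert"
  assumes v: "bessel_bound v K" and c: "ell2 c"
  shows bessel_summable: "(\<lambda>\<alpha>. scaleC (c \<alpha>) (v \<alpha>)) summable_on UNIV"
    and bessel_norm_le: "norm (\<Sum>\<^sub>\<infinity>\<alpha>. scaleC (c \<alpha>) (v \<alpha>)) \<le> K * ell2_norm c"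
proof -
  let ?f = "\<lambda>\<alpha>. scaleC (c \<alpha>) (v \<alpha>)"
  define L where "L = (\<Sum>\<^sub>\<infinity>\<alpha>. (cmod (c \<alpha>))\<^sup>2)"
  have K: "0 \<le> K" and vF: "\<And>F c. finite F \<Longrightarrow> norm (\<Sum>\<alpha>\<in>F. scaleC (c \<alpha>) (v \<alpha>)) \<le> K * L2_set (\<lambda>\<alpha>. cmod (c \<alpha>)) F"
    using v by (auto simp: bessel_bound_def)
  have "\<exists>P. eventually P (finite_subsets_at_top UNIV) \<and>
      (\<forall>F F'. P F \<and> P F' \<longrightarrow> dist (sum ?f F) (sum ?f F') < e)" if "e > 0" for e
  proof -
    \<comment> \<open>Tails with square sum below d have images below e / 2; K + 1 keeps the
      quotient meaningful when K = 0.\<close>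
    define d where "d = (e / (2 * (K + 1)))\<^sup>2"
    have d: "d > 0" using K that by (simp add: d_def)
    obtain F0 where F0: "finite F0" "\<bar>(\<Sum>\<alpha>\<in>F0. (cmod (c \<alpha>))\<^sup>2) - L\<bar> \<le> d / 2"
      using infsum_finite_approximation[OF c, of "d / 2"] d by (auto simp: L_def dist_real_def)
    have near: "dist (sum ?f F) (sum ?f F0) < e / 2" if F: "finite F" "F0 \<subseteq> F" for F
    proof -
      have "(\<Sum>\<alpha>\<in>F. (cmod (c \<alpha>))\<^sup>2) \<le> L"
        unfolding L_def by (rule finite_sum_le_infsum[OF c]) (use F in auto)
      moreover have "L - (\<Sum>\<alpha>\<in>F0. (cmod (c \<alpha>))\<^sup>2) \<le> d / 2"
        using abs_le_D2[OF F0(2)] by simp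
      moreover have "(\<Sum>\<alpha>\<in>F - F0. (cmod (c \<alpha>))\<^sup>2) = (\<Sum>\<alpha>\<in>F. (cmod (c \<alpha>))\<^sup>2) - (\<Sum>\<alpha>\<in>F0. (cmod (c \<alpha>))\<^sup>2)"
        by (rule sum_diff[OF F])
      ultimately have "(\<Sum>\<alpha>\<in>F - F0. (cmod (c \<alpha>))\<^sup>2) < d" using d by linarith
      then have lt: "L2_set (\<lambda>\<alpha>. cmod (c \<alpha>)) (F - F0) < e / (2 * (K + 1))"
        unfolding L2_set_def d_def using K \<open>e > 0\<close> by (intro real_less_lsqrt) (auto simp: sum_nonneg)
      have "dist (sum ?f F) (sum ?f F0) = norm (sum ?f (F - F0))"
        using F F0(1) by (simp add: dist_norm sum_diff)
      also have "\<dots> \<le> K * L2_set (\<lambda>\<alpha>. cmod (c \<alpha>)) (F - F0)" using F by (intro vF) auto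
      also have "\<dots> \<le> (K + 1) * L2_set (\<lambda>\<alpha>. cmod (c \<alpha>)) (F - F0)" by (simp add: mult_right_mono)
      also have "\<dots> < (K + 1) * (e / (2 * (K + 1)))" using K lt by (intro mult_strict_left_mono) auto
      also have "\<dots> = e / 2" using K by (simp add: field_simps)
      finally show ?thesis .
    qed
    show ?thesis
    proof (intro exI conjI allI impI)
      show "eventually (\<lambda>F. finite F \<and> F0 \<subseteq> F) (finite_subsets_at_top UNIV)"
        using F0(1) by (auto simp: eventually_finite_subsets_at_top)
      fix F F' assume "(finite F \<and> F0 \<subseteq> F) \<and> (finite F' \<and> F0 \<subseteq> F')"
      then show "dist (sum ?f F) (sum ?f F') < e"
        by (auto intro!: dist_triangle_half_l[OF near near])
    qed
  qed
  then have "cauchy_filter (filtermap (sum ?f) (finite_subsets_at_top UNIV))"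
    by (simp add: cauchy_filter_metric_filtermap)
  moreover have "complete (UNIV :: 'a set)"
    by (rule complete_UNIV)
  ultimately obtain L' where "(sum ?f \<longlongrightarrow> L') (finite_subsets_at_top UNIV)"
    using complete_uniform[where S = "UNIV :: 'a set"] by (force simp add: filterlim_def)
  then have hs: "(?f has_sum L') UNIV" by (simp add: has_sum_def)
  then show "?f summable_on UNIV" by (auto simp: summable_on_def)
  have "norm L' \<le> K * ell2_norm c"
  proof (rule tendsto_le[OF _ tendsto_const tendsto_norm[OF hs[unfolded has_sum_def]]])
    show "\<forall>\<^sub>F F in finite_subsets_at_top UNIV. norm (sum ?f F) \<le> K * ell2_norm c"
    proof (rule eventually_finite_subsets_at_top_weakI)
      fix F :: "'b set" assume "finite F"
      then have "norm (sum ?f F) \<le> K * L2_set (\<lambda>\<alpha>. cmod (c \<alpha>)) F" by (rule vF)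
      also have "\<dots> \<le> K * ell2_norm c"
        by (intro mult_left_mono L2_set_le_ell2_norm c K)
      finally show "norm (sum ?f F) \<le> K * ell2_norm c" .
    qed
  qed simp
  then show "norm (infsum ?f UNIV) \<le> K * ell2_norm c" using infsumI[OF hs] by simp
qed

text \<open>The sets of words of length at most m are finite and eventually contain every finite set
  of words, so an unordered sum may be taken level by level.\<close>

lemma has_sum_words_imp_sums:
  fixes f :: "'n::finite list \<Rightarrow> 'b::real_normed_vector"
  assumes "(f has_sum S) UNIV"
  shows "(\<lambda>k. \<Sum>\<alpha> | length \<alpha> = k. f \<alpha>) sums S"
proof -
  have "filterlim (\<lambda>m. {\<alpha> :: 'n list. length \<alpha> \<le> m}) (finite_subsets_at_top UNIV) sequentially"
    unfolding filterlim_finite_subsets_at_top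
  proof (intro allI impI)
    fix F :: "'n list set" assume F: "finite F \<and> F \<subseteq> UNIV"
    then obtain m where m: "\<And>\<alpha>. \<alpha> \<in> F \<Longrightarrow> length \<alpha> \<le> m"
      using finite_nat_set_iff_bounded_le[of "length ` F"] by auto
    show "\<forall>\<^sub>F k in sequentially. finite {\<alpha> :: 'n list. length \<alpha> \<le> k} \<and> F \<subseteq> {\<alpha>. length \<alpha> \<le> k}
        \<and> {\<alpha> :: 'n list. length \<alpha> \<le> k} \<subseteq> UNIV"
      using eventually_ge_at_top[of m] by eventually_elim (use m in \<open>auto intro: order_trans\<close>)
  qed
  from filterlim_compose[OF assms[unfolded has_sum_def] this]
  show ?thesis unfolding sums_def_le sum_words_le .
qed

locale orthonormal_words =
  fixes e :: "'n::finite list \<Rightarrow> 'a::complex_hilbert"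
  assumes orth: "cinner (e \<alpha>) (e \<beta>) = (if \<alpha> = \<beta> then 1 else 0)"

lemma exists_orthonormal_words:
  assumes inf: "\<not> (\<exists>B :: 'a::complex_hilbert set. finite B \<and> module.span scaleC B = UNIV)"
  shows "\<exists>e :: 'n::finite list \<Rightarrow> 'a. orthonormal_words e"
proof -
  obtain f :: "nat \<Rightarrow> 'a" where f: "\<And>m n. cinner (f m) (f n) = (if m = n then 1 else 0)"
    using exists_orthonormal_sequence[OF inf] by metis
  have "orthonormal_words (\<lambda>\<alpha> :: 'n list. f (to_nat \<alpha>))"
    by unfold_locales (simp add: f)
  then show ?thesis by blast
qed

context orthonormal_words
begin

lemma norm_e [simp]: "norm (e \<alpha>) = 1"
proof -
  have "complex_of_real ((norm (e \<alpha>))\<^sup>2) = 1" using cinner_self[of "e \<alpha>"] orth[of \<alpha> \<alpha>] by simp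
  then show ?thesis using norm_ge_zero[of "e \<alpha>"] by (simp only: of_real_eq_1_iff) (auto simp: power2_eq_1_iff)
qed

text \<open>The injection g covers both the family itself and its images under the shifts, where g
  prepends a letter.\<close>

lemma norm_sum_e:
  assumes "finite F" "inj_on g F"
  shows "norm (\<Sum>\<alpha>\<in>F. scaleC (c \<alpha>) (e (g \<alpha>))) = L2_set (\<lambda>\<alpha>. cmod (c \<alpha>)) F"
proof -
  let ?y = "\<Sum>\<alpha>\<in>F. scaleC (c \<alpha>) (e (g \<alpha>))"
  have "cinner ?y ?y = (\<Sum>\<alpha>\<in>F. c \<alpha> * cinner (e (g \<alpha>)) ?y)"
    by (simp only: cinner.sum_left cinner_scaleC_left)
  also have "\<dots> = (\<Sum>\<alpha>\<in>F. c \<alpha> * cnj (c \<alpha>))"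
  proof (rule sum.cong[OF refl])
    fix \<alpha> assume "\<alpha> \<in> F"
    have "cinner (e (g \<alpha>)) ?y = (\<Sum>\<beta>\<in>F. if \<beta> = \<alpha> then cnj (c \<beta>) else 0)"
      unfolding cinner.sum_right cinner_scaleC_right orth
      using assms(2) \<open>\<alpha> \<in> F\<close> by (intro sum.cong) (auto dest: inj_onD)
    then show "c \<alpha> * cinner (e (g \<alpha>)) ?y = c \<alpha> * cnj (c \<alpha>)"
      using \<open>\<alpha> \<in> F\<close> assms(1) by simp
  qed
  also have "\<dots> = of_real (\<Sum>\<alpha>\<in>F. (cmod (c \<alpha>))\<^sup>2)"
    by (simp add: complex_norm_square del: of_real_power)
  finally have "(norm ?y)\<^sup>2 = (\<Sum>\<alpha>\<in>F. (cmod (c \<alpha>))\<^sup>2)"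
    by (simp only: cinner_self of_real_eq_iff)
  then show ?thesis by (simp add: L2_set_def real_sqrt_unique)
qed

lemma bessel_bound_e: "inj g \<Longrightarrow> bessel_bound (\<lambda>\<alpha>. e (g \<alpha>)) 1"
  by (auto simp: bessel_bound_def norm_sum_e inj_on_subset[OF _ subset_UNIV])

abbreviation coords :: "'a \<Rightarrow> 'n list \<Rightarrow> complex" where
  "coords h \<equiv> \<lambda>\<alpha>. cinner h (e \<alpha>)"

lemma L2_set_coords_le:
  assumes "finite F"
  shows "L2_set (\<lambda>\<alpha>. cmod (coords h \<alpha>)) F \<le> norm h"
proof -
  let ?y = "\<Sum>\<alpha>\<in>F. scaleC (coords h \<alpha>) (e \<alpha>)" and ?L = "L2_set (\<lambda>\<alpha>. cmod (coords h \<alpha>)) F"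
  have y: "norm ?y = ?L" using norm_sum_e[OF assms, of id] by simp
  have "complex_of_real (?L\<^sup>2) = cinner h ?y"
    by (simp add: cinner.sum_right cinner_scaleC_right L2_set_def sum_nonneg complex_norm_square mult.commute
        del: of_real_power)
  then have "?L\<^sup>2 \<le> norm h * norm ?y" by (rule real_cinner_le)
  then have le: "?L * ?L \<le> norm h * ?L" by (simp only: power2_eq_square y)
  show ?thesis
  proof (cases "?L = 0")
    case False
    then have "?L > 0" using L2_set_nonneg[of "\<lambda>\<alpha>. cmod (coords h \<alpha>)" F] by linarith
    then show ?thesis using le by (rule mult_right_le_imp_le[rotated])
  qed simp
qed

lemma ell2_coords: "ell2 (coords h)" and ell2_norm_coords_le: "ell2_norm (coords h) \<le> norm h"
  by (auto intro: ell2I ell2_norm_leI L2_set_coords_le)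

text \<open>For v with a Bessel bound, the operator that sends e_\<alpha> to v_\<alpha> and vanishes
  on the orthogonal complement of the e_\<alpha>.\<close>

definition synth :: "('n list \<Rightarrow> 'a) \<Rightarrow> 'a \<Rightarrow>\<^sub>L 'a" where
  "synth v = Blinfun (\<lambda>h. \<Sum>\<^sub>\<infinity>\<alpha>. scaleC (coords h \<alpha>) (v \<alpha>))"

context
  fixes v :: "'n list \<Rightarrow> 'a" and K assumes v: "bessel_bound v K"
begin

lemma synth_summable: "(\<lambda>\<alpha>. scaleC (coords h \<alpha>) (v \<alpha>)) summable_on UNIV"
  by (rule bessel_summable[OF v ell2_coords])

lemma synth_apply: "blinfun_apply (synth v) h = (\<Sum>\<^sub>\<infinity>\<alpha>. scaleC (coords h \<alpha>) (v \<alpha>))"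
proof -
  have "bounded_linear (\<lambda>h. \<Sum>\<^sub>\<infinity>\<alpha>. scaleC (coords h \<alpha>) (v \<alpha>))"
  proof (rule bounded_linear_intro[where K = K])
    show "(\<Sum>\<^sub>\<infinity>\<alpha>. scaleC (coords (x + y) \<alpha>) (v \<alpha>))
        = (\<Sum>\<^sub>\<infinity>\<alpha>. scaleC (coords x \<alpha>) (v \<alpha>)) + (\<Sum>\<^sub>\<infinity>\<alpha>. scaleC (coords y \<alpha>) (v \<alpha>))" for x y
      by (simp add: cinner_add_left scaleC_add_left infsum_add synth_summable)
    show "(\<Sum>\<^sub>\<infinity>\<alpha>. scaleC (coords (r *\<^sub>R x) \<alpha>) (v \<alpha>)) = r *\<^sub>R (\<Sum>\<^sub>\<infinity>\<alpha>. scaleC (coords x \<alpha>) (v \<alpha>))" for r x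
      by (simp add: cinner_scaleR_left scaleC.scaleR_left infsum_scaleR_right)
    have "K \<ge> 0" using v by (simp add: bessel_bound_def)
    then show "norm (\<Sum>\<^sub>\<infinity>\<alpha>. scaleC (coords h \<alpha>) (v \<alpha>)) \<le> norm h * K" for h
      using bessel_norm_le[OF v ell2_coords[of h]] mult_left_mono[OF ell2_norm_coords_le[of h], of K]
      by (simp add: mult.commute)
  qed
  then show ?thesis by (simp add: synth_def bounded_linear_Blinfun_apply)
qed

lemma synth_has_sum: "((\<lambda>\<alpha>. scaleC (coords h \<alpha>) (v \<alpha>)) has_sum blinfun_apply (synth v) h) UNIV"
  unfolding synth_apply by (rule has_sum_infsum[OF synth_summable])

lemma synth_complex_ops: "synth v \<in> complex_ops"
  unfolding complex_ops_def
proof safe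
  fix c h
  have "((\<lambda>\<alpha>. scaleC c (scaleC (coords h \<alpha>) (v \<alpha>))) has_sum scaleC c (synth v h)) UNIV"
    by (rule has_sum_bounded_linear[OF scaleC.bounded_linear_right synth_has_sum])
  then have "((\<lambda>\<alpha>. scaleC (coords (scaleC c h) \<alpha>) (v \<alpha>)) has_sum scaleC c (synth v h)) UNIV"
    by (simp add: scaleC_scaleC cinner_scaleC_left)
  then show "synth v (scaleC c h) = scaleC c (synth v h)"
    using has_sum_unique synth_has_sum by blast
qed

lemma synth_e [simp]: "synth v (e \<alpha>) = v \<alpha>"
proof -
  have "((\<lambda>\<beta>. scaleC (coords (e \<alpha>) \<beta>) (v \<beta>)) has_sum v \<alpha>) UNIV"
    by (rule has_sum_finite_neutralI[of "{\<alpha>}"]) (auto simp: orth scaleC_one scaleC.zero_left)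
  then show ?thesis using has_sum_unique synth_has_sum by blast
qed

lemma norm_synth_le: "norm (synth v h) \<le> K * norm h"
proof -
  have "K \<ge> 0" using v by (simp add: bessel_bound_def)
  then show ?thesis
    using bessel_norm_le[OF v ell2_coords[of h]] mult_left_mono[OF ell2_norm_coords_le[of h], of K]
    by (simp add: synth_apply)
qed

lemma bessel_bound_compose:
  assumes T: "T \<in> complex_ops"
  shows "bessel_bound (\<lambda>\<alpha>. blinfun_apply T (v \<alpha>)) (norm T * K)"
  unfolding bessel_bound_def
proof safe
  show "0 \<le> norm T * K" using v by (simp add: bessel_bound_def)
  fix F c assume F: "finite (F :: 'n list set)"
  have "(\<Sum>\<alpha>\<in>F. scaleC (c \<alpha>) (T (v \<alpha>))) = T (\<Sum>\<alpha>\<in>F. scaleC (c \<alpha>) (v \<alpha>))"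
    by (simp add: blinfun.sum_right complex_opsD[OF T])
  also have "norm \<dots> \<le> norm T * norm (\<Sum>\<alpha>\<in>F. scaleC (c \<alpha>) (v \<alpha>))" by (rule norm_blinfun)
  also have "\<dots> \<le> norm T * (K * L2_set (\<lambda>\<alpha>. cmod (c \<alpha>)) F)"
    using v F by (intro mult_left_mono) (auto simp: bessel_bound_def)
  finally show "norm (\<Sum>\<alpha>\<in>F. scaleC (c \<alpha>) (T (v \<alpha>))) \<le> norm T * K * L2_set (\<lambda>\<alpha>. cmod (c \<alpha>)) F"
    by (simp add: mult.assoc)
qed

end

text \<open>Identities between such operators reduce to identities between vectors; this is how
  intertwining relations are checked.\<close>

lemma compose_synth:
  assumes T: "T \<in> complex_ops" and v: "bessel_bound v K"
  shows "T o\<^sub>L synth v = synth (\<lambda>\<alpha>. blinfun_apply T (v \<alpha>))"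
proof (rule blinfun_eqI)
  fix h
  have "((\<lambda>\<alpha>. T (scaleC (coords h \<alpha>) (v \<alpha>))) has_sum T (synth v h)) UNIV"
    by (rule has_sum_bounded_linear[OF blinfun.bounded_linear_right synth_has_sum[OF v]])
  then have "((\<lambda>\<alpha>. scaleC (coords h \<alpha>) (T (v \<alpha>))) has_sum T (synth v h)) UNIV"
    by (simp add: complex_opsD[OF T])
  then show "(T o\<^sub>L synth v) h = synth (\<lambda>\<alpha>. T (v \<alpha>)) h"
    using has_sum_unique[OF _ synth_has_sum[OF bessel_bound_compose[OF v T]]] by auto
qed

definition vec :: "('n list \<Rightarrow> complex) \<Rightarrow> 'a" where
  "vec a = (\<Sum>\<^sub>\<infinity>\<alpha>. scaleC (a \<alpha>) (e \<alpha>))"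

lemma vec_has_sum: "ell2 a \<Longrightarrow> ((\<lambda>\<alpha>. scaleC (a \<alpha>) (e \<alpha>)) has_sum vec a) UNIV"
  unfolding vec_def using bessel_summable[OF bessel_bound_e[of id]] by simp

lemma has_sum_coords:
  assumes "((\<lambda>\<alpha>. scaleC (a \<alpha>) (e (g \<alpha>))) has_sum h) UNIV" "inj g"
  shows "coords h (g \<beta>) = a \<beta>"
proof -
  have "((\<lambda>\<alpha>. cinner (scaleC (a \<alpha>) (e (g \<alpha>))) (e (g \<beta>))) has_sum coords h (g \<beta>)) UNIV"
    by (rule has_sum_bounded_linear[OF cinner.bounded_linear_left assms(1)])
  moreover have "((\<lambda>\<alpha>. cinner (scaleC (a \<alpha>) (e (g \<alpha>))) (e (g \<beta>))) has_sum a \<beta>) UNIV"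
    by (rule has_sum_finite_neutralI[of "{\<beta>}"])
      (use assms(2) in \<open>auto simp: orth cinner_scaleC_left dest: injD\<close>)
  ultimately show ?thesis by (rule has_sum_unique)
qed

lemma coords_vec [simp]: "ell2 a \<Longrightarrow> coords (vec a) = a"
  using has_sum_coords[of a id, OF _ inj_on_id] vec_has_sum by auto

lemma norm_vec: "ell2 a \<Longrightarrow> norm (vec a) = ell2_norm a"
proof (rule antisym)
  assume a: "ell2 a"
  show "norm (vec a) \<le> ell2_norm a"
    using bessel_norm_le[OF bessel_bound_e[of id] a] by (simp add: vec_def)
  show "ell2_norm a \<le> norm (vec a)"
    using ell2_norm_coords_le[of "vec a"] a by simp
qed

text \<open>The left creation operators of the Fock space, scaled by s and extended by zero off the
  closed span of the e_\<alpha>.\<close>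

definition shift :: "real \<Rightarrow> ('n, 'a) op_tuple" where
  "shift s i = synth (\<lambda>\<alpha>. s *\<^sub>R e (i # \<alpha>))"

lemma bessel_bound_shift: "0 \<le> s \<Longrightarrow> bessel_bound (\<lambda>\<alpha>. s *\<^sub>R e (i # \<alpha>)) s"
  using bessel_bound_e[of "(#) i"]
  by (simp add: bessel_bound_def scaleC.scaleR_right scaleR_sum_right[symmetric] mult_left_mono)

lemma shift_complex_ops: "0 \<le> s \<Longrightarrow> shift s i \<in> complex_ops"
  unfolding shift_def by (rule synth_complex_ops[OF bessel_bound_shift])

lemma shift_e [simp]: "0 \<le> s \<Longrightarrow> shift s i (e \<alpha>) = s *\<^sub>R e (i # \<alpha>)"
  unfolding shift_def by (rule synth_e[OF bessel_bound_shift])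

lemma word_shift_e: "0 \<le> s \<Longrightarrow> word_op (shift s) \<alpha> (e \<beta>) = s ^ length \<alpha> *\<^sub>R e (\<alpha> @ \<beta>)"
  by (induction \<alpha>) (auto simp: blinfun.scaleR_right)

text \<open>The range of \<open>shift s i\<close> lies in the closed span of the words beginning
  with i. This gives orthogonality of different ranges, and of every range to
  \<open>e []\<close>.\<close>

lemma shift_orthogonal:
  assumes s: "0 \<le> s" and "\<And>\<alpha>. cinner (e (i # \<alpha>)) w = 0"
  shows "cinner (shift s i x) w = 0"
proof -
  have "((\<lambda>\<alpha>. cinner (scaleC (coords x \<alpha>) (s *\<^sub>R e (i # \<alpha>))) w) has_sum cinner (shift s i x) w) UNIV"
    unfolding shift_def
    by (rule has_sum_bounded_linear[OF cinner.bounded_linear_left synth_has_sum[OF bessel_bound_shift[OF s]]])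
  then show ?thesis
    by (simp add: assms cinner_scaleC_left cinner_scaleR_left has_sum_iff)
qed

text \<open>Pythagoras: the ranges are mutually orthogonal, so the row inherits the bound s of the
  single shifts.\<close>

lemma row_bound_shift:
  assumes s: "0 \<le> s"
  shows "row_bound (shift s) s"
  unfolding row_bound_def
proof
  fix x :: "'n \<Rightarrow> 'a"
  let ?v = "\<lambda>i. shift s i (x i)"
  have perp: "cinner (?v i) (?v j) = 0" if "i \<noteq> j" for i j
  proof (rule shift_orthogonal[OF s])
    fix \<alpha>
    have "cinner (?v j) (e (i # \<alpha>)) = 0"
      by (rule shift_orthogonal[OF s]) (use that in \<open>simp add: orth\<close>)
    then show "cinner (e (i # \<alpha>)) (?v j) = 0" using cinner_commute[of "e (i # \<alpha>)" "?v j"] by simp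
  qed
  have "cinner (sum ?v UNIV) (sum ?v UNIV) = (\<Sum>i\<in>UNIV. \<Sum>j\<in>UNIV. if i = j then cinner (?v i) (?v i) else 0)"
    unfolding cinner.sum_left cinner.sum_right by (intro sum.cong) (auto simp: perp)
  also have "\<dots> = of_real (\<Sum>i\<in>UNIV. (norm (?v i))\<^sup>2)"
    by (simp add: cinner_self)
  finally have "(norm (sum ?v UNIV))\<^sup>2 = (\<Sum>i\<in>UNIV. (norm (?v i))\<^sup>2)"
    by (simp only: cinner_self of_real_eq_iff)
  also have "\<dots> \<le> (\<Sum>i\<in>UNIV. s\<^sup>2 * (norm (x i))\<^sup>2)"
  proof (rule sum_mono)
    fix i
    have "norm (?v i) \<le> s * norm (x i)"
      unfolding shift_def by (rule norm_synth_le[OF bessel_bound_shift[OF s]])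
    then show "(norm (?v i))\<^sup>2 \<le> s\<^sup>2 * (norm (x i))\<^sup>2"
      using power_mono[of "norm (?v i)" "s * norm (x i)" 2] by (simp add: power_mult_distrib)
  qed
  finally show "(norm (sum ?v UNIV))\<^sup>2 \<le> s\<^sup>2 * (\<Sum>i\<in>UNIV. (norm (x i))\<^sup>2)"
    by (simp add: sum_distrib_left)
qed

lemma shift_nc_ball: "0 \<le> s \<Longrightarrow> s < 1 \<Longrightarrow> shift s \<in> nc_ball"
  by (rule nc_ballI[OF shift_complex_ops _ _ row_bound_shift])

end

section \<open>Free holomorphic functions and intertwining maps\<close>

text \<open>One half of Cauchy-Hadamard, for the ell2 norms of the homogeneous parts.\<close>

lemma free_expansion_summable:
  fixes a :: "'n::finite list \<Rightarrow> complex"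
  assumes lim: "limsup (\<lambda>k. ereal (root (2 * k) (\<Sum>\<alpha> | length \<alpha> = k. (cmod (a \<alpha>))\<^sup>2))) \<le> 1"
    and \<rho>: "0 \<le> \<rho>" "\<rho> < 1"
  shows "summable (\<lambda>k. level_norm a k * \<rho> ^ k)"
proof -
  \<comment> \<open>Any y > 1 with y \<rho> < 1 would do; this choice also covers \<rho> =
    0.\<close>
  define y where "y = 2 / (1 + \<rho>)"
  have y: "y > 1" "y * \<rho> < 1" "0 \<le> y * \<rho>" using \<rho> by (auto simp: y_def field_simps)
  have "limsup (\<lambda>k. ereal (root (2 * k) (\<Sum>\<alpha> | length \<alpha> = k. (cmod (a \<alpha>))\<^sup>2))) < ereal y"
    by (rule order_le_less_trans[OF lim]) (use y(1) in \<open>simp add: one_ereal_def\<close>)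
  then have "\<forall>\<^sub>F k in sequentially. ereal (root (2 * k) (\<Sum>\<alpha> | length \<alpha> = k. (cmod (a \<alpha>))\<^sup>2)) < ereal y"
    by (rule Limsup_lessD)
  then have "\<forall>\<^sub>F k in sequentially. norm (level_norm a k * \<rho> ^ k) \<le> (y * \<rho>) ^ k"
    using eventually_gt_at_top[of 0]
  proof eventually_elim
    case (elim k)
    let ?S = "\<Sum>\<alpha> | length \<alpha> = k. (cmod (a \<alpha>))\<^sup>2"
    have S: "0 \<le> ?S" by (rule sum_nonneg) auto
    have "?S = root (2 * k) ?S ^ (2 * k)" using elim S by (simp add: real_root_pow_pos2)
    also have "\<dots> \<le> y ^ (2 * k)" using elim S by (intro power_mono) (auto simp: real_root_ge_zero)
    also have "\<dots> = (y ^ k)\<^sup>2" by (simp add: power_mult mult.commute)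
    finally have "level_norm a k \<le> y ^ k"
      unfolding L2_set_def using y(1) by (intro real_le_lsqrt) auto
    then show ?case
      using \<rho> by (simp add: abs_mult power_mult_distrib mult_right_mono)
  qed
  then show ?thesis
    by (rule summable_comparison_test_ev) (use y in \<open>intro summable_geometric, simp\<close>)
qed

text \<open>The converse half of Cauchy-Hadamard: it is enough that the terms stay bounded at every
  radius s < 1.\<close>

lemma limsup_levelI:
  fixes a :: "'n::finite list \<Rightarrow> complex"
  assumes C: "\<And>s. 0 < s \<Longrightarrow> s < 1 \<Longrightarrow> \<exists>C. \<forall>k. level_norm a k * s ^ k \<le> C"
  shows "limsup (\<lambda>k. ereal (root (2 * k) (\<Sum>\<alpha> | length \<alpha> = k. (cmod (a \<alpha>))\<^sup>2))) \<le> 1"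
proof (rule dense_ge)
  fix x :: ereal assume "1 < x"
  show "limsup (\<lambda>k. ereal (root (2 * k) (\<Sum>\<alpha> | length \<alpha> = k. (cmod (a \<alpha>))\<^sup>2))) \<le> x"
  proof (cases x)
    case (real y)
    then have y: "y > 1" using \<open>1 < x\<close> by (simp add: one_ereal_def)
    \<comment> \<open>Chosen between 1 / y and 1, so that (y s)^k eventually exceeds the constant
      C.\<close>
    define s where "s = 2 / (1 + y)"
    have s: "0 < s" "s < 1" "1 < y * s" using y by (auto simp: s_def field_simps)
    obtain C where C: "\<And>k. level_norm a k * s ^ k \<le> C" using C[OF s(1,2)] by blast
    have "\<forall>\<^sub>F k in sequentially. C \<le> (y * s) ^ k"
    proof -
      obtain N where N: "C < (y * s) ^ N" using real_arch_pow[OF s(3)] by blast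
      show ?thesis
      proof (rule eventually_sequentiallyI[of N])
        fix k assume "N \<le> k"
        then have "(y * s) ^ N \<le> (y * s) ^ k" using s(3) by (intro power_increasing) auto
        then show "C \<le> (y * s) ^ k" using N by linarith
      qed
    qed
    then have "\<forall>\<^sub>F k in sequentially. ereal (root (2 * k) (\<Sum>\<alpha> | length \<alpha> = k. (cmod (a \<alpha>))\<^sup>2)) \<le> x"
      using eventually_gt_at_top[of 0]
    proof eventually_elim
      case (elim k)
      let ?S = "\<Sum>\<alpha> | length \<alpha> = k. (cmod (a \<alpha>))\<^sup>2"
      have "level_norm a k * s ^ k \<le> y ^ k * s ^ k"
        using C[of k] elim by (simp add: power_mult_distrib)
      then have "level_norm a k \<le> y ^ k" using s by simp
      then have "?S \<le> (y ^ k)\<^sup>2" unfolding L2_set_def by (rule sqrt_le_D)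
      then have "root (2 * k) ?S \<le> root (2 * k) (y ^ (2 * k))"
        using elim by (simp add: power_mult[symmetric] mult.commute)
      also have "\<dots> = y" using elim y by (intro real_root_power_cancel) auto
      finally show ?case using real by simp
    qed
    then show ?thesis by (rule Limsup_bounded)
  qed (use \<open>1 < x\<close> in auto)
qed

lemma ell2_limsup:
  fixes a :: "'n::finite list \<Rightarrow> complex"
  assumes "ell2 a"
  shows "limsup (\<lambda>k. ereal (root (2 * k) (\<Sum>\<alpha> | length \<alpha> = k. (cmod (a \<alpha>))\<^sup>2))) \<le> 1"
proof (rule limsup_levelI, intro exI allI)
  fix s :: real and k assume "0 < s" "s < 1"
  then have "level_norm a k * s ^ k \<le> ell2_norm a * 1"
    by (intro mult_mono L2_set_le_ell2_norm assms power_le_one) auto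
  then show "level_norm a k * s ^ k \<le> ell2_norm a" by simp
qed

lemma free_series_summable:
  fixes X :: "('n::finite, 'a::complex_hilbert) op_tuple"
  assumes lim: "limsup (\<lambda>k. ereal (root (2 * k) (\<Sum>\<alpha> | length \<alpha> = k. (cmod (a \<alpha>))\<^sup>2))) \<le> 1"
    and X: "X \<in> nc_ball"
  shows "summable (\<lambda>k. \<Sum>\<alpha> | length \<alpha> = k. scale_op (a \<alpha>) (word_op X \<alpha>))"
proof -
  obtain r where r: "0 \<le> r" "r < 1" "row_bound X r" using nc_ball_row_bound[OF X] .
  show ?thesis
    by (rule summable_comparison_test'[OF free_expansion_summable[OF lim r(1,2)]])
      (rule norm_level_le[OF r(3,1) nc_ball_complex_ops[OF X]])
qed

lemma expansion_apply_sums: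
  assumes "has_free_expansion f a" "X \<in> nc_ball"
  shows "(\<lambda>k. \<Sum>\<alpha> | length \<alpha> = k. scaleC (a \<alpha>) (word_op X \<alpha> h)) sums f X h"
proof -
  have "(\<lambda>k. \<Sum>\<alpha> | length \<alpha> = k. scale_op (a \<alpha>) (word_op X \<alpha>)) sums f X"
    using assms by (simp add: has_free_expansion_def)
  from bounded_linear.sums[OF blinfun.bounded_linear_left[of h] this]
  show ?thesis by (simp add: blinfun.sum_left)
qed

text \<open>All tuples act on the same H. The operator T, which may be neither injective nor
  surjective, takes over the role of the direct sums and similarities in the usual definition of
  noncommutative functions.\<close>

definition intertwining ::
  "(('n::finite, 'a::complex_hilbert) op_tuple \<Rightarrow> 'a \<Rightarrow>\<^sub>L 'a) \<Rightarrow> bool" where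
  "intertwining F \<longleftrightarrow> (\<forall>X\<in>nc_ball. \<forall>Y\<in>nc_ball. \<forall>T\<in>complex_ops.
     (\<forall>i. T o\<^sub>L X i = Y i o\<^sub>L T) \<longrightarrow> T o\<^sub>L F X = F Y o\<^sub>L T)"

lemma intertwine_word:
  assumes T: "\<And>i. T o\<^sub>L X i = Y i o\<^sub>L T"
  shows "blinfun_apply T (word_op X \<alpha> h) = word_op Y \<alpha> (blinfun_apply T h)"
proof (induction \<alpha>)
  case (Cons i \<alpha>)
  have "T (X i z) = Y i (T z)" for z
    using arg_cong[OF T[of i], of "\<lambda>A. blinfun_apply A z"] by simp
  then show ?case using Cons by simp
qed simp

lemma free_holomorphic_intertwining:
  fixes f :: "('n::finite, 'b::complex_hilbert) op_tuple \<Rightarrow> 'b \<Rightarrow>\<^sub>L 'b"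
  assumes "free_holomorphic f"
  shows "intertwining f"
  unfolding intertwining_def
proof (intro ballI impI)
  fix X Y :: "('n, 'b) op_tuple" and T :: "'b \<Rightarrow>\<^sub>L 'b"
  assume XY: "X \<in> nc_ball" "Y \<in> nc_ball" and T: "T \<in> complex_ops" and eq: "\<forall>i. T o\<^sub>L X i = Y i o\<^sub>L T"
  obtain a where a: "has_free_expansion f a" using assms by (auto simp: free_holomorphic_def)
  show "T o\<^sub>L f X = f Y o\<^sub>L T"
  proof (rule blinfun_eqI)
    fix h
    have "(\<lambda>k. T (\<Sum>\<alpha> | length \<alpha> = k. scaleC (a \<alpha>) (word_op X \<alpha> h))) sums T (f X h)"
      by (rule bounded_linear.sums[OF blinfun.bounded_linear_right expansion_apply_sums[OF a XY(1)]])
    moreover have "T (word_op X \<alpha> h) = word_op Y \<alpha> (T h)" for \<alpha>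
      by (rule intertwine_word) (use eq in blast)
    ultimately have "(\<lambda>k. \<Sum>\<alpha> | length \<alpha> = k. scaleC (a \<alpha>) (word_op Y \<alpha> (T h))) sums T (f X h)"
      by (simp add: blinfun.sum_right complex_opsD[OF T])
    then have "T (f X h) = f Y (T h)"
      using expansion_apply_sums[OF a XY(2)] by (rule sums_unique2)
    then show "(T o\<^sub>L f X) h = (f Y o\<^sub>L T) h" by simp
  qed
qed

lemma intertwining_compose:
  fixes f :: "('n::finite, 'a::complex_hilbert) op_tuple \<Rightarrow> 'a \<Rightarrow>\<^sub>L 'a"
    and \<phi> :: "('n, 'a) op_tuple \<Rightarrow> ('n, 'a) op_tuple"
  assumes f: "intertwining f" and \<phi>: "\<And>i. intertwining (\<lambda>X. \<phi> X i)" "\<phi> \<in> nc_ball \<rightarrow> nc_ball"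
  shows "intertwining (\<lambda>X. f (\<phi> X))"
  unfolding intertwining_def
proof (intro ballI impI)
  fix X Y :: "('n, 'a) op_tuple" and T :: "'a \<Rightarrow>\<^sub>L 'a"
  assume XY: "X \<in> nc_ball" "Y \<in> nc_ball" and T: "T \<in> complex_ops" and eq: "\<forall>i. T o\<^sub>L X i = Y i o\<^sub>L T"
  have "\<forall>i. T o\<^sub>L \<phi> X i = \<phi> Y i o\<^sub>L T"
    using \<phi>(1) XY T eq unfolding intertwining_def by blast
  moreover have "\<phi> X \<in> nc_ball" "\<phi> Y \<in> nc_ball" using \<phi>(2) XY by auto
  ultimately show "T o\<^sub>L f (\<phi> X) = f (\<phi> Y) o\<^sub>L T"
    using f T unfolding intertwining_def by blast
qed

lemma geometric_partial_le: "0 \<le> q \<Longrightarrow> q < 1 \<Longrightarrow> (\<Sum>k\<le>m. q ^ k) \<le> 1 / (1 - q)" for q :: real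
  using sum_le_suminf[OF summable_geometric[of q], of "{..m}"] suminf_geometric[of q] by simp

text \<open>Level k contributes at most a constant times (r / s)^k, so the gap between r and s gives
  a geometric series. This is the boundedness of the intertwiner from the scaled shifts to
  X.\<close>

lemma bessel_bound_words:
  fixes X :: "('n::finite, 'a::complex_hilbert) op_tuple"
  assumes X: "\<And>i. X i \<in> complex_ops" and r: "row_bound X r" "0 \<le> r" "r < s"
  shows "bessel_bound (\<lambda>\<alpha>. (1 / s ^ length \<alpha>) *\<^sub>R word_op X \<alpha> h) (norm h / (1 - r / s))"
  unfolding bessel_bound_def
proof safe
  have s: "0 < s" using r by simp
  show "0 \<le> norm h / (1 - r / s)" using r s by simp
  fix F :: "'n list set" and c assume F: "finite F"
  define L where "L = L2_set (\<lambda>\<alpha>. cmod (c \<alpha>)) F"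
  obtain m where m: "\<And>\<alpha>. \<alpha> \<in> F \<Longrightarrow> length \<alpha> \<le> m"
    using finite_nat_set_iff_bounded_le[of "length ` F"] F by auto
  \<comment> \<open>Extension by zero turns the sum over F into one over full levels, where the row
    estimate applies.\<close>
  define c' where "c' \<alpha> = (if \<alpha> \<in> F then c \<alpha> else 0)" for \<alpha>
  have lev: "level_norm c' k \<le> L" for k
  proof -
    have "(\<Sum>\<alpha> | length \<alpha> = k. (cmod (c' \<alpha>))\<^sup>2) = (\<Sum>\<alpha>\<in>{\<alpha>. length \<alpha> = k} \<inter> F. (cmod (c \<alpha>))\<^sup>2)"
      unfolding c'_def by (subst sum.inter_restrict) (auto intro!: sum.cong)
    also have "\<dots> \<le> (\<Sum>\<alpha>\<in>F. (cmod (c \<alpha>))\<^sup>2)" using F by (intro sum_mono2) auto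
    finally show ?thesis by (simp add: L_def L2_set_def)
  qed
  have "(\<Sum>\<alpha>\<in>F. scaleC (c \<alpha>) ((1 / s ^ length \<alpha>) *\<^sub>R word_op X \<alpha> h))
      = (\<Sum>\<alpha> | length \<alpha> \<le> m. scaleC (c' \<alpha>) ((1 / s ^ length \<alpha>) *\<^sub>R word_op X \<alpha> h))"
    by (rule sum.mono_neutral_cong_left) (use F m in \<open>auto simp: c'_def scaleC.zero_left\<close>)
  also have "\<dots> = (\<Sum>k\<le>m. (1 / s ^ k) *\<^sub>R (\<Sum>\<alpha> | length \<alpha> = k. scaleC (c' \<alpha>) (word_op X \<alpha> h)))"
    by (simp add: sum_words_le scaleR_sum_right scaleC.scaleR_right)
  also have "norm \<dots> \<le> (\<Sum>k\<le>m. L * norm h * (r / s) ^ k)"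
  proof (rule sum_norm_le)
    fix k
    have "norm (\<Sum>\<alpha> | length \<alpha> = k. scaleC (c' \<alpha>) (word_op X \<alpha> h)) \<le> level_norm c' k * r ^ k * norm h"
      by (rule norm_level_apply_le[OF r(1,2) X])
    also have "\<dots> \<le> L * r ^ k * norm h" using lev r by (intro mult_right_mono) auto
    finally show "norm ((1 / s ^ k) *\<^sub>R (\<Sum>\<alpha> | length \<alpha> = k. scaleC (c' \<alpha>) (word_op X \<alpha> h)))
        \<le> L * norm h * (r / s) ^ k"
      using s by (simp add: field_simps power_divide)
  qed
  also have "\<dots> = L * norm h * (\<Sum>k\<le>m. (r / s) ^ k)" by (simp add: sum_distrib_left)
  also have "\<dots> \<le> L * norm h * (1 / (1 - r / s))"
    using r s by (intro mult_left_mono geometric_partial_le) (auto simp: L_def)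
  finally show "norm (\<Sum>\<alpha>\<in>F. scaleC (c \<alpha>) ((1 / s ^ length \<alpha>) *\<^sub>R word_op X \<alpha> h))
      \<le> norm h / (1 - r / s) * L2_set (\<lambda>\<alpha>. cmod (c \<alpha>)) F"
    by (simp add: L_def mult.commute)
qed

context orthonormal_words
begin

lemma intertwining_apply_has_sum:
  assumes F: "intertwining F" and X: "X \<in> nc_ball" "row_bound X r" "0 \<le> r" and s: "r < s" "s < 1"
  shows "((\<lambda>\<alpha>. scaleC (coords (F (shift s) (e [])) \<alpha> / of_real (s ^ length \<alpha>)) (word_op X \<alpha> h))
    has_sum F X h) UNIV"
proof -
  define v where "v \<alpha> = (1 / s ^ length \<alpha>) *\<^sub>R word_op X \<alpha> h" for \<alpha>
  define K where "K = norm h / (1 - r / s)"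
  have s0: "0 < s" "0 \<le> s" using X s by auto
  have Xc: "X i \<in> complex_ops" for i using X(1) by (rule nc_ball_complex_ops)
  have v: "bessel_bound v K"
    using bessel_bound_words[OF Xc X(2,3) s(1)] unfolding v_def[abs_def] K_def .
  have T: "synth v \<in> complex_ops" by (rule synth_complex_ops[OF v])
  \<comment> \<open>Both sides are synthesis operators, and both send e_\<alpha> to X_i X_\<alpha> h
    divided by s^|\<alpha>|: the factor s of the shift cancels the extra division caused by the
    longer word.\<close>
  have "synth v o\<^sub>L shift s i = X i o\<^sub>L synth v" for i
    unfolding shift_def compose_synth[OF T bessel_bound_shift[OF s0(2)]] compose_synth[OF Xc v]
    using s0 by (simp add: blinfun.scaleR_right synth_e[OF v]) (simp add: v_def blinfun.scaleR_right)
  then have "synth v o\<^sub>L F (shift s) = F X o\<^sub>L synth v"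
    using F shift_nc_ball[OF s0(2) s(2)] X(1) T unfolding intertwining_def by blast
  from arg_cong[OF this, of "\<lambda>A. blinfun_apply A (e [])"]
  have "F X h = synth v (F (shift s) (e []))"
    by (simp add: synth_e[OF v]) (simp add: v_def)
  moreover have "scaleC (coords z \<alpha>) (v \<alpha>) = scaleC (coords z \<alpha> / of_real (s ^ length \<alpha>)) (word_op X \<alpha> h)" for z \<alpha>
    by (simp add: v_def scaleC_of_real[symmetric] scaleC_scaleC del: of_real_power)
  ultimately show ?thesis using synth_has_sum[OF v, of "F (shift s) (e [])"] by simp
qed

text \<open>The expansion with coefficients read off at t is valid at all tuples of radius below t,
  in particular at the shifts scaled by s; comparing coordinates there gives the claim.\<close>

lemma intertwining_coeff_indep:
  assumes F: "intertwining F" and s: "0 < s" "s < t" "t < 1"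
  shows "coords (F (shift s) (e [])) \<alpha> / of_real (s ^ length \<alpha>)
    = coords (F (shift t) (e [])) \<alpha> / of_real (t ^ length \<alpha>)"
proof -
  let ?b = "\<lambda>\<alpha>. coords (F (shift t) (e [])) \<alpha> / of_real (t ^ length \<alpha>)"
  have "((\<lambda>\<alpha>. scaleC (?b \<alpha>) (word_op (shift s) \<alpha> (e []))) has_sum F (shift s) (e [])) UNIV"
    using s by (intro intertwining_apply_has_sum[OF F shift_nc_ball row_bound_shift]) auto
  moreover have "scaleC (?b \<alpha>) (word_op (shift s) \<alpha> (e [])) = scaleC (?b \<alpha> * of_real (s ^ length \<alpha>)) (e \<alpha>)" for \<alpha>
    using s by (simp add: word_shift_e scaleC_of_real[symmetric] scaleC_scaleC del: of_real_power)
  ultimately have "coords (F (shift s) (e [])) \<alpha> = ?b \<alpha> * of_real (s ^ length \<alpha>)"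
    using has_sum_coords[of "\<lambda>\<alpha>. ?b \<alpha> * of_real (s ^ length \<alpha>)" "\<lambda>x. x"] by (simp add: inj_on_def)
  then show ?thesis using s by (simp add: field_simps)
qed

lemma intertwining_free_expansion:
  fixes F :: "('n, 'a) op_tuple \<Rightarrow> 'a \<Rightarrow>\<^sub>L 'a"
  assumes F: "intertwining F"
  shows "\<exists>a. has_free_expansion F a"
proof -
  \<comment> \<open>The radius 1/2 is arbitrary, since the normalised coefficients do not depend on
    it.\<close>
  define a where "a \<alpha> = coords (F (shift (1/2)) (e [])) \<alpha> / of_real ((1/2) ^ length \<alpha>)" for \<alpha>
  have a: "coords (F (shift s) (e [])) \<alpha> = a \<alpha> * of_real (s ^ length \<alpha>)" if "0 < s" "s < 1" for s \<alpha>
  proof -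
    have "coords (F (shift s) (e [])) \<alpha> / of_real (s ^ length \<alpha>) = a \<alpha>"
    proof (cases s "1/2 :: real" rule: linorder_cases)
      case less
      then show ?thesis unfolding a_def using that by (intro intertwining_coeff_indep[OF F]) auto
    next
      case equal
      show ?thesis unfolding a_def equal by simp
    next
      case greater
      then show ?thesis unfolding a_def using that by (intro intertwining_coeff_indep[OF F, symmetric]) auto
    qed
    then show ?thesis using that by (auto simp: field_simps)
  qed
  have lim: "limsup (\<lambda>k. ereal (root (2 * k) (\<Sum>\<alpha> | length \<alpha> = k. (cmod (a \<alpha>))\<^sup>2))) \<le> 1"
  proof (rule limsup_levelI, intro exI allI)
    fix s :: real and k assume s: "0 < s" "s < 1"
    have "level_norm a k * s ^ k = L2_set (\<lambda>\<alpha>. cmod (coords (F (shift s) (e [])) \<alpha>)) {\<alpha>. length \<alpha> = k}"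
      using s by (auto simp: a[OF s] norm_mult norm_power L2_set_left_distrib intro!: L2_set_cong)
    \<comment> \<open>Bessel's inequality for this single vector is the whole growth
      estimate.\<close>
    also have "\<dots> \<le> norm (F (shift s) (e []))" by (rule L2_set_coords_le) simp
    finally show "level_norm a k * s ^ k \<le> norm (F (shift s) (e []))" .
  qed
  have "(\<lambda>k. \<Sum>\<alpha> | length \<alpha> = k. scale_op (a \<alpha>) (word_op X \<alpha>)) sums F X" if X: "X \<in> nc_ball" for X
  proof -
    obtain r where r: "0 \<le> r" "r < 1" "row_bound X r" using nc_ball_row_bound[OF X] .
    define s where "s = (1 + r) / 2"
    have s: "r < s" "s < 1" "0 < s" using r by (auto simp: s_def)
    \<comment> \<open>Norm convergence comes from the growth of the coefficients; the unordered
      sums, known only at each vector h, then identify the limit.\<close>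
    obtain S where S: "(\<lambda>k. \<Sum>\<alpha> | length \<alpha> = k. scale_op (a \<alpha>) (word_op X \<alpha>)) sums S"
      using free_series_summable[OF lim X] by (auto simp: summable_def)
    have "S h = F X h" for h
    proof (rule sums_unique2)
      show "(\<lambda>k. \<Sum>\<alpha> | length \<alpha> = k. scaleC (a \<alpha>) (word_op X \<alpha> h)) sums S h"
        using bounded_linear.sums[OF blinfun.bounded_linear_left[of h] S] by (simp add: blinfun.sum_left)
      show "(\<lambda>k. \<Sum>\<alpha> | length \<alpha> = k. scaleC (a \<alpha>) (word_op X \<alpha> h)) sums F X h"
        using has_sum_words_imp_sums[OF intertwining_apply_has_sum[OF F X r(3,1) s(1,2), of h]]
        using s by (simp add: a[OF s(3,2)])
    qed
    then have "S = F X" by (rule blinfun_eqI)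
    then show ?thesis using S by simp
  qed
  then show ?thesis using lim unfolding has_free_expansion_def by blast
qed

lemma free_holomorphic_iff_intertwining:
  "free_holomorphic (F :: ('n, 'a) op_tuple \<Rightarrow> 'a \<Rightarrow>\<^sub>L 'a) \<longleftrightarrow> intertwining F"
  using free_holomorphic_intertwining intertwining_free_expansion by (auto simp: free_holomorphic_def)

text \<open>Applying a word of shifts to \<open>e []\<close> gives a multiple of the basis vector of
  that word, so one evaluation displays all coefficients. Hence they are unique, which gives
  \<open>free_coeffs\<close> its meaning, and bounds on this vector become bounds on
  coefficients.\<close>

lemma expansion_coeff:
  assumes a: "has_free_expansion f a" and s: "0 < s" "s < 1"
  shows "coords (f (shift s) (e [])) \<alpha> = a \<alpha> * of_real (s ^ length \<alpha>)"
proof -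
  have "(\<lambda>k. \<Sum>\<beta> | length \<beta> = k. scaleC (a \<beta>) (word_op (shift s) \<beta> (e []))) sums f (shift s) (e [])"
    using s by (intro expansion_apply_sums[OF a] shift_nc_ball) auto
  from bounded_linear.sums[OF cinner.bounded_linear_left this, of "e \<alpha>"]
  moreover have "cinner (scaleC (a \<beta>) (word_op (shift s) \<beta> (e []))) (e \<alpha>)
      = (if \<beta> = \<alpha> then a \<alpha> * of_real (s ^ length \<alpha>) else 0)" for \<beta>
    using s by (simp add: cinner_scaleC_left word_shift_e cinner_scaleR_left orth scaleR_conv_of_real)
  ultimately have "(\<lambda>k. if k = length \<alpha> then a \<alpha> * of_real (s ^ length \<alpha>) else 0)
      sums coords (f (shift s) (e [])) \<alpha>"
    by (simp add: cinner.sum_left eq_commute[of "length \<alpha>"])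
  from sums_unique2[OF this sums_single] show ?thesis .
qed

lemma has_free_expansion_unique:
  fixes f :: "('n, 'a) op_tuple \<Rightarrow> 'a \<Rightarrow>\<^sub>L 'a"
  assumes "has_free_expansion f a" "has_free_expansion f b"
  shows "a = b"
proof
  fix \<alpha> show "a \<alpha> = b \<alpha>"
    using expansion_coeff[OF assms(1), of "1/2" \<alpha>] expansion_coeff[OF assms(2), of "1/2" \<alpha>] by simp
qed

lemma free_coeffs_eq: "has_free_expansion f a \<Longrightarrow> free_coeffs f = a"
  for f :: "('n, 'a) op_tuple \<Rightarrow> 'a \<Rightarrow>\<^sub>L 'a"
  unfolding free_coeffs_def by (blast intro: has_free_expansion_unique)

end

section \<open>The Hardy space and its operators\<close>

definition op_invertible :: "('a::complex_hilbert \<Rightarrow>\<^sub>L 'a) \<Rightarrow> bool" where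
  "op_invertible A \<longleftrightarrow> (\<exists>S\<in>complex_ops. S o\<^sub>L A = id_blinfun \<and> A o\<^sub>L S = id_blinfun)"

lemma H2_ball_expansion:
  fixes e :: "'n::finite list \<Rightarrow> 'a::complex_hilbert" and f :: "('n, 'a) op_tuple \<Rightarrow> 'a \<Rightarrow>\<^sub>L 'a"
  assumes "orthonormal_words e" "f \<in> H2_ball"
  shows "has_free_expansion f (free_coeffs f)" "ell2 (free_coeffs f)" "f \<in> extensional nc_ball"
  using assms(2) orthonormal_words.free_coeffs_eq[OF assms(1), of f]
  by (auto simp: H2_ball_def free_holomorphic_def)

context orthonormal_words
begin

text \<open>\<open>fn\<close> and \<open>hvec\<close> translate between the closed span of the
  e_\<alpha> and the Hardy space. On all of H, \<open>fn\<close> forgets the part orthogonal to the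
  e_\<alpha>, so going there and back is the orthogonal projection \<open>proj\<close>.\<close>

definition fn :: "'a \<Rightarrow> ('n, 'a) op_tuple \<Rightarrow> 'a \<Rightarrow>\<^sub>L 'a" where
  "fn h = (\<lambda>X\<in>nc_ball. \<Sum>k. \<Sum>\<alpha> | length \<alpha> = k. scale_op (coords h \<alpha>) (word_op X \<alpha>))"

definition proj :: "'a \<Rightarrow>\<^sub>L 'a" where
  "proj = synth e"

definition hvec :: "(('n, 'a) op_tuple \<Rightarrow> 'a \<Rightarrow>\<^sub>L 'a) \<Rightarrow> 'a" where
  "hvec f = vec (free_coeffs f)"

lemma fn_sums:
  "X \<in> nc_ball \<Longrightarrow> (\<lambda>k. \<Sum>\<alpha> | length \<alpha> = k. scale_op (coords h \<alpha>) (word_op X \<alpha>)) sums fn h X"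
  unfolding fn_def by (simp add: summable_sums free_series_summable ell2_limsup ell2_coords)

lemma fn_expansion: "has_free_expansion (fn h) (coords h)"
  unfolding has_free_expansion_def using fn_sums ell2_limsup[OF ell2_coords] by blast

lemma free_coeffs_fn [simp]: "free_coeffs (fn h) = coords h"
  by (rule free_coeffs_eq[OF fn_expansion])

lemma fn_extensional: "fn h \<in> extensional nc_ball"
  by (simp add: fn_def)

lemma fn_H2: "fn h \<in> H2_ball"
  using fn_extensional fn_expansion ell2_coords by (auto simp: H2_ball_def free_holomorphic_def)

lemma expansion_eq_fn:
  assumes "has_free_expansion f (coords h)" "f \<in> extensional nc_ball"
  shows "f = fn h"
proof (rule extensionalityI[OF assms(2) fn_extensional])
  fix X :: "('n, 'a) op_tuple" assume X: "X \<in> nc_ball"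
  show "f X = fn h X"
    by (rule sums_unique2[OF _ fn_sums[OF X]]) (use assms(1) X in \<open>simp add: has_free_expansion_def\<close>)
qed

lemma fn_hvec: "f \<in> H2_ball \<Longrightarrow> fn (hvec f) = f"
  using H2_ball_expansion[OF orthonormal_words_axioms, of f]
  by (intro expansion_eq_fn[symmetric]) (simp_all add: hvec_def)

lemma vec_coords: "vec (coords h) = proj h"
proof -
  have "bessel_bound e 1" using bessel_bound_e[of id] by simp
  from synth_apply[OF this, of h] show ?thesis by (simp add: vec_def proj_def)
qed

lemma hvec_fn [simp]: "hvec (fn h) = proj h"
  by (simp add: hvec_def vec_coords)

lemma proj_complex_ops: "proj \<in> complex_ops"
  unfolding proj_def using bessel_bound_e[of id] by (intro synth_complex_ops) simp

lemma coords_proj [simp]: "coords (proj h) = coords h"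
  using coords_vec[OF ell2_coords[of h]] by (simp add: vec_coords)

lemma fn_eq_iff: "fn x = fn y \<longleftrightarrow> proj x = proj y"
proof
  assume "proj x = proj y"
  then have "coords x \<alpha> = coords y \<alpha>" for \<alpha> by (metis coords_proj)
  then show "fn x = fn y" by (simp add: fn_def)
qed (metis hvec_fn)

lemma fn_proj [simp]: "fn (proj x) = fn x"
  using fn_hvec[OF fn_H2] by simp

lemma proj_hvec: "f \<in> H2_ball \<Longrightarrow> proj (hvec f) = hvec f"
  by (metis fn_hvec hvec_fn)

lemma H2_norm_fn: "H2_norm (fn h) = norm (proj h)"
  using norm_vec[OF ell2_coords[of h]] by (simp add: H2_norm_def ell2_norm_def[symmetric] vec_coords)

lemma H2_norm_fn_le: "H2_norm (fn h) \<le> norm h"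
  using ell2_norm_coords_le[of h] by (simp add: H2_norm_def ell2_norm_def)

lemma norm_hvec: "f \<in> H2_ball \<Longrightarrow> norm (hvec f) = H2_norm f"
  by (metis H2_norm_fn fn_hvec proj_hvec)

section \<open>Transport of the linear structure and of bounded operators\<close>

lemma H2_add_fn: "H2_add (fn x) (fn y) = fn (x + y)"
proof (rule extensionalityI[of _ nc_ball])
  fix X :: "('n, 'a) op_tuple" assume X: "X \<in> nc_ball"
  have eq: "scale_op (coords (x + y) \<alpha>) A = scale_op (coords x \<alpha>) A + scale_op (coords y \<alpha>) A" for \<alpha> A
    by (intro blinfun_eqI) (simp add: cinner_add_left scaleC_add_left blinfun.add_left)
  have "(\<lambda>k. \<Sum>\<alpha> | length \<alpha> = k. scale_op (coords (x + y) \<alpha>) (word_op X \<alpha>)) sums (fn x X + fn y X)"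
    using sums_add[OF fn_sums[OF X, of x] fn_sums[OF X, of y]] by (simp add: eq sum.distrib)
  then show "H2_add (fn x) (fn y) X = fn (x + y) X"
    using X sums_unique2[OF _ fn_sums[OF X]] by (simp add: H2_add_def)
qed (auto simp: H2_add_def fn_extensional)

lemma H2_scale_fn: "H2_scale c (fn x) = fn (scaleC c x)"
proof (rule extensionalityI[of _ nc_ball])
  fix X :: "('n, 'a) op_tuple" assume X: "X \<in> nc_ball"
  have "bounded_linear (scale_op c :: ('a \<Rightarrow>\<^sub>L 'a) \<Rightarrow> _)"
    by (rule bounded_linear_intro[where K = "cmod c"])
      (auto simp: norm_scale_op blinfun.add_left scaleC_add_right blinfun.scaleR_left scaleC.scaleR_right
        mult.commute intro!: blinfun_eqI)
  from bounded_linear.sums[OF this fn_sums[OF X, of x]]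
  have "(\<lambda>k. scale_op c (\<Sum>\<alpha> | length \<alpha> = k. scale_op (coords x \<alpha>) (word_op X \<alpha>))) sums scale_op c (fn x X)" .
  moreover have "scale_op c (\<Sum>\<alpha> | length \<alpha> = k. scale_op (coords x \<alpha>) (word_op X \<alpha>))
      = (\<Sum>\<alpha> | length \<alpha> = k. scale_op (coords (scaleC c x) \<alpha>) (word_op X \<alpha>))" for k
    by (intro blinfun_eqI) (simp add: blinfun.sum_left scaleC.sum_right scaleC_scaleC cinner_scaleC_left)
  ultimately show "H2_scale c (fn x) X = fn (scaleC c x) X"
    using X sums_unique2[OF _ fn_sums[OF X]] by (simp add: H2_scale_def)
qed (auto simp: H2_scale_def fn_extensional)

text \<open>The operator T carried over to the closed span of the e_\<alpha> and extended by zero,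
  so that it lives in the Banach space of bounded maps on H, where Neumann series are at
  hand.\<close>

definition H2_lift :: "('n, 'a) H2_op \<Rightarrow> 'a \<Rightarrow>\<^sub>L 'a" where
  "H2_lift T = Blinfun (\<lambda>h. hvec (T (fn h)))"

context
  fixes T :: "('n, 'a) H2_op"
  assumes T: "H2_bounded_operator T"
begin

lemma T_H2: "T (fn h) \<in> H2_ball"
  using T fn_H2 by (auto simp: H2_bounded_operator_def)

lemma H2_lift_apply: "H2_lift T h = hvec (T (fn h))"
proof -
  obtain K where K: "\<And>f. f \<in> H2_ball \<Longrightarrow> H2_norm (T f) \<le> K * H2_norm f"
    using T unfolding H2_bounded_operator_def by blast
  have sc: "hvec (T (fn (scaleC c x))) = scaleC c (hvec (T (fn x)))" for c x
  proof -
    have "T (fn (scaleC c x)) = H2_scale c (T (fn x))"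
      using T fn_H2 by (simp add: H2_scale_fn[symmetric] H2_bounded_operator_def)
    also have "\<dots> = fn (scaleC c (hvec (T (fn x))))"
      by (simp add: fn_hvec[OF T_H2] H2_scale_fn[symmetric])
    finally show ?thesis by (simp add: complex_opsD[OF proj_complex_ops] proj_hvec[OF T_H2])
  qed
  have "bounded_linear (\<lambda>h. hvec (T (fn h)))"
  proof (rule bounded_linear_intro[where K = "\<bar>K\<bar>"])
    fix x y
    have "T (fn (x + y)) = H2_add (T (fn x)) (T (fn y))"
      using T fn_H2 by (simp add: H2_add_fn[symmetric] H2_bounded_operator_def)
    also have "\<dots> = fn (hvec (T (fn x)) + hvec (T (fn y)))"
      by (simp add: fn_hvec[OF T_H2] H2_add_fn[symmetric])
    finally show "hvec (T (fn (x + y))) = hvec (T (fn x)) + hvec (T (fn y))"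
      by (simp add: blinfun.add_right proj_hvec[OF T_H2])
  next
    fix r x show "hvec (T (fn (scaleR r x))) = scaleR r (hvec (T (fn x)))"
      using sc[of "of_real r" x] by (simp add: scaleC_of_real)
  next
    fix h
    have "norm (hvec (T (fn h))) \<le> K * H2_norm (fn h)"
      using K[OF fn_H2] by (simp add: norm_hvec[OF T_H2])
    also have "\<dots> \<le> \<bar>K\<bar> * H2_norm (fn h)"
      by (intro mult_right_mono) (auto simp: H2_norm_fn)
    also have "\<dots> \<le> \<bar>K\<bar> * norm h"
      by (intro mult_left_mono H2_norm_fn_le) auto
    finally show "norm (hvec (T (fn h))) \<le> norm h * \<bar>K\<bar>" by (simp add: mult.commute)
  qed
  then show ?thesis by (simp add: H2_lift_def bounded_linear_Blinfun_apply)
qed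

lemma fn_H2_lift: "fn (H2_lift T h) = T (fn h)"
  by (simp add: H2_lift_apply fn_hvec[OF T_H2])

lemma proj_H2_lift [simp]: "proj (H2_lift T h) = H2_lift T h"
  by (simp add: H2_lift_apply proj_hvec[OF T_H2])

lemma H2_lift_proj [simp]: "H2_lift T (proj h) = H2_lift T h"
  by (simp add: H2_lift_apply)

lemma H2_lift_complex_ops: "H2_lift T \<in> complex_ops"
  unfolding complex_ops_def
proof safe
  fix c x
  have "T (fn (scaleC c x)) = H2_scale c (T (fn x))"
    using T fn_H2 by (simp add: H2_scale_fn[symmetric] H2_bounded_operator_def)
  then have "fn (H2_lift T (scaleC c x)) = fn (scaleC c (H2_lift T x))"
    by (simp add: fn_H2_lift H2_scale_fn[symmetric])
  then have "proj (H2_lift T (scaleC c x)) = proj (scaleC c (H2_lift T x))"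
    by (simp only: fn_eq_iff)
  then show "H2_lift T (scaleC c x) = scaleC c (H2_lift T x)"
    by (simp add: complex_opsD[OF proj_complex_ops])
qed

lemma resolvent_fn:
  "H2_add (H2_scale c (fn x)) (H2_scale (- 1) (T (fn x))) = fn (scaleC c x - H2_lift T x)"
  by (simp add: fn_H2_lift[symmetric] H2_scale_fn H2_add_fn scaleC.minus_left scaleC_one)

end

text \<open>The way back, which turns an inverse on H into an inverse on the Hardy space.\<close>

lemma bounded_operator_of_complex_op:
  assumes S: "S \<in> complex_ops"
  shows "H2_bounded_operator (\<lambda>f. fn (blinfun_apply S (hvec f)))"
  unfolding H2_bounded_operator_def
proof (intro conjI ballI allI)
  show "(\<lambda>f. fn (S (hvec f))) \<in> H2_ball \<rightarrow> H2_ball" by (simp add: fn_H2)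
next
  fix f g :: "('n, 'a) op_tuple \<Rightarrow> 'a \<Rightarrow>\<^sub>L 'a" assume fg: "f \<in> H2_ball" "g \<in> H2_ball"
  have "H2_add f g = fn (hvec f + hvec g)"
    using fg by (simp add: H2_add_fn[symmetric] fn_hvec)
  then have "hvec (H2_add f g) = hvec f + hvec g"
    using fg by (simp add: blinfun.add_right proj_hvec)
  then show "fn (S (hvec (H2_add f g))) = H2_add (fn (S (hvec f))) (fn (S (hvec g)))"
    by (simp add: H2_add_fn blinfun.add_right)
next
  fix c and f :: "('n, 'a) op_tuple \<Rightarrow> 'a \<Rightarrow>\<^sub>L 'a" assume f: "f \<in> H2_ball"
  have "H2_scale c f = fn (scaleC c (hvec f))"
    using f by (simp add: H2_scale_fn[symmetric] fn_hvec)
  then have "hvec (H2_scale c f) = scaleC c (hvec f)"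
    using f by (simp add: complex_opsD[OF proj_complex_ops] proj_hvec)
  then show "fn (S (hvec (H2_scale c f))) = H2_scale c (fn (S (hvec f)))"
    by (simp add: H2_scale_fn complex_opsD[OF S])
next
  show "\<exists>K. \<forall>f\<in>H2_ball. H2_norm (fn (S (hvec f))) \<le> K * H2_norm f"
  proof (intro exI ballI)
    fix f :: "('n, 'a) op_tuple \<Rightarrow> 'a \<Rightarrow>\<^sub>L 'a" assume f: "f \<in> H2_ball"
    have "H2_norm (fn (S (hvec f))) \<le> norm (S (hvec f))" by (rule H2_norm_fn_le)
    also have "\<dots> \<le> norm S * norm (hvec f)" by (rule norm_blinfun)
    finally show "H2_norm (fn (S (hvec f))) \<le> norm S * H2_norm f" using f by (simp add: norm_hvec)
  qed
qed

text \<open>On the orthogonal complement of the closed span of \<open>e\<close>, where the lift vanishes, \<open>c - T\<close> is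
  multiplication by \<open>c\<close>; this is why \<open>c = 0\<close> has to be excluded.\<close>

lemma H2_invertible_iff:
  assumes T: "H2_bounded_operator T" and c: "c \<noteq> 0"
  shows "H2_invertible (\<lambda>f. H2_add (H2_scale c f) (H2_scale (- 1) (T f)))
    \<longleftrightarrow> op_invertible (scale_op c id_blinfun - H2_lift T)"
proof
  let ?A = "H2_lift T"
  assume "H2_invertible (\<lambda>f. H2_add (H2_scale c f) (H2_scale (- 1) (T f)))"
  then obtain S where S: "H2_bounded_operator S"
    and inv: "\<And>f. f \<in> H2_ball \<Longrightarrow> S (H2_add (H2_scale c f) (H2_scale (- 1) (T f))) = f"
      "\<And>f. f \<in> H2_ball \<Longrightarrow> H2_add (H2_scale c (S f)) (H2_scale (- 1) (T (S f))) = f"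
    unfolding H2_invertible_def by blast
  let ?B = "H2_lift S"
  define R where "R = ?B + scale_op (1 / c) (id_blinfun - proj)"
  have "R \<in> complex_ops"
    unfolding R_def by (intro add_complex_ops scale_complex_ops diff_complex_ops id_complex_ops
        proj_complex_ops H2_lift_complex_ops S)
  moreover have "R o\<^sub>L (scale_op c id_blinfun - ?A) = id_blinfun"
  proof (rule blinfun_eqI)
    fix x
    have "fn (?B (scaleC c x - ?A x)) = fn x"
      by (simp add: fn_H2_lift[OF S] resolvent_fn[OF T, symmetric] inv fn_H2)
    then have "?B (scaleC c x - ?A x) = proj x"
      using fn_eq_iff proj_H2_lift[OF S] by metis
    then show "(R o\<^sub>L (scale_op c id_blinfun - ?A)) x = id_blinfun x"
      using c by (simp add: R_def blinfun.add_left blinfun.diff_left blinfun.diff_right proj_H2_lift[OF T]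
          complex_opsD[OF proj_complex_ops] scaleC.diff_right scaleC.zero_right scaleC_scaleC scaleC_one
          algebra_simps)
  qed
  moreover have "(scale_op c id_blinfun - ?A) o\<^sub>L R = id_blinfun"
  proof (rule blinfun_eqI)
    fix y
    have "fn (scaleC c (?B y) - ?A (?B y)) = fn y"
      by (simp add: resolvent_fn[OF T, symmetric] fn_H2_lift[OF S] inv fn_H2)
    then have "proj (scaleC c (?B y) - ?A (?B y)) = proj y"
      by (simp only: fn_eq_iff)
    then have "scaleC c (?B y) - ?A (?B y) = proj y"
      by (simp add: blinfun.diff_right complex_opsD[OF proj_complex_ops] proj_H2_lift[OF S] proj_H2_lift[OF T])
    then show "((scale_op c id_blinfun - ?A) o\<^sub>L R) y = id_blinfun y"
      using c by (simp add: R_def blinfun.add_left blinfun.add_right blinfun.diff_left blinfun.diff_right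
          H2_lift_proj[OF T] complex_opsD[OF H2_lift_complex_ops[OF T]] scaleC.diff_right scaleC_add_right
          scaleC_scaleC scaleC_one algebra_simps)
  qed
  ultimately show "op_invertible (scale_op c id_blinfun - ?A)" unfolding op_invertible_def by blast
next
  let ?A = "H2_lift T"
  assume "op_invertible (scale_op c id_blinfun - ?A)"
  then obtain S where S: "S \<in> complex_ops" and eq: "S o\<^sub>L (scale_op c id_blinfun - ?A) = id_blinfun"
      "(scale_op c id_blinfun - ?A) o\<^sub>L S = id_blinfun"
    unfolding op_invertible_def by blast
  have SA: "S (scaleC c x - ?A x) = x" for x
    using arg_cong[OF eq(1), of "\<lambda>A. blinfun_apply A x"] by (simp add: blinfun.diff_left)
  have AS: "scaleC c (S x) - ?A (S x) = x" for x
    using arg_cong[OF eq(2), of "\<lambda>A. blinfun_apply A x"] by (simp add: blinfun.diff_left)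
  show "H2_invertible (\<lambda>f. H2_add (H2_scale c f) (H2_scale (- 1) (T f)))"
    unfolding H2_invertible_def
  proof (intro exI conjI ballI)
    show "H2_bounded_operator (\<lambda>f. fn (S (hvec f)))" by (rule bounded_operator_of_complex_op[OF S])
    fix f :: "('n, 'a) op_tuple \<Rightarrow> 'a \<Rightarrow>\<^sub>L 'a" assume f: "f \<in> H2_ball"
    have "H2_add (H2_scale c f) (H2_scale (- 1) (T f)) = fn (scaleC c (hvec f) - ?A (hvec f))"
      using resolvent_fn[OF T, of c "hvec f"] f by (simp add: fn_hvec)
    then show "fn (S (hvec (H2_add (H2_scale c f) (H2_scale (- 1) (T f))))) = f"
      using f by (simp add: blinfun.diff_right complex_opsD[OF proj_complex_ops] proj_hvec proj_H2_lift[OF T]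
          SA[unfolded blinfun.diff_right] fn_hvec)
    show "H2_add (H2_scale c (fn (S (hvec f)))) (H2_scale (- 1) (T (fn (S (hvec f))))) = f"
      using f by (simp add: resolvent_fn[OF T] AS fn_hvec)
  qed
qed

end

section \<open>The subordination estimate\<close>

lemma cadjoint_compose:
  assumes "A \<in> complex_ops" "B \<in> complex_ops"
  shows "cadjoint (A o\<^sub>L B) = cadjoint B o\<^sub>L cadjoint A"
  by (rule cadjoint_eqI) (simp add: assms cinner_cadjoint)

text \<open>The core of Cauchy-Schwarz for a form that may vanish at nonzero vectors: q stands for
  |<x, z>|^2, and the polynomial is the form at x - t <x, z> z.\<close>

lemma quadratic_nonneg_bound:
  fixes A B q :: real
  assumes key: "\<And>t. 0 \<le> A - 2 * t * q + t\<^sup>2 * q * B" and "0 \<le> q" "0 \<le> A" "0 \<le> B"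
  shows "q \<le> A * B"
proof (cases "B = 0")
  case True
  show ?thesis
  proof (rule ccontr)
    assume "\<not> ?thesis"
    then have "q > 0" using True assms(2) by simp
    \<comment> \<open>With B = 0 the polynomial is linear in t, and this t makes it
      negative.\<close>
    then show False using key[of "(A + 1) / q"] True assms(3) by simp
  qed
next
  case False
  then have "B > 0" using assms(4) by simp
  then show ?thesis using key[of "1 / B"] by (simp add: field_simps power2_eq_square)
qed

text \<open>The form <D x, z> for D = 1 - \<Sum> M_i M_i^*. It is positive semidefinite on the ball,
  and its Cauchy-Schwarz inequality takes the place of the square root of D.\<close>

definition defect :: "('n::finite, 'a::complex_hilbert) op_tuple \<Rightarrow> 'a \<Rightarrow> 'a \<Rightarrow> complex" where
  "defect M x z = cinner x z - (\<Sum>i\<in>UNIV. cinner (cadjoint (M i) x) (cadjoint (M i) z))"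

abbreviation defect_norm2 :: "('n::finite, 'a::complex_hilbert) op_tuple \<Rightarrow> 'a \<Rightarrow> real" where
  "defect_norm2 M z \<equiv> (norm z)\<^sup>2 - (\<Sum>i\<in>UNIV. (norm (cadjoint (M i) z))\<^sup>2)"

context
  fixes M :: "('n::finite, 'a::complex_hilbert) op_tuple"
  assumes M: "M \<in> nc_ball"
begin

lemma defect_norm2_nonneg: "0 \<le> defect_norm2 M z"
proof -
  obtain r where r: "0 \<le> r" "r < 1" "row_bound M r" using nc_ball_row_bound[OF M] .
  have "(\<Sum>i\<in>UNIV. (norm (cadjoint (M i) z))\<^sup>2) \<le> r\<^sup>2 * (norm z)\<^sup>2"
    using r(3) row_bound_iff_column[of M r] nc_ball_complex_ops[OF M] by blast
  also have "\<dots> \<le> 1 * (norm z)\<^sup>2"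
    using r by (intro mult_right_mono) (auto simp: power_le_one)
  finally show ?thesis by simp
qed

lemma defect_self: "defect M z z = of_real (defect_norm2 M z)"
  by (simp add: defect_def cinner_self)

lemma defect_Cauchy_Schwarz: "(cmod (defect M x z))\<^sup>2 \<le> defect_norm2 M x * defect_norm2 M z"
proof -
  let ?Q = "defect M x z"
  have Mc: "cadjoint (M i) \<in> complex_ops" for i
    by (rule cadjoint_complex_ops[OF nc_ball_complex_ops[OF M]])
  have exp: "defect M (x - scaleC \<mu> z) (x - scaleC \<mu> z)
      = defect M x x - cnj \<mu> * ?Q - \<mu> * cnj ?Q + \<mu> * cnj \<mu> * defect M z z" for \<mu>
    using cinner_commute[of z x] cinner_commute[of "cadjoint (M _) z" "cadjoint (M _) x"]
    by (simp add: defect_def cinner.diff_left cinner.diff_right cinner_scaleC_left cinner_scaleC_right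
        blinfun.diff_right complex_opsD[OF Mc] sum.distrib sum_subtractf sum_distrib_left algebra_simps)
  have key: "0 \<le> defect_norm2 M x - 2 * t * (cmod ?Q)\<^sup>2 + t\<^sup>2 * (cmod ?Q)\<^sup>2 * defect_norm2 M z" for t
  proof -
    define A B where "A = defect_norm2 M x" and "B = defect_norm2 M z"
    have AB: "defect M x x = of_real A" "defect M z z = of_real B"
      by (simp_all only: defect_self A_def B_def)
    have "complex_of_real (defect_norm2 M (x - scaleC (of_real t * ?Q) z))
      = of_real A - 2 * of_real t * (?Q * cnj ?Q) + (of_real t)\<^sup>2 * (?Q * cnj ?Q) * of_real B"
      unfolding defect_self[symmetric] exp AB by (simp add: power2_eq_square algebra_simps)
    also have "\<dots> = of_real (defect_norm2 M x - 2 * t * (cmod ?Q)\<^sup>2 + t\<^sup>2 * (cmod ?Q)\<^sup>2 * defect_norm2 M z)"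
      unfolding complex_norm_square[symmetric] A_def[symmetric] B_def[symmetric] by simp
    finally show ?thesis using defect_norm2_nonneg by (metis of_real_eq_iff)
  qed
  then show ?thesis
    by (rule quadratic_nonneg_bound[OF _ _ defect_norm2_nonneg defect_norm2_nonneg]) simp
qed

lemma defect_telescope:
  "(\<Sum>k<m. \<Sum>\<alpha> | length \<alpha> = k. defect_norm2 M (cadjoint (word_op M \<alpha>) y)) \<le> (norm y)\<^sup>2"
proof -
  have Mc: "M i \<in> complex_ops" for i by (rule nc_ball_complex_ops[OF M])
  have "(\<Sum>k<m. \<Sum>\<alpha> | length \<alpha> = k. defect_norm2 M (cadjoint (word_op M \<alpha>) y))
      = (norm y)\<^sup>2 - (\<Sum>\<alpha> | length \<alpha> = m. (norm (cadjoint (word_op M \<alpha>) y))\<^sup>2)"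
  proof (induction m)
    case 0
    have "cadjoint id_blinfun = (id_blinfun :: 'a \<Rightarrow>\<^sub>L 'a)" by (rule cadjoint_eqI) simp
    then show ?case by simp
  next
    case (Suc m)
    \<comment> \<open>Adjoints reverse products, so M_i^* acts last exactly when i is appended at
      the end of the word.\<close>
    have "cadjoint (word_op M (\<alpha> @ [i])) y = cadjoint (M i) (cadjoint (word_op M \<alpha>) y)" for \<alpha> i
    proof -
      have "word_op M [i] = M i" by (rule blinfun_eqI) simp
      then have "cadjoint (word_op M (\<alpha> @ [i])) = cadjoint (M i) o\<^sub>L cadjoint (word_op M \<alpha>)"
        by (simp only: word_op_append cadjoint_compose[OF word_op_complex_ops[OF Mc] Mc])
      then show ?thesis by simp
    qed
    then show ?case
      by (simp only: sum.lessThan_Suc Suc.IH) (simp add: sum_words_Suc_snoc sum_subtractf)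
  qed
  then show ?thesis by (simp add: sum_nonneg)
qed

end

text \<open>Coefficients of \<open>a (1 - \<Sum> cnj (l i) X\<^sub>i)\<inverse>\<close>; the argument is the reversed word.\<close>

primrec right_quotient :: "('n list \<Rightarrow> complex) \<Rightarrow> ('n \<Rightarrow> complex) \<Rightarrow> 'n list \<Rightarrow> complex" where
  "right_quotient a l [] = a []"
| "right_quotient a l (i # w) = a (rev w @ [i]) + cnj (l i) * right_quotient a l w"

text \<open>Right multiplication by \<Sum> cnj(l_i) X_i is L times an isometry of ell2. As g is a
  plus this image of g, |g| \<le> K + L |g|. Truncation at length m makes |g| finite beforehand, so
  that it can be absorbed on the left.\<close>

lemma right_quotient_L2:
  fixes a :: "'n::finite list \<Rightarrow> complex" and l :: "'n \<Rightarrow> complex"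
  assumes L: "(\<Sum>i\<in>UNIV. (cmod (l i))\<^sup>2) = L\<^sup>2" "0 \<le> L" "L < 1"
    and a: "\<And>F. finite F \<Longrightarrow> L2_set (\<lambda>\<alpha>. cmod (a \<alpha>)) F \<le> K"
  shows "L2_set (\<lambda>\<alpha>. cmod (right_quotient a l (rev \<alpha>))) {\<alpha>. length \<alpha> \<le> m} \<le> K / (1 - L)"
proof -
  let ?g = "\<lambda>\<alpha>. right_quotient a l (rev \<alpha>)"
  let ?W = "{\<alpha> :: 'n list. length \<alpha> \<le> m}"
  define \<sigma> where "\<sigma> \<gamma> = (if \<gamma> = [] then 0 else cnj (l (last \<gamma>)) * ?g (butlast \<gamma>))" for \<gamma>
  let ?N = "L2_set (\<lambda>\<alpha>. cmod (?g \<alpha>)) ?W"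
  have g: "?g \<gamma> = a \<gamma> + \<sigma> \<gamma>" for \<gamma>
    by (cases \<gamma> rule: rev_cases) (auto simp: \<sigma>_def)
  have step: "(\<Sum>\<gamma> | length \<gamma> = Suc k. (cmod (\<sigma> \<gamma>))\<^sup>2) = L\<^sup>2 * (\<Sum>\<alpha> | length \<alpha> = k. (cmod (?g \<alpha>))\<^sup>2)" for k
    by (simp add: sum_words_Suc_snoc \<sigma>_def norm_mult power_mult_distrib sum_distrib_right[symmetric]
        L(1) sum_distrib_left)
  have "(\<Sum>\<gamma>\<in>?W. (cmod (\<sigma> \<gamma>))\<^sup>2) = L\<^sup>2 * (\<Sum>k<m. \<Sum>\<alpha> | length \<alpha> = k. (cmod (?g \<alpha>))\<^sup>2)"
    unfolding sum_words_le
  proof (induction m)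
    case (Suc m)
    then show ?case by (simp add: step distrib_left del: words_0)
  qed (simp add: \<sigma>_def)
  also have "\<dots> \<le> L\<^sup>2 * (\<Sum>\<alpha>\<in>?W. (cmod (?g \<alpha>))\<^sup>2)"
    unfolding sum_words_le by (intro mult_left_mono sum_mono2) (auto intro: sum_nonneg)
  finally have \<sigma>: "L2_set (\<lambda>\<gamma>. cmod (\<sigma> \<gamma>)) ?W \<le> L * ?N"
    using L(2) unfolding L2_set_def by (metis real_sqrt_le_iff real_sqrt_mult real_sqrt_abs abs_of_nonneg)
  have "?N \<le> L2_set (\<lambda>\<gamma>. cmod (a \<gamma>) + cmod (\<sigma> \<gamma>)) ?W"
    unfolding g by (intro L2_set_mono norm_triangle_ineq) auto
  also have "\<dots> \<le> L2_set (\<lambda>\<gamma>. cmod (a \<gamma>)) ?W + L2_set (\<lambda>\<gamma>. cmod (\<sigma> \<gamma>)) ?W"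
    by (rule L2_set_triangle_ineq)
  also have "\<dots> \<le> K + L * ?N" using a[of ?W] \<sigma> by simp
  finally show ?thesis using L(3) by (simp add: field_simps)
qed

lemma subordination_bound:
  fixes M :: "('n::finite, 'a::complex_hilbert) op_tuple"
  assumes M: "M \<in> nc_ball" and f: "has_free_expansion f a" and a: "ell2 a"
    and u: "norm u = 1" "\<And>i. cadjoint (M i) u = scaleC (cnj (l i)) u"
    and L: "(\<Sum>i\<in>UNIV. (cmod (l i))\<^sup>2) = L\<^sup>2" "0 \<le> L" "L < 1"
  shows "norm (f M u) \<le> sqrt (1 - L\<^sup>2) / (1 - L) * ell2_norm a"
proof -
  obtain r where r: "0 \<le> r" "r < 1" "row_bound M r" using nc_ball_row_bound[OF M] .
  have Mc: "M i \<in> complex_ops" for i by (rule nc_ball_complex_ops[OF M])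
  define g where "g \<alpha> = right_quotient a l (rev \<alpha>)" for \<alpha>
  define G where "G = ell2_norm a / (1 - L)"
  \<comment> \<open>This is D u, by the eigenvalue relation for u.\<close>
  define d where "d = u - (\<Sum>i\<in>UNIV. scaleC (cnj (l i)) (M i u))"
  have g_le: "L2_set (\<lambda>\<alpha>. cmod (g \<alpha>)) {\<alpha>. length \<alpha> \<le> m} \<le> G" for m
    unfolding g_def G_def by (rule right_quotient_L2[OF L L2_set_le_ell2_norm[OF a]])
  have G0: "0 \<le> G" using L by (simp add: G_def)
  define P where "P m = (\<Sum>k<m. \<Sum>\<alpha> | length \<alpha> = k. scaleC (g \<alpha>) (word_op M \<alpha> d))" for m
  define E where "E m = (\<Sum>\<alpha> | length \<alpha> = m. scaleC (g \<alpha>) (word_op M \<alpha> u))" for m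
  \<comment> \<open>Summation by parts for a = g (1 - \<Sum> cnj(l_i) X_i); truncation leaves the
    top-degree term E.\<close>
  have ident: "(\<Sum>k\<le>m. \<Sum>\<alpha> | length \<alpha> = k. scaleC (a \<alpha>) (word_op M \<alpha> u)) = P m + E m" for m
  proof (induction m)
    case 0
    show ?case by (simp add: P_def E_def g_def)
  next
    case (Suc m)
    have w: "word_op M (\<alpha> @ [i]) u = word_op M \<alpha> (M i u)" for \<alpha> i
      by (simp add: word_op_append)
    have a_eq: "a (\<alpha> @ [i]) = g (\<alpha> @ [i]) - cnj (l i) * g \<alpha>" for \<alpha> i
      by (simp add: g_def)
    have wd: "word_op M \<alpha> d = word_op M \<alpha> u - (\<Sum>i\<in>UNIV. scaleC (cnj (l i)) (word_op M \<alpha> (M i u)))" for \<alpha>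
      by (simp add: d_def blinfun.diff_right blinfun.sum_right complex_opsD[OF word_op_complex_ops[OF Mc]])
    have "(\<Sum>\<alpha> | length \<alpha> = Suc m. scaleC (a \<alpha>) (word_op M \<alpha> u))
        = E (Suc m) - (\<Sum>\<alpha> | length \<alpha> = m. scaleC (g \<alpha>) (\<Sum>i\<in>UNIV. scaleC (cnj (l i)) (word_op M \<alpha> (M i u))))"
      by (simp add: E_def sum_words_Suc_snoc a_eq w scaleC.diff_left sum_subtractf scaleC.sum_right
          scaleC_scaleC mult.commute)
    also have "\<dots> = E (Suc m) - E m + (\<Sum>\<alpha> | length \<alpha> = m. scaleC (g \<alpha>) (word_op M \<alpha> d))"
      by (simp add: wd scaleC.diff_right sum_subtractf E_def)
    finally show ?case using Suc by (simp add: P_def)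
  qed
  have du: "defect_norm2 M u = 1 - L\<^sup>2"
    using u L(1) by (simp add: norm_scaleC)
  have dz: "cinner d z = defect M u z" for z
    by (simp add: d_def defect_def cinner.diff_left cinner.sum_left cinner_scaleC_left u(2)
        cinner_cadjoint[OF Mc])
  \<comment> \<open>P is paired with itself and the words move to the other side as adjoints.
    Cauchy-Schwarz for the defect form splits off sqrt(1 - L^2), which comes from u; Cauchy-Schwarz
    over the words splits off G; the telescoping bound leaves |P|, which cancels.\<close>
  have P_le: "norm (P m) \<le> sqrt (1 - L\<^sup>2) * G" for m
  proof -
    let ?W = "{\<alpha> :: 'n list. length \<alpha> < m}"
    have W: "(\<Sum>\<alpha>\<in>?W. h \<alpha>) = (\<Sum>k<m. \<Sum>\<alpha> | length \<alpha> = k. h \<alpha>)" for h :: "'n list \<Rightarrow> 'c::comm_monoid_add"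
    proof (cases m)
      case (Suc m')
      then show ?thesis using sum_words_le[of h m'] by (simp add: less_Suc_eq_le lessThan_Suc_atMost)
    qed simp
    let ?y = "P m"
    let ?q = "\<lambda>\<alpha>. sqrt (defect_norm2 M (cadjoint (word_op M \<alpha>) ?y))"
    have "complex_of_real ((norm ?y)\<^sup>2) = cinner ?y ?y" by (simp add: cinner_self)
    also have "\<dots> = (\<Sum>\<alpha>\<in>?W. g \<alpha> * defect M u (cadjoint (word_op M \<alpha>) ?y))"
      by (subst (1) P_def) (simp add: W[symmetric] cinner.sum_left cinner_scaleC_left
          cinner_cadjoint[OF word_op_complex_ops[OF Mc]] dz)
    finally have "(norm ?y)\<^sup>2 = cmod (\<Sum>\<alpha>\<in>?W. g \<alpha> * defect M u (cadjoint (word_op M \<alpha>) ?y))"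
      by (metis norm_of_real abs_of_nonneg zero_le_power2)
    also have "\<dots> \<le> (\<Sum>\<alpha>\<in>?W. cmod (g \<alpha>) * (sqrt (1 - L\<^sup>2) * ?q \<alpha>))"
    proof (rule sum_norm_le)
      fix \<alpha>
      have "cmod (defect M u (cadjoint (word_op M \<alpha>) ?y)) \<le> sqrt (1 - L\<^sup>2) * ?q \<alpha>"
        using defect_Cauchy_Schwarz[OF M, of u "cadjoint (word_op M \<alpha>) ?y"]
        unfolding du real_sqrt_mult[symmetric] by (rule real_le_rsqrt)
      then show "norm (g \<alpha> * defect M u (cadjoint (word_op M \<alpha>) ?y)) \<le> cmod (g \<alpha>) * (sqrt (1 - L\<^sup>2) * ?q \<alpha>)"
        by (simp add: norm_mult mult_left_mono)
    qed
    also have "\<dots> = sqrt (1 - L\<^sup>2) * (\<Sum>\<alpha>\<in>?W. \<bar>cmod (g \<alpha>)\<bar> * \<bar>?q \<alpha>\<bar>)"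
    proof -
      have "\<bar>?q \<alpha>\<bar> = ?q \<alpha>" for \<alpha>
        by (rule abs_of_nonneg) (rule real_sqrt_ge_zero[OF defect_norm2_nonneg[OF M]])
      then show ?thesis by (simp only: abs_norm_cancel sum_distrib_left mult.left_commute)
    qed
    also have "\<dots> \<le> sqrt (1 - L\<^sup>2) * (G * norm ?y)"
    proof (intro mult_left_mono order_trans[OF L2_set_mult_ineq] mult_mono)
      have "L2_set (\<lambda>\<alpha>. cmod (g \<alpha>)) ?W \<le> L2_set (\<lambda>\<alpha>. cmod (g \<alpha>)) {\<alpha>. length \<alpha> \<le> m}"
        unfolding L2_set_def by (intro real_sqrt_le_mono sum_mono2) auto
      then show "L2_set (\<lambda>\<alpha>. cmod (g \<alpha>)) ?W \<le> G" using g_le[of m] by linarith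
      have "(\<Sum>\<alpha>\<in>?W. (?q \<alpha>)\<^sup>2) \<le> (norm ?y)\<^sup>2"
        using defect_telescope[OF M, of ?y m]
        by (simp only: W real_sqrt_pow2[OF defect_norm2_nonneg[OF M]])
      then show "L2_set ?q ?W \<le> norm ?y"
        unfolding L2_set_def by (intro real_le_lsqrt) auto
      show "0 \<le> sqrt (1 - L\<^sup>2)" using L by (simp add: power_le_one)
    qed (auto simp: G0)
    finally have "norm ?y * norm ?y \<le> (sqrt (1 - L\<^sup>2) * G) * norm ?y"
      by (simp add: power2_eq_square mult_ac)
    moreover have "0 \<le> sqrt (1 - L\<^sup>2) * G" using G0 L by (simp add: power_le_one)
    ultimately show ?thesis
      by (cases "norm ?y = 0") (auto dest: mult_right_le_imp_le)
  qed
  \<comment> \<open>The top-degree term dies out because M has a row bound r < 1, while its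
    coefficients stay bounded by G.\<close>
  have E_le: "norm (E m) \<le> G * r ^ m" for m
  proof -
    have "norm (E m) \<le> level_norm g m * r ^ m * norm u"
      unfolding E_def by (rule norm_level_apply_le[OF r(3,1) Mc])
    also have "level_norm g m \<le> L2_set (\<lambda>\<alpha>. cmod (g \<alpha>)) {\<alpha>. length \<alpha> \<le> m}"
      unfolding L2_set_def by (intro real_sqrt_le_mono sum_mono2) auto
    also have "\<dots> \<le> G" by (rule g_le)
    finally show ?thesis using r u by (simp add: mult_right_mono)
  qed
  have "(\<lambda>m. norm (P m + E m)) \<longlonglongrightarrow> norm (f M u)"
    using tendsto_norm[OF expansion_apply_sums[OF f M, of u, unfolded sums_def_le]] unfolding ident .
  moreover have "(\<lambda>m. sqrt (1 - L\<^sup>2) * G + G * r ^ m) \<longlonglongrightarrow> sqrt (1 - L\<^sup>2) * G + G * 0"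
    using r by (intro tendsto_intros LIMSEQ_realpow_zero)
  moreover have "norm (P m + E m) \<le> sqrt (1 - L\<^sup>2) * G + G * r ^ m" for m
    using norm_triangle_ineq[of "P m" "E m"] P_le[of m] E_le[of m] by linarith
  ultimately have "norm (f M u) \<le> sqrt (1 - L\<^sup>2) * G + G * 0"
    by (intro LIMSEQ_le) auto
  then show ?thesis by (simp add: G_def)
qed

section \<open>The spectral radius formula\<close>

primrec op_power :: "('a::real_normed_vector \<Rightarrow>\<^sub>L 'a) \<Rightarrow> nat \<Rightarrow> 'a \<Rightarrow>\<^sub>L 'a" where
  "op_power A 0 = id_blinfun"
| "op_power A (Suc k) = A o\<^sub>L op_power A k"

lemma op_power_commute: "op_power A k (A x) = A (op_power A k x)"
  by (induction k) auto

lemma op_power_complex_ops: "A \<in> complex_ops \<Longrightarrow> op_power A k \<in> complex_ops"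
  by (induction k) (auto intro: id_complex_ops compose_complex_ops)

lemma norm_op_power_le: "norm (op_power A k) \<le> norm A ^ k"
proof (induction k)
  case (Suc k)
  have "norm (op_power A (Suc k)) \<le> norm A * norm (op_power A k)" by (simp add: norm_blinfun_compose)
  also have "\<dots> \<le> norm A * norm A ^ k" by (rule mult_left_mono[OF Suc]) simp
  finally show ?case by simp
qed (simp add: norm_blinfun_id_le)

lemma op_power_scale:
  assumes "A \<in> complex_ops"
  shows "op_power (scale_op c A) k = scale_op (c ^ k) (op_power A k)"
  by (induction k) (auto intro!: blinfun_eqI simp: scaleC_one complex_opsD[OF assms] scaleC_scaleC mult.commute)

lemma geometric_op_left:
  "(\<Sum>j<m. op_power A j) o\<^sub>L (id_blinfun - A) = id_blinfun - op_power A m"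
proof (rule blinfun_eqI)
  fix x
  have "(\<Sum>j<m. op_power A j (x - A x)) = x - op_power A m x"
    by (induction m) (auto simp: blinfun.diff_right op_power_commute)
  then show "((\<Sum>j<m. op_power A j) o\<^sub>L (id_blinfun - A)) x = (id_blinfun - op_power A m) x"
    by (simp add: blinfun.sum_left blinfun.diff_left)
qed

lemma geometric_op_right:
  "(id_blinfun - A) o\<^sub>L (\<Sum>j<m. op_power A j) = id_blinfun - op_power A m"
proof (rule blinfun_eqI)
  fix x
  have "A (\<Sum>j<m. op_power A j x) = (\<Sum>j<m. op_power A j (A x))"
    by (simp add: blinfun.sum_right op_power_commute)
  then show "((id_blinfun - A) o\<^sub>L (\<Sum>j<m. op_power A j)) x = (id_blinfun - op_power A m) x"
    using arg_cong[OF geometric_op_left[of A m], of "\<lambda>B. blinfun_apply B x"]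
    by (simp add: blinfun.diff_left blinfun.sum_left blinfun.diff_right sum_subtractf)
qed

text \<open>A left and a right inverse may be supplied separately and then coincide; below they also
  arise as S Q and Q S.\<close>

lemma op_invertibleI:
  assumes "L \<in> complex_ops" "L o\<^sub>L A = id_blinfun" "A o\<^sub>L R = id_blinfun"
  shows "op_invertible A"
proof -
  have "L o\<^sub>L (A o\<^sub>L R) = (L o\<^sub>L A) o\<^sub>L R" by (rule blinfun_eqI) simp
  then have "L = R" by (metis assms(2,3) blinfun_eqI blinfun_apply_blinfun_compose blinfun_apply_id_blinfun)
  then show ?thesis using assms unfolding op_invertible_def by blast
qed

lemma op_invertible_scale:
  assumes A: "op_invertible A" and c: "c \<noteq> 0" and Ac: "A \<in> complex_ops"
  shows "op_invertible (scale_op c A)"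
proof -
  obtain S where S: "S \<in> complex_ops" "S o\<^sub>L A = id_blinfun" "A o\<^sub>L S = id_blinfun"
    using A unfolding op_invertible_def by blast
  have SA: "S (A x) = x" "A (S x) = x" for x
    using arg_cong[OF S(2), of "\<lambda>B. blinfun_apply B x"] arg_cong[OF S(3), of "\<lambda>B. blinfun_apply B x"] by auto
  show ?thesis
    by (rule op_invertibleI[of "scale_op (1 / c) S" _ "scale_op (1 / c) S"])
      (auto intro!: blinfun_eqI scale_complex_ops S simp: complex_opsD[OF S(1)] complex_opsD[OF Ac]
        scaleC_scaleC SA scaleC_one c)
qed

lemma op_invertible_id_diff:
  fixes B :: "'a::complex_hilbert \<Rightarrow>\<^sub>L 'a"
  assumes B: "B \<in> complex_ops" "norm B < 1"
  shows "op_invertible (id_blinfun - B)"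
proof -
  have "summable (op_power B)"
    by (rule summable_comparison_test'[OF summable_geometric[of "norm B"]])
      (use B norm_op_power_le in auto)
  then obtain S where S: "op_power B sums S" by (auto simp: summable_def)
  have lim: "(\<lambda>m. id_blinfun - op_power B m) \<longlonglongrightarrow> id_blinfun - 0"
    by (intro tendsto_intros summable_LIMSEQ_zero sums_summable[OF S])
  have "(\<lambda>m. (\<Sum>j<m. op_power B j) o\<^sub>L (id_blinfun - B)) \<longlonglongrightarrow> (S o\<^sub>L (id_blinfun - B))"
    by (intro bounded_bilinear.tendsto[OF bounded_bilinear_blinfun_compose] S[unfolded sums_def] tendsto_const)
  then have "S o\<^sub>L (id_blinfun - B) = id_blinfun"
    using LIMSEQ_unique[OF _ lim] by (simp only: geometric_op_left diff_zero)
  moreover have "(\<lambda>m. (id_blinfun - B) o\<^sub>L (\<Sum>j<m. op_power B j)) \<longlonglongrightarrow> ((id_blinfun - B) o\<^sub>L S)"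
    by (intro bounded_bilinear.tendsto[OF bounded_bilinear_blinfun_compose] S[unfolded sums_def] tendsto_const)
  then have "(id_blinfun - B) o\<^sub>L S = id_blinfun"
    using LIMSEQ_unique[OF _ lim] by (simp only: geometric_op_right diff_zero)
  moreover have "S \<in> complex_ops"
    by (rule sums_complex_ops[OF op_power_complex_ops[OF B(1)] S])
  ultimately show ?thesis by (intro op_invertibleI)
qed

text \<open>The easy half of Gelfand's formula: 1 - D^k is 1 - D times a polynomial Q in D, on
  either side, so 1 - D inherits invertibility from 1 - D^k, to which the Neumann series
  applies.\<close>

lemma op_invertible_of_power_small:
  fixes A :: "'a::complex_hilbert \<Rightarrow>\<^sub>L 'a"
  assumes A: "A \<in> complex_ops" and c: "c \<noteq> 0" and small: "norm (op_power A k) < cmod c ^ k"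
  shows "op_invertible (scale_op c id_blinfun - A)"
proof -
  define D where "D = scale_op (1 / c) A"
  define Q where "Q = (\<Sum>j<k. op_power D j)"
  have D: "D \<in> complex_ops" unfolding D_def by (rule scale_complex_ops[OF A])
  have Q: "Q \<in> complex_ops" unfolding Q_def by (intro sum_complex_ops op_power_complex_ops D)
  have "norm (op_power D k) < 1"
    using small c by (simp add: D_def op_power_scale[OF A] norm_scale_op norm_divide norm_power power_one_over)
  then have "op_invertible (id_blinfun - op_power D k)"
    by (rule op_invertible_id_diff[OF op_power_complex_ops[OF D]])
  then obtain S where S: "S \<in> complex_ops" "S o\<^sub>L (id_blinfun - op_power D k) = id_blinfun"
      "(id_blinfun - op_power D k) o\<^sub>L S = id_blinfun"
    unfolding op_invertible_def by blast
  have "op_invertible (id_blinfun - D)"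
  proof (rule op_invertibleI)
    show "S o\<^sub>L Q \<in> complex_ops" by (intro compose_complex_ops S Q)
    show "(S o\<^sub>L Q) o\<^sub>L (id_blinfun - D) = id_blinfun"
    proof -
      have "(S o\<^sub>L Q) o\<^sub>L (id_blinfun - D) = S o\<^sub>L (Q o\<^sub>L (id_blinfun - D))" by (rule blinfun_eqI) simp
      then show ?thesis by (simp only: Q_def geometric_op_left S(2))
    qed
    show "(id_blinfun - D) o\<^sub>L (Q o\<^sub>L S) = id_blinfun"
    proof -
      have "(id_blinfun - D) o\<^sub>L (Q o\<^sub>L S) = ((id_blinfun - D) o\<^sub>L Q) o\<^sub>L S" by (rule blinfun_eqI) simp
      then show ?thesis by (simp only: Q_def geometric_op_right S(3))
    qed
  qed
  then have "op_invertible (scale_op c (id_blinfun - D))"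
    by (intro op_invertible_scale c diff_complex_ops id_complex_ops D)
  moreover have "scale_op c (id_blinfun - D) = scale_op c id_blinfun - A"
    by (rule blinfun_eqI) (use c in \<open>simp add: D_def blinfun.diff_left scaleC.diff_right scaleC_scaleC scaleC_one\<close>)
  ultimately show ?thesis by simp
qed

text \<open>The hard half of Gelfand's formula. In the variable w = 1 / c the resolvent R(w),
  inverse to 1 - w A, is analytic for |w| < 1 / s with Taylor coefficients A^k at 0, and Cauchy's
  inequality at radius 1 / t bounds them. Analyticity is used for the scalar functions <R(w) x, y>;
  the bound K of R on a closed disc makes the estimate uniform in x and y.\<close>

lemma op_power_growth:
  fixes A :: "'a::complex_hilbert \<Rightarrow>\<^sub>L 'a"
  assumes A: "A \<in> complex_ops" and s: "0 < s" "s < t"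
    and inv: "\<And>c. s < cmod c \<Longrightarrow> op_invertible (scale_op c id_blinfun - A)"
  shows "\<exists>K. \<forall>k. norm (op_power A k) \<le> K * t ^ k"
proof -
  define B where "B = ball (0::complex) (1 / s)"
  have oB: "open B" and zB: "0 \<in> B" using s by (auto simp: B_def)
  have "\<exists>S. S \<in> complex_ops \<and> S o\<^sub>L (id_blinfun - scale_op w A) = id_blinfun
      \<and> (id_blinfun - scale_op w A) o\<^sub>L S = id_blinfun" if "w \<in> B" for w
  proof -
    have "op_invertible (id_blinfun - scale_op w A)"
    proof (cases "w = 0")
      case True
      have "scale_op 0 A = 0" by (rule blinfun_eqI) (simp add: scaleC.zero_left)
      then show ?thesis using True
        by (intro op_invertibleI[of id_blinfun _ id_blinfun] id_complex_ops) (auto intro: blinfun_eqI)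
    next
      case False
      then have "s < cmod (1 / w)" using that s by (simp add: B_def norm_divide field_simps)
      then have "op_invertible (scale_op w (scale_op (1 / w) id_blinfun - A))"
        using False A by (intro op_invertible_scale inv diff_complex_ops scale_complex_ops id_complex_ops)
      moreover have "scale_op w (scale_op (1 / w) id_blinfun - A) = id_blinfun - scale_op w A"
        by (rule blinfun_eqI) (use False in \<open>simp add: blinfun.diff_left scaleC.diff_right scaleC_scaleC scaleC_one\<close>)
      ultimately show ?thesis by simp
    qed
    then show ?thesis unfolding op_invertible_def by blast
  qed
  then obtain R where Rc: "\<And>w. w \<in> B \<Longrightarrow> R w \<in> complex_ops"
    and R1: "\<And>w. w \<in> B \<Longrightarrow> R w o\<^sub>L (id_blinfun - scale_op w A) = id_blinfun"
    and R2: "\<And>w. w \<in> B \<Longrightarrow> (id_blinfun - scale_op w A) o\<^sub>L R w = id_blinfun"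
    by metis
  have R1': "R w (x - scaleC w (A x)) = x" if "w \<in> B" for w x
    using arg_cong[OF R1[OF that], of "\<lambda>A. blinfun_apply A x"] by (simp add: blinfun.diff_left)
  have R2': "R w x - scaleC w (A (R w x)) = x" if "w \<in> B" for w x
    using arg_cong[OF R2[OF that], of "\<lambda>A. blinfun_apply A x"] by (simp add: blinfun.diff_left)
  \<comment> \<open>The resolvent identity yields first the continuity of R and then its derivative
    R(v) A R(v), tested on pairs of vectors.\<close>
  have res: "R w x - R v x = scaleC (w - v) (R w (A (R v x)))" if "w \<in> B" "v \<in> B" for w v x
  proof -
    have "R v x = R w (R v x - scaleC w (A (R v x)))" by (rule R1'[OF that(1), symmetric])
    also have "R v x - scaleC w (A (R v x)) = x - scaleC (w - v) (A (R v x))"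
      using R2'[OF that(2), of x] by (simp add: scaleC.diff_left algebra_simps)
    finally have "R v x = R w x - scaleC (w - v) (R w (A (R v x)))"
      by (simp add: blinfun.diff_right complex_opsD[OF Rc[OF that(1)]])
    then show ?thesis by (simp add: algebra_simps)
  qed
  have res_norm: "norm (R w - R v) \<le> cmod (w - v) * (norm (R w) * norm A * norm (R v))" if "w \<in> B" "v \<in> B" for w v
  proof -
    have "R w - R v = scale_op (w - v) (R w o\<^sub>L (A o\<^sub>L R v))"
      by (rule blinfun_eqI) (use res[OF that] in \<open>simp add: blinfun.diff_left\<close>)
    moreover have "norm (R w o\<^sub>L (A o\<^sub>L R v)) \<le> norm (R w) * (norm A * norm (R v))"
      by (intro order_trans[OF norm_blinfun_compose] mult_left_mono norm_blinfun_compose) auto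
    ultimately show ?thesis by (simp add: norm_scale_op mult_left_mono mult.assoc)
  qed
  have lim: "(R \<longlongrightarrow> R v) (at v)" if v: "v \<in> B" for v
  proof -
    define C where "C = norm A * norm (R v)"
    have C: "0 \<le> C" by (simp add: C_def)
    \<comment> \<open>Makes |w - v| C at most 1/2, so that the resolvent identity gives |R w| \<le>
      2 |R v| near v. This local bound is what continuity is drawn from.\<close>
    define d where "d = 1 / (2 * (C + 1))"
    have d: "d > 0" using C by (simp add: d_def)
    have ev: "\<forall>\<^sub>F w in at v. norm (R w - R v) \<le> cmod (w - v) * (2 * norm (R v) * C)"
    proof -
      have "\<forall>\<^sub>F w in at v. w \<in> B" using oB v by (simp add: eventually_at_topological) blast
      moreover have "\<forall>\<^sub>F w in at v. dist w v < d" using d by (auto simp: eventually_at)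
      ultimately show ?thesis
      proof eventually_elim
        case (elim w)
        have "cmod (w - v) * C \<le> d * C" using elim C by (intro mult_right_mono) (auto simp: dist_norm)
        also have "\<dots> \<le> 1 / 2" using C by (simp add: d_def field_simps)
        finally have half: "cmod (w - v) * C \<le> 1 / 2" .
        have le: "norm (R w - R v) \<le> norm (R w) * (cmod (w - v) * C)"
          using res_norm[OF elim(1) v] by (simp add: C_def mult_ac)
        also have "\<dots> \<le> norm (R w) * (1 / 2)" using half by (rule mult_left_mono) simp
        finally have "norm (R w) \<le> 2 * norm (R v)"
          using norm_triangle_ineq2[of "R w" "R v"] by linarith
        then have "norm (R w) * (cmod (w - v) * C) \<le> 2 * norm (R v) * (cmod (w - v) * C)"
          using C by (intro mult_right_mono) auto
        then show ?case using le by (simp add: mult_ac)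
      qed
    qed
    have "((\<lambda>w. cmod (w - v) * (2 * norm (R v) * C)) \<longlongrightarrow> cmod (v - v) * (2 * norm (R v) * C)) (at v)"
      by (intro tendsto_intros)
    then have "((\<lambda>w. R w - R v) \<longlongrightarrow> 0) (at v)"
      using ev by (intro Lim_null_comparison[OF ev]) simp
    then show ?thesis by (simp add: LIM_zero_iff)
  qed
  have contR: "continuous_on B R"
    using lim oB by (auto simp: continuous_on_eq_continuous_at isCont_def)
  have holo: "(\<lambda>w. cinner (R w x) y) holomorphic_on B" for x y
  proof (subst holomorphic_on_open[OF oB], intro ballI exI)
    fix v assume v: "v \<in> B"
    have "((\<lambda>w. cinner (R w (A (R v x))) y) \<longlongrightarrow> cinner (R v (A (R v x))) y) (at v)"
      by (intro cinner.tendsto blinfun.tendsto lim[OF v] tendsto_const)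
    moreover have "\<forall>\<^sub>F w in at v. w \<in> B \<and> w \<noteq> v"
      using oB v by (simp add: eventually_at_topological) blast
    then have "\<forall>\<^sub>F w in at v. cinner (R w (A (R v x))) y = (cinner (R w x) y - cinner (R v x) y) / (w - v)"
      by eventually_elim
        (use res[OF _ v, of _ x] in \<open>auto simp: cinner.diff_left[symmetric] cinner_scaleC_left\<close>)
    ultimately show "((\<lambda>w. cinner (R w x) y) has_field_derivative cinner (R v (A (R v x))) y) (at v)"
      unfolding has_field_derivative_iff by (rule Lim_transform_eventually)
  qed
  have "(deriv ^^ k) (\<lambda>w. cinner (R w x) y) 0 = fact k * cinner (op_power A k x) y" for k x y
  proof -
    \<comment> \<open>Near 0 the norm of w A is below 1, so R(w) is the Neumann series and the
      Taylor coefficients can be read off.\<close>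
    have "\<forall>\<^sub>F w in nhds 0. w \<in> B \<and> cmod w * (norm A + 1) < 1"
    proof (rule eventually_conj)
      show "\<forall>\<^sub>F w in nhds 0. w \<in> B" using oB zB by (rule eventually_nhds_in_open)
      have "((\<lambda>w. cmod w * (norm A + 1)) \<longlongrightarrow> cmod 0 * (norm A + 1)) (nhds 0)"
        by (intro tendsto_intros filterlim_ident)
      then show "\<forall>\<^sub>F w in nhds 0. cmod w * (norm A + 1) < 1"
        by (rule order_tendstoD(2)) simp
    qed
    then have "\<forall>\<^sub>F w in nhds 0. (\<lambda>n. fps_nth (Abs_fps (\<lambda>n. cinner (op_power A n x) y)) n * w ^ n)
        sums cinner (R w x) y"
    proof eventually_elim
      case (elim w)
      let ?D = "scale_op w A"
      have D: "?D \<in> complex_ops" by (rule scale_complex_ops[OF A])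
      have "norm ?D < 1"
        using elim norm_ge_zero[of w] unfolding norm_scale_op distrib_left by linarith
      then have "summable (op_power ?D)"
        by (intro summable_comparison_test'[OF summable_geometric[of "norm ?D"]])
          (use norm_op_power_le in auto)
      then obtain S where S: "op_power ?D sums S" by (auto simp: summable_def)
      have "(\<lambda>m. (id_blinfun - ?D) o\<^sub>L (\<Sum>j<m. op_power ?D j)) \<longlonglongrightarrow> ((id_blinfun - ?D) o\<^sub>L S)"
        by (intro bounded_bilinear.tendsto[OF bounded_bilinear_blinfun_compose] S[unfolded sums_def] tendsto_const)
      moreover have "(\<lambda>m. id_blinfun - op_power ?D m) \<longlonglongrightarrow> id_blinfun - 0"
        by (intro tendsto_intros summable_LIMSEQ_zero sums_summable[OF S])
      ultimately have "(id_blinfun - ?D) o\<^sub>L S = id_blinfun"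
        by (simp only: geometric_op_right diff_zero LIMSEQ_unique)
      from arg_cong[OF this, of "\<lambda>A. blinfun_apply A x"] have "S x - scaleC w (A (S x)) = x"
        by (simp add: blinfun.diff_left)
      then have "S x = R w x" using R1'[of w "S x"] elim by simp
      then have "(\<lambda>n. cinner (op_power ?D n x) y) sums cinner (R w x) y"
        using bounded_linear.sums[OF cinner.bounded_linear_left
            bounded_linear.sums[OF blinfun.bounded_linear_left[of x] S], of y] by simp
      then show ?case by (simp add: op_power_scale[OF A] cinner_scaleC_left mult.commute)
    qed
    from fps_nth_fps_expansion[OF has_fps_expansionI[OF this], of k]
    show ?thesis by (simp add: field_simps)
  qed
  note coeff = this
  define \<rho> where "\<rho> = 1 / t"
  have "\<rho> < 1 / s" using s by (simp add: \<rho>_def frac_less2)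
  then have \<rho>: "0 < \<rho>" "cball 0 \<rho> \<subseteq> B" using s by (auto simp: \<rho>_def B_def)
  have "compact (R ` cball 0 \<rho>)"
    by (intro compact_continuous_image continuous_on_subset[OF contR] \<rho>) auto
  then obtain K where K: "\<And>w. w \<in> cball 0 \<rho> \<Longrightarrow> norm (R w) \<le> K"
    using compact_imp_bounded[of "R ` cball 0 \<rho>"] unfolding bounded_iff by blast
  have K0: "0 \<le> K" using K[of 0] \<rho>(1) norm_ge_zero[of "R 0"] by (simp del: norm_ge_zero)
  have bnd: "cmod (cinner (op_power A k x) y) \<le> K * norm x * norm y * t ^ k" for k x y
  proof -
    have "norm ((deriv ^^ k) (\<lambda>w. cinner (R w x) y) 0) \<le> fact k * (K * norm x * norm y) / \<rho> ^ k"
    proof (rule Cauchy_inequality)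
      show "(\<lambda>w. cinner (R w x) y) holomorphic_on ball 0 \<rho>"
        by (rule holomorphic_on_subset[OF holo]) (use \<rho> in auto)
      show "continuous_on (cball 0 \<rho>) (\<lambda>w. cinner (R w x) y)"
        by (rule continuous_on_subset[OF holomorphic_on_imp_continuous_on[OF holo] \<rho>(2)])
      show "0 < \<rho>" by (rule \<rho>)
      fix w :: complex assume "norm (0 - w) = \<rho>"
      then have w: "norm (R w) \<le> K" by (intro K) simp
      have "cmod (cinner (R w x) y) \<le> norm (R w x) * norm y" by (rule cinner_Cauchy_Schwarz)
      also have "\<dots> \<le> (K * norm x) * norm y"
        by (intro mult_right_mono order_trans[OF norm_blinfun] w) auto
      finally show "cmod (cinner (R w x) y) \<le> K * norm x * norm y" .
    qed
    then have "fact k * cmod (cinner (op_power A k x) y) \<le> fact k * (K * norm x * norm y * t ^ k)"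
      by (simp add: coeff norm_mult \<rho>_def power_divide mult_ac)
    then show ?thesis by (simp add: mult_le_cancel_left_pos)
  qed
  have "norm (op_power A k) \<le> K * t ^ k" for k
  proof (rule norm_blinfun_bound)
    show "0 \<le> K * t ^ k" using K0 s by simp
    fix x
    \<comment> \<open>Testing against A^k x itself turns the bound on the form into one on the
      norm.\<close>
    let ?y = "op_power A k x"
    have "norm ?y * norm ?y \<le> (K * t ^ k * norm x) * norm ?y"
      using bnd[of k x ?y] by (simp add: cinner_self norm_power power2_eq_square mult_ac norm_mult)
    moreover have "0 \<le> K * t ^ k * norm x" using K0 s by simp
    ultimately show "norm ?y \<le> K * t ^ k * norm x"
      by (cases "norm ?y = 0") (auto dest: mult_right_le_imp_le)
  qed
  then show ?thesis by blast
qed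

text \<open>On the logarithmic scale N^2 and 1 / D differ by at most ln 2, which vanishes after
  division by 2 k. The bound r^k \<le> N k then gives the lower estimate, and the growth at each t >
  r the upper one.\<close>

lemma powr_root_limit:
  fixes D N :: "nat \<Rightarrow> real"
  assumes D: "\<And>k. 0 < D k" and r: "0 < r"
    and low: "\<And>k. 0 < k \<Longrightarrow> r ^ k \<le> N k"
    and up: "\<And>k. 0 < k \<Longrightarrow> (N k)\<^sup>2 \<le> 2 / D k"
    and dn: "\<And>k. 0 < k \<Longrightarrow> 1 / D k \<le> 2 * (N k)\<^sup>2"
    and growth: "\<And>t. r < t \<Longrightarrow> \<exists>K. \<forall>k. N k \<le> K * t ^ k"
  shows "(\<lambda>k. D k powr (- 1 / (2 * real k))) \<longlonglongrightarrow> r"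
proof -
  define y where "y k = - ln (D k) / (2 * real k)" for k
  have small: "(\<lambda>k. a + c / (2 * real k)) \<longlonglongrightarrow> a" for a c :: real
    using tendsto_add[OF tendsto_const lim_const_over_n[of "c / 2"], of a] by simp
  have "y \<longlonglongrightarrow> ln r"
  proof (rule order_tendstoI)
    fix a assume "a < ln r"
    have "\<forall>\<^sub>F k in sequentially. a < ln r + (- ln 2) / (2 * real k)"
      by (rule order_tendstoD(1)[OF small \<open>a < ln r\<close>])
    then show "\<forall>\<^sub>F k in sequentially. a < y k"
      using eventually_gt_at_top[of 0]
    proof eventually_elim
      case (elim k)
      have "(r ^ k)\<^sup>2 \<le> (N k)\<^sup>2" using low[OF elim(2)] r by (intro power_mono) auto
      also have "\<dots> \<le> 2 / D k" by (rule up[OF elim(2)])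
      finally have "ln ((r ^ k)\<^sup>2) \<le> ln (2 / D k)" using r D[of k] by (subst ln_le_cancel_iff) auto
      then have "2 * real k * ln r \<le> ln 2 - ln (D k)"
        using r D[of k] by (simp add: ln_realpow ln_div mult.assoc)
      then have "(2 * real k * ln r + - ln 2) / (2 * real k) \<le> y k"
        unfolding y_def by (intro divide_right_mono) auto
      then have "ln r + (- ln 2) / (2 * real k) \<le> y k"
        using elim(2) by (simp only: add_divide_distrib) simp
      then show ?case using elim(1) by linarith
    qed
  next
    fix b assume b: "ln r < b"
    \<comment> \<open>The geometric mean of r and exp b, so that r < t and ln t < b.\<close>
    define t where "t = exp ((ln r + b) / 2)"
    have "exp (ln r) < t" unfolding t_def using b by (subst exp_less_cancel_iff) simp
    then have t: "ln t < b" "r < t" "0 < t" using b r by (simp_all add: t_def)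
    obtain K where K: "\<And>k. N k \<le> K * t ^ k" using growth[OF t(2)] by blast
    \<comment> \<open>The maximum with 1 makes the constant positive, so that its logarithm can be
      taken.\<close>
    define c where "c = max K 1"
    have c: "1 \<le> c" "N k \<le> c * t ^ k" for k
      using order_trans[OF K[of k] mult_right_mono[of K c "t ^ k"]] t by (auto simp: c_def)
    have "\<forall>\<^sub>F k in sequentially. ln t + ln (2 * c\<^sup>2) / (2 * real k) < b"
      by (rule order_tendstoD(2)[OF small t(1)])
    then show "\<forall>\<^sub>F k in sequentially. y k < b"
      using eventually_gt_at_top[of 0]
    proof eventually_elim
      case (elim k)
      have "0 \<le> N k" using low[OF elim(2)] r by (meson order_trans zero_le_power less_imp_le)
      then have "(N k)\<^sup>2 \<le> (c * t ^ k)\<^sup>2" using c by (intro power_mono) auto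
      then have "1 / D k \<le> (2 * c\<^sup>2) * (t ^ k)\<^sup>2" using dn[OF elim(2)] by (simp add: power_mult_distrib)
      then have "ln (1 / D k) \<le> ln ((2 * c\<^sup>2) * (t ^ k)\<^sup>2)"
        using D[of k] t c(1) by (subst ln_le_cancel_iff) (auto intro!: mult_pos_pos)
      also have "\<dots> = ln (2 * c\<^sup>2) + 2 * real k * ln t"
        using t c(1) by (subst ln_mult) (auto simp: ln_realpow)
      finally have "y k \<le> (ln (2 * c\<^sup>2) + 2 * real k * ln t) / (2 * real k)"
        unfolding y_def using D[of k] by (intro divide_right_mono) (auto simp: ln_div)
      then have "y k \<le> ln t + ln (2 * c\<^sup>2) / (2 * real k)"
        using elim(2) by (simp only: add_divide_distrib) simp
      then show ?case using elim(1) by linarith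
    qed
  qed
  then have "(\<lambda>k. exp (y k)) \<longlonglongrightarrow> exp (ln r)" by (rule tendsto_exp)
  moreover have "D k powr (- 1 / (2 * real k)) = exp (y k)" for k
    using D[of k] by (simp add: powr_def y_def)
  ultimately show ?thesis using r by simp
qed

text \<open>Both limits compute the radius of convergence of the power series with coefficients
  sqrt(D k): the ratio test gives L and the root test gives r.\<close>

lemma ratio_limit_eq_root_limit:
  fixes D :: "nat \<Rightarrow> real"
  assumes D: "\<And>k. 0 < D k" and r: "0 < r"
    and root: "(\<lambda>k. D k powr (- 1 / (2 * real k))) \<longlonglongrightarrow> r"
    and ratio: "(\<lambda>k. sqrt (D k / D (Suc k))) \<longlonglongrightarrow> L"
  shows "L = r"
proof -
  have "conv_radius (\<lambda>k. sqrt (D k)) = ereal L"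
  proof (rule conv_radius_ratio_limit[OF refl])
    show "\<forall>\<^sub>F n in sequentially. sqrt (D n) \<noteq> 0" using D by (simp add: less_imp_neq[symmetric])
    show "(\<lambda>n. norm (sqrt (D n)) / norm (sqrt (D (Suc n)))) \<longlonglongrightarrow> L"
      using ratio D by (simp add: real_sqrt_divide less_imp_le)
  qed
  moreover have "conv_radius (\<lambda>k. sqrt (D k)) = ereal r"
  proof -
    have "(\<lambda>k. inverse (D k powr (- 1 / (2 * real k)))) \<longlonglongrightarrow> inverse r"
      using root r by (intro tendsto_inverse) auto
    then have "(\<lambda>k. ereal (root k (norm (sqrt (D k))))) \<longlonglongrightarrow> ereal (inverse r)"
    proof (rule Lim_transform_eventually[OF tendsto_ereal])
      show "\<forall>\<^sub>F k in sequentially. ereal (inverse (D k powr (- 1 / (2 * real k)))) = ereal (root k (norm (sqrt (D k))))"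
        using eventually_gt_at_top[of 0]
      proof eventually_elim
        case (elim k)
        have "root k (sqrt (D k)) = D k powr (1 / (2 * real k))"
          using elim D[of k] by (simp add: root_powr_inverse powr_half_sqrt[symmetric] powr_powr)
        then show ?case using D[of k] by (simp add: powr_minus_divide inverse_eq_divide powr_minus[symmetric])
      qed
    qed
    then have "limsup (\<lambda>k. ereal (root k (norm (sqrt (D k))))) = ereal (inverse r)"
      by (intro lim_imp_Limsup) auto
    then show ?thesis using r by (simp add: conv_radius_def)
  qed
  ultimately show ?thesis by simp
qed

section \<open>Composition operators\<close>

lemma zero_nc_ball: "(\<lambda>_. 0) \<in> nc_ball"
  by (auto simp: nc_ball_def zero_complex_ops)

lemma expansion_at_zero:
  fixes f :: "('n::finite, 'a::complex_hilbert) op_tuple \<Rightarrow> 'a \<Rightarrow>\<^sub>L 'a"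
  assumes "has_free_expansion f a"
  shows "f (\<lambda>_. 0) = scale_op (a []) id_blinfun"
proof -
  have "scale_op c (word_op (\<lambda>_. 0 :: 'a \<Rightarrow>\<^sub>L 'a) \<alpha>) = (if \<alpha> = [] then scale_op c id_blinfun else 0)"
    for \<alpha> :: "'n list" and c
    by (cases \<alpha>) (auto intro!: blinfun_eqI simp: scaleC.zero_right)
  then have "(\<Sum>\<alpha> | length \<alpha> = k. scale_op (a \<alpha>) (word_op (\<lambda>_. 0 :: 'a \<Rightarrow>\<^sub>L 'a) \<alpha>))
      = (if k = 0 then scale_op (a []) id_blinfun else 0)" for k
    by (cases k) (auto intro!: sum.neutral)
  moreover have "(\<lambda>k. \<Sum>\<alpha> | length \<alpha> = k. scale_op (a \<alpha>) (word_op (\<lambda>_. 0) \<alpha>)) sums f (\<lambda>_. 0)"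
    using assms zero_nc_ball unfolding has_free_expansion_def by blast
  ultimately have "(\<lambda>k. if k = 0 then scale_op (a []) id_blinfun else 0) sums f (\<lambda>_. 0)" by simp
  from sums_unique2[OF this sums_single] show ?thesis .
qed

context orthonormal_words
begin

text \<open>Nonempty words of shifts have range orthogonal to \<open>e []\<close>, so only the
  constant term survives. In adjoint form, \<open>e []\<close> is an eigenvector of f(sS)^* with
  eigenvalue the conjugate of \<open>a []\<close>, the value of f at 0. This is how \<psi>(0) enters
  the estimates.\<close>

lemma expansion_shift_vacuum:
  assumes a: "has_free_expansion f a" and s: "0 \<le> s" "s < 1"
  shows "cinner (f (shift s) x) (e []) = a [] * cinner x (e [])"
proof -
  have "(\<lambda>k. \<Sum>\<alpha> | length \<alpha> = k. cinner (scaleC (a \<alpha>) (word_op (shift s) \<alpha> x)) (e [])) sums cinner (f (shift s) x) (e [])"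
    using bounded_linear.sums[OF cinner.bounded_linear_left expansion_apply_sums[OF a shift_nc_ball[OF s]]]
    by (simp add: cinner.sum_left)
  moreover have "cinner (scaleC (a \<alpha>) (word_op (shift s) \<alpha> x)) (e []) = (if \<alpha> = [] then a [] * cinner x (e []) else 0)" for \<alpha>
    using shift_orthogonal[OF s(1), of _ "e []"] by (cases \<alpha>) (auto simp: cinner_scaleC_left orth)
  moreover have "(\<Sum>\<alpha> :: 'n list | length \<alpha> = k. if \<alpha> = [] then a [] * cinner x (e []) else 0)
      = (if k = 0 then a [] * cinner x (e []) else 0)" for k
    by (cases k) (auto intro!: sum.neutral)
  ultimately have "(\<lambda>k. if k = 0 then a [] * cinner x (e []) else 0) sums cinner (f (shift s) x) (e [])"
    by simp
  from sums_unique2[OF this sums_single] show ?thesis .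
qed

lemma scalar_point_eqI:
  fixes Y :: "('n, 'a) op_tuple"
  assumes "\<And>i. Y i = scale_op (z $ i) id_blinfun"
  shows "scalar_point Y = z"
  unfolding scalar_point_def
proof (rule the_equality)
  fix w assume w: "\<forall>i. Y i = scale_op (w $ i) id_blinfun"
  have "w $ i = z $ i" for i
  proof -
    have "scaleC (w $ i) (e []) = scaleC (z $ i) (e [])"
      using w assms[of i] by (metis scale_op_apply blinfun_apply_id_blinfun)
    then have "cinner (scaleC (w $ i) (e [])) (e []) = cinner (scaleC (z $ i) (e [])) (e [])" by simp
    then show ?thesis by (simp add: cinner_scaleC_left orth)
  qed
  then show "w = z" by (simp add: vec_eq_iff)
qed (use assms in blast)

lemma self_map_iff:
  "free_holomorphic_self_map (\<phi> :: ('n, 'a) op_tuple \<Rightarrow> ('n, 'a) op_tuple)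
    \<longleftrightarrow> (\<forall>i. intertwining (\<lambda>X. \<phi> X i)) \<and> \<phi> \<in> nc_ball \<rightarrow> nc_ball"
  by (simp add: free_holomorphic_self_map_def free_holomorphic_iff_intertwining)

lemma self_map_power:
  assumes "free_holomorphic_self_map (\<phi> :: ('n, 'a) op_tuple \<Rightarrow> ('n, 'a) op_tuple)"
  shows "free_holomorphic_self_map (\<phi> ^^ k)"
proof (induction k)
  case 0
  show ?case by (simp add: self_map_iff intertwining_def)
next
  case (Suc k)
  have \<phi>: "intertwining (\<lambda>X. \<phi> X i)" "\<phi> \<in> nc_ball \<rightarrow> nc_ball" for i
    using assms by (auto simp: self_map_iff)
  have k: "intertwining (\<lambda>X. (\<phi> ^^ k) X i)" "\<phi> ^^ k \<in> nc_ball \<rightarrow> nc_ball" for i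
    using Suc by (auto simp: self_map_iff)
  show ?case unfolding self_map_iff
  proof
    show "\<forall>i. intertwining (\<lambda>X. (\<phi> ^^ Suc k) X i)"
      using intertwining_compose[OF \<phi>(1) k] by simp
    show "\<phi> ^^ Suc k \<in> nc_ball \<rightarrow> nc_ball" using \<phi>(2) k(2) by auto
  qed
qed

context
  fixes \<psi> :: "('n, 'a) op_tuple \<Rightarrow> ('n, 'a) op_tuple"
  assumes \<psi>: "free_holomorphic_self_map \<psi>"
begin

abbreviation (input) point :: "complex ^ 'n" where
  "point \<equiv> scalar_point (\<psi> (\<lambda>_. 0))"

lemma self_map_zero: "\<psi> (\<lambda>_. 0) i = scale_op (point $ i) id_blinfun"
  and self_map_vacuum:
    "0 \<le> s \<Longrightarrow> s < 1 \<Longrightarrow> cinner (\<psi> (shift s) i x) (e []) = point $ i * cinner x (e [])"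
proof -
  obtain a where a: "\<And>i. has_free_expansion (\<lambda>X. \<psi> X i) (a i)"
    using \<psi> unfolding free_holomorphic_self_map_def free_holomorphic_def by metis
  have z: "\<psi> (\<lambda>_. 0) i = scale_op ((\<chi> i. a i []) $ i) id_blinfun" for i
    using expansion_at_zero[OF a[of i]] by simp
  have p: "point = (\<chi> i. a i [])" by (rule scalar_point_eqI[OF z])
  show "\<psi> (\<lambda>_. 0) i = scale_op (point $ i) id_blinfun" unfolding p by (rule z)
  show "cinner (\<psi> (shift s) i x) (e []) = point $ i * cinner x (e [])" if "0 \<le> s" "s < 1"
    using expansion_shift_vacuum[OF a[of i] that] unfolding p by simp
qed

lemma self_map_ball: "X \<in> nc_ball \<Longrightarrow> \<psi> X \<in> nc_ball"
  using \<psi> by (auto simp: free_holomorphic_self_map_def)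

lemma cadjoint_self_map_vacuum:
  assumes "0 \<le> s" "s < 1"
  shows "cadjoint (\<psi> (shift s) i) (e []) = scaleC (cnj (point $ i)) (e [])"
  using self_map_vacuum[OF assms] nc_ball_complex_ops[OF self_map_ball[OF shift_nc_ball[OF assms]]]
  by (intro cinner_eqI) (simp add: cinner_cadjoint[symmetric] cinner_scaleC_right)

lemma norm_point_sq: "(\<Sum>i\<in>UNIV. (cmod (point $ i))\<^sup>2) = (norm point)\<^sup>2"
  by (simp add: norm_vec_def L2_set_def sum_nonneg)

text \<open>The column of adjoints of \<psi>(sS) maps the unit vector \<open>e []\<close> to a
  vector of norm |\<psi>(0)|, and this column has norm below 1. The value s = 1/2 is
  arbitrary.\<close>

lemma norm_point_less_1: "norm point < 1"
proof -
  let ?M = "\<psi> (shift (1/2))"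
  have M: "?M \<in> nc_ball" by (intro self_map_ball shift_nc_ball) auto
  obtain r where r: "0 \<le> r" "r < 1" "row_bound ?M r" using nc_ball_row_bound[OF M] .
  have "(norm point)\<^sup>2 = (\<Sum>i\<in>UNIV. (norm (cadjoint (?M i) (e [])))\<^sup>2)"
    by (simp add: cadjoint_self_map_vacuum norm_scaleC norm_point_sq)
  also have "\<dots> \<le> r\<^sup>2 * (norm (e []))\<^sup>2"
    using r(3) row_bound_iff_column[of ?M r] nc_ball_complex_ops[OF M] by blast
  also have "\<dots> < 1" using r by (simp add: power_less_one_iff)
  finally show ?thesis by (simp add: power_less_one_iff)
qed

text \<open>Equal to sqrt((1 + |\<lambda>|) / (1 - |\<lambda>|)) with \<lambda> = \<psi>(0), the
  constant familiar from Littlewood's subordination principle.\<close>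

abbreviation (input) comp_bound :: real where
  "comp_bound \<equiv> sqrt (1 - (norm point)\<^sup>2) / (1 - norm point)"

lemma composition_expansion:
  "\<exists>b. has_free_expansion (composition_operator \<psi> (fn h)) b \<and> ell2 b \<and> ell2_norm b \<le> comp_bound * ell2_norm (coords h)"
proof -
  let ?F = "composition_operator \<psi> (fn h)"
  have FX: "?F X = fn h (\<psi> X)" if "X \<in> nc_ball" for X
    using that by (simp add: composition_operator_def compose_def)
  have "intertwining (\<lambda>X. fn h (\<psi> X))"
    using intertwining_compose[of "fn h" \<psi>] \<psi> fn_expansion[of h] free_holomorphic_intertwining[of "fn h"]
    by (auto simp: self_map_iff free_holomorphic_def)
  then have "intertwining ?F" unfolding intertwining_def using FX by simp
  then obtain b where b: "has_free_expansion ?F b" using intertwining_free_expansion by blast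
  have le: "L2_set (\<lambda>\<alpha>. cmod (b \<alpha>)) S \<le> comp_bound * ell2_norm (coords h)" if S: "finite S" for S
  proof -
    have "L2_set (\<lambda>\<alpha>. cmod (b \<alpha>) * s ^ length \<alpha>) S \<le> comp_bound * ell2_norm (coords h)" if s: "0 < s" "s < 1" for s
    proof -
      have ball: "shift s \<in> nc_ball" using s by (intro shift_nc_ball) auto
      have "L2_set (\<lambda>\<alpha>. cmod (b \<alpha>) * s ^ length \<alpha>) S = L2_set (\<lambda>\<alpha>. cmod (coords (?F (shift s) (e [])) \<alpha>)) S"
        using s by (simp add: expansion_coeff[OF b s] norm_mult norm_power)
      also have "\<dots> \<le> norm (?F (shift s) (e []))" by (rule L2_set_coords_le[OF S])
      also have "\<dots> = norm (fn h (\<psi> (shift s)) (e []))" by (simp add: FX[OF ball])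
      also have "\<dots> \<le> comp_bound * ell2_norm (coords h)"
        using s norm_point_less_1
        by (intro subordination_bound[OF self_map_ball[OF ball] fn_expansion ell2_coords norm_e
              cadjoint_self_map_vacuum norm_point_sq]) auto
      finally show ?thesis .
    qed
    \<comment> \<open>For a finite set S the left side is continuous in s up to 1, and the bound
      does not depend on s.\<close>
    then have "\<forall>\<^sub>F s in at_left 1. L2_set (\<lambda>\<alpha>. cmod (b \<alpha>) * s ^ length \<alpha>) S \<le> comp_bound * ell2_norm (coords h)"
      using eventually_at_left_real[of 0 1] by (auto elim!: eventually_mono)
    moreover have "((\<lambda>s. L2_set (\<lambda>\<alpha>. cmod (b \<alpha>) * s ^ length \<alpha>) S)
        \<longlongrightarrow> L2_set (\<lambda>\<alpha>. cmod (b \<alpha>) * 1 ^ length \<alpha>) S) (at_left 1)"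
      unfolding L2_set_def by (intro tendsto_intros)
    ultimately show ?thesis
      using tendsto_upperbound[of _ _ "at_left (1::real)"] by (simp add: trivial_limit_at_left_real)
  qed
  show ?thesis using b ell2I[OF le] ell2_norm_leI[OF le] by blast
qed

lemma composition_extensional: "composition_operator \<psi> f \<in> extensional nc_ball"
  by (simp add: composition_operator_def compose_def)

lemma composition_H2: "composition_operator \<psi> (fn h) \<in> H2_ball"
  and composition_norm: "H2_norm (composition_operator \<psi> (fn h)) \<le> comp_bound * H2_norm (fn h)"
proof -
  obtain b where b: "has_free_expansion (composition_operator \<psi> (fn h)) b" "ell2 b"
      "ell2_norm b \<le> comp_bound * ell2_norm (coords h)"
    using composition_expansion by blast
  have fc: "free_coeffs (composition_operator \<psi> (fn h)) = b" by (rule free_coeffs_eq[OF b(1)])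
  show "composition_operator \<psi> (fn h) \<in> H2_ball"
    unfolding H2_ball_def using b composition_extensional fc by (auto simp: free_holomorphic_def)
  show "H2_norm (composition_operator \<psi> (fn h)) \<le> comp_bound * H2_norm (fn h)"
    using b(3) by (simp add: H2_norm_def fc ell2_norm_def)
qed

lemma composition_bounded: "H2_bounded_operator (composition_operator \<psi>)"
  unfolding H2_bounded_operator_def
proof (intro conjI ballI allI)
  show "composition_operator \<psi> \<in> H2_ball \<rightarrow> H2_ball"
    using composition_H2 fn_hvec by (metis Pi_I)
  show "composition_operator \<psi> (H2_add f g) = H2_add (composition_operator \<psi> f) (composition_operator \<psi> g)" for f g
    by (auto simp: composition_operator_def compose_def H2_add_def self_map_ball fun_eq_iff)
  show "composition_operator \<psi> (H2_scale c f) = H2_scale c (composition_operator \<psi> f)" for c f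
    by (auto simp: composition_operator_def compose_def H2_scale_def self_map_ball fun_eq_iff)
  show "\<exists>K. \<forall>f\<in>H2_ball. H2_norm (composition_operator \<psi> f) \<le> K * H2_norm f"
    using composition_norm fn_hvec by metis
qed

lemma norm_lift_composition_le: "norm (H2_lift (composition_operator \<psi>)) \<le> comp_bound"
proof (rule norm_blinfun_bound)
  show c0: "0 \<le> comp_bound" using norm_point_less_1 by (simp add: power_le_one)
  fix h
  have "norm (H2_lift (composition_operator \<psi>) h) = H2_norm (composition_operator \<psi> (fn h))"
    by (simp add: H2_lift_apply[OF composition_bounded] norm_hvec[OF composition_H2])
  also have "\<dots> \<le> comp_bound * H2_norm (fn h)" by (rule composition_norm)
  also have "\<dots> \<le> comp_bound * norm h" by (rule mult_left_mono[OF H2_norm_fn_le c0])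
  finally show "norm (H2_lift (composition_operator \<psi>) h) \<le> comp_bound * norm h" .
qed

text \<open>Tested on truncations of the reproducing kernel at the point \<open>\<psi>(0)\<close>.\<close>

lemma norm_lift_composition_ge: "1 / (1 - (norm point)\<^sup>2) \<le> (norm (H2_lift (composition_operator \<psi>)))\<^sup>2"
proof -
  let ?A = "H2_lift (composition_operator \<psi>)" and ?L = "norm point"
  define w where "w \<alpha> = prod_list (map (($) point) \<alpha>)" for \<alpha>
  have level: "(\<Sum>\<alpha> | length \<alpha> = k. (cmod (w \<alpha>))\<^sup>2) = (?L\<^sup>2) ^ k" for k
  proof (induction k)
    case (Suc k)
    have "(\<Sum>\<alpha> | length \<alpha> = Suc k. (cmod (w \<alpha>))\<^sup>2)
        = (\<Sum>i\<in>UNIV. (cmod (point $ i))\<^sup>2 * (\<Sum>\<alpha> | length \<alpha> = k. (cmod (w \<alpha>))\<^sup>2))"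
      by (simp add: sum_words_Suc w_def norm_mult power_mult_distrib sum_distrib_left)
    then show ?case by (simp add: Suc sum_distrib_right[symmetric] norm_point_sq)
  qed (simp add: w_def)
  have word: "word_op (\<psi> (\<lambda>_. 0)) \<alpha> = scale_op (w \<alpha>) id_blinfun" for \<alpha>
  proof (induction \<alpha>)
    case (Cons i \<alpha>)
    then show ?case
      by (auto intro!: blinfun_eqI simp: self_map_zero[of i] w_def scaleC_scaleC)
  qed (auto intro!: blinfun_eqI simp: w_def scaleC_one)
  \<comment> \<open>S m is both the squared norm of the truncated kernel and its value at \<psi>(0),
    which is the value of the composed function at 0 and so one coordinate of its vector. Hence S m
    is at most the norm of the lift times sqrt(S m).\<close>
  define S where "S m = (\<Sum>k\<le>m. (?L\<^sup>2) ^ k)" for m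
  have "S m \<le> (norm ?A)\<^sup>2" for m
  proof -
    define h where "h = (\<Sum>\<alpha> | length \<alpha> \<le> m. scaleC (cnj (w \<alpha>)) (e \<alpha>))"
    have S1: "1 \<le> S m"
    proof -
      have "(\<Sum>k\<in>{0}. (?L\<^sup>2) ^ k) \<le> S m" unfolding S_def by (rule sum_mono2) auto
      then show ?thesis by simp
    qed
    have nh: "norm h = sqrt (S m)"
      using norm_sum_e[of "{\<alpha>. length \<alpha> \<le> m}" id "\<lambda>\<alpha>. cnj (w \<alpha>)"]
      by (simp add: h_def L2_set_def sum_words_le level S_def)
    have ch: "coords h \<alpha> = (if length \<alpha> \<le> m then cnj (w \<alpha>) else 0)" for \<alpha>
    proof -
      have "coords h \<alpha> = (\<Sum>\<beta> | length \<beta> \<le> m. if \<beta> = \<alpha> then cnj (w \<beta>) else 0)"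
        unfolding h_def cinner.sum_left cinner_scaleC_left orth by (intro sum.cong) auto
      then show ?thesis by simp
    qed
    have "(\<lambda>k. \<Sum>\<alpha> | length \<alpha> = k. scaleC (coords h \<alpha>) (word_op (\<psi> (\<lambda>_. 0)) \<alpha> (e []))) sums fn h (\<psi> (\<lambda>_. 0)) (e [])"
      by (intro expansion_apply_sums[OF fn_expansion] self_map_ball zero_nc_ball)
    moreover have "(\<Sum>\<alpha> | length \<alpha> = k. scaleC (coords h \<alpha>) (word_op (\<psi> (\<lambda>_. 0)) \<alpha> (e [])))
        = (if k \<in> {..m} then scaleC (of_real ((?L\<^sup>2) ^ k)) (e []) else 0)" for k
    proof -
      have "cnj (w \<alpha>) * w \<alpha> = of_real ((cmod (w \<alpha>))\<^sup>2)" for \<alpha>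
        by (simp only: complex_norm_square mult.commute)
      then have "(\<Sum>\<alpha> | length \<alpha> = k. scaleC (coords h \<alpha>) (word_op (\<psi> (\<lambda>_. 0)) \<alpha> (e [])))
        = (\<Sum>\<alpha> | length \<alpha> = k. scaleC (of_real (if k \<le> m then (cmod (w \<alpha>))\<^sup>2 else 0)) (e []))"
        by (intro sum.cong) (auto simp: ch word scaleC_scaleC scaleC.zero_left simp del: of_real_power)
      also have "\<dots> = scaleC (of_real (if k \<le> m then (?L\<^sup>2) ^ k else 0)) (e [])"
        by (simp add: level scaleC.sum_left[symmetric] del: of_real_power of_real_sum flip: of_real_sum)
      finally show ?thesis by (simp add: scaleC.zero_left)
    qed
    ultimately have "(\<lambda>k. if k \<in> {..m} then scaleC (of_real ((?L\<^sup>2) ^ k)) (e []) else 0) sums fn h (\<psi> (\<lambda>_. 0)) (e [])"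
      by simp
    from sums_unique2[OF this sums_If_finite_set[OF finite_atMost]]
    have "fn h (\<psi> (\<lambda>_. 0)) (e []) = scaleC (of_real (S m)) (e [])"
      by (simp only: S_def scaleC.sum_left of_real_sum)
    moreover have "fn h (\<psi> (\<lambda>_. 0)) = fn (?A h) (\<lambda>_. 0)"
      by (simp add: zero_nc_ball fn_H2_lift[OF composition_bounded] composition_operator_def compose_def)
    moreover have "fn (?A h) (\<lambda>_. 0) = scale_op (coords (?A h) []) id_blinfun"
      by (rule expansion_at_zero[OF fn_expansion])
    ultimately have "scaleC (coords (?A h) []) (e []) = scaleC (of_real (S m)) (e [])" by simp
    then have "cinner (scaleC (coords (?A h) []) (e [])) (e []) = cinner (scaleC (of_real (S m)) (e [])) (e [])"
      by (simp only:)
    then have "of_real (S m) = cinner (?A h) (e [])" by (simp add: cinner_scaleC_left orth)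
    then have "S m \<le> norm (?A h) * norm (e [])" by (rule real_cinner_le)
    also have "\<dots> \<le> norm ?A * sqrt (S m)" using norm_blinfun[of ?A h] by (simp add: nh)
    finally have "sqrt (S m) * sqrt (S m) \<le> norm ?A * sqrt (S m)" using S1 by simp
    then have "sqrt (S m) \<le> norm ?A" by (rule mult_right_le_imp_le) (use S1 in simp)
    then show ?thesis by (rule sqrt_le_D)
  qed
  moreover have "S \<longlonglongrightarrow> 1 / (1 - ?L\<^sup>2)"
    using geometric_sums[of "?L\<^sup>2"] norm_point_less_1
    unfolding S_def sums_def_le by (simp add: power_less_one_iff)
  ultimately show ?thesis by (intro LIMSEQ_le_const2) auto
qed

end

section \<open>Powers and spectrum of a composition operator\<close>

lemma fn_op_power_composition:
  assumes \<phi>: "free_holomorphic_self_map (\<phi> :: ('n, 'a) op_tuple \<Rightarrow> ('n, 'a) op_tuple)"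
  shows "fn (op_power (H2_lift (composition_operator \<phi>)) k h) = composition_operator (\<phi> ^^ k) (fn h)"
proof (induction k)
  case 0
  show ?case by (simp add: composition_operator_def compose_def extensional_restrict[OF fn_extensional])
next
  case (Suc k)
  have "fn (op_power (H2_lift (composition_operator \<phi>)) (Suc k) h)
      = composition_operator \<phi> (composition_operator (\<phi> ^^ k) (fn h))"
    by (simp add: fn_H2_lift[OF composition_bounded[OF \<phi>]] Suc)
  also have "\<dots> = composition_operator (\<phi> ^^ Suc k) (fn h)"
    by (auto simp: composition_operator_def compose_def self_map_ball[OF \<phi>] funpow_swap1 fun_eq_iff)
  finally show ?case .
qed

text \<open>The case k = 0 is different: the left side would be the identity of H, the right side
  the projection \<open>proj\<close>.\<close>

lemma op_power_composition:
  assumes \<phi>: "free_holomorphic_self_map (\<phi> :: ('n, 'a) op_tuple \<Rightarrow> ('n, 'a) op_tuple)" and k: "0 < k"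
  shows "op_power (H2_lift (composition_operator \<phi>)) k = H2_lift (composition_operator (\<phi> ^^ k))"
proof (rule blinfun_eqI)
  fix h
  let ?A = "H2_lift (composition_operator \<phi>)"
  obtain j where j: "k = Suc j" using k gr0_implies_Suc by blast
  have "H2_lift (composition_operator (\<phi> ^^ k)) h = hvec (fn (op_power ?A k h))"
    by (simp only: H2_lift_apply[OF composition_bounded[OF self_map_power[OF \<phi>]]] fn_op_power_composition[OF \<phi>])
  also have "\<dots> = op_power ?A k h"
    by (simp add: j proj_H2_lift[OF composition_bounded[OF \<phi>]])
  finally show "op_power ?A k h = H2_lift (composition_operator (\<phi> ^^ k)) h" ..
qed

text \<open>The constant function 1, which is \<open>fn (e [])\<close> on the ball, is fixed. The
  supremum in the spectral radius is therefore not over the empty set and is at least 1, so that 0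
  can be left aside.\<close>

lemma one_in_spectrum_composition:
  assumes \<phi>: "free_holomorphic_self_map (\<phi> :: ('n, 'a) op_tuple \<Rightarrow> ('n, 'a) op_tuple)"
  shows "1 \<in> H2_spectrum (composition_operator \<phi>)"
proof -
  let ?A = "H2_lift (composition_operator \<phi>)"
  have id: "fn (e []) X = id_blinfun" if "X \<in> nc_ball" for X
  proof -
    have *: "scale_op (coords (e []) \<alpha>) (word_op X \<alpha>) = (if \<alpha> = [] then id_blinfun else 0)" for \<alpha>
      by (auto intro!: blinfun_eqI simp: orth scaleC_one scaleC.zero_left)
    have "(\<Sum>\<alpha> | length \<alpha> = k. scale_op (coords (e []) \<alpha>) (word_op X \<alpha>)) = (if k = 0 then id_blinfun else 0)" for k
      unfolding * by (cases k) (auto intro!: sum.neutral)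
    then have "(\<lambda>k. if k = 0 then id_blinfun else 0) sums fn (e []) X"
      using fn_sums[OF that, of "e []"] by simp
    from sums_unique2[OF this sums_single] show ?thesis .
  qed
  have "composition_operator \<phi> (fn (e [])) = fn (e [])"
    by (rule extensionalityI[OF composition_extensional[OF \<phi>] fn_extensional])
      (simp add: composition_operator_def compose_def id self_map_ball[OF \<phi>])
  moreover have "proj (e []) = e []"
    unfolding proj_def using bessel_bound_e[of id] by (intro synth_e) simp
  ultimately have fixed: "?A (e []) = e []"
    by (simp add: H2_lift_apply[OF composition_bounded[OF \<phi>]])
  have "\<not> op_invertible (scale_op 1 id_blinfun - ?A)"
  proof
    assume "op_invertible (scale_op 1 id_blinfun - ?A)"
    then obtain S where "S o\<^sub>L (scale_op 1 id_blinfun - ?A) = id_blinfun"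
      unfolding op_invertible_def by blast
    from arg_cong[OF this, of "\<lambda>B. blinfun_apply B (e [])"]
    have "e [] = 0" by (simp add: blinfun.diff_left fixed scaleC_one blinfun.zero_right)
    then show False using norm_e[of "[]"] by simp
  qed
  then show ?thesis
    using H2_invertible_iff[OF composition_bounded[OF \<phi>], of 1] by (simp add: H2_spectrum_def)
qed

section \<open>Spectral radius and norms of powers\<close>

context
  fixes T :: "('n, 'a) H2_op"
  assumes T: "H2_bounded_operator T" and one: "1 \<in> H2_spectrum T"
begin

lemma spectrum_power_le:
  assumes c: "c \<in> H2_spectrum T" and k: "0 < k"
  shows "cmod c \<le> root k (norm (op_power (H2_lift T) k))"
proof (cases "c = 0")
  case False
  then have "\<not> op_invertible (scale_op c id_blinfun - H2_lift T)"
    using c H2_invertible_iff[OF T] by (simp add: H2_spectrum_def)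
  then have "cmod c ^ k \<le> norm (op_power (H2_lift T) k)"
    using op_invertible_of_power_small[OF H2_lift_complex_ops[OF T] False] not_le by blast
  then have "root k (cmod c ^ k) \<le> root k (norm (op_power (H2_lift T) k))"
    using k by simp
  then show ?thesis using k by (simp add: real_root_power_cancel)
qed (use k in simp)

lemma bdd_above_spectrum: "bdd_above (cmod ` H2_spectrum T)"
  using spectrum_power_le[of _ 1] by (auto intro!: bdd_aboveI2)

lemma spectral_radius_ge_1: "1 \<le> H2_spectral_radius T"
  unfolding H2_spectral_radius_def using cSUP_upper[OF one bdd_above_spectrum] by simp

lemma spectral_radius_power_le:
  assumes k: "0 < k"
  shows "H2_spectral_radius T ^ k \<le> norm (op_power (H2_lift T) k)"
proof -
  have "H2_spectral_radius T \<le> root k (norm (op_power (H2_lift T) k))"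
    unfolding H2_spectral_radius_def using one spectrum_power_le[OF _ k] by (intro cSUP_least) auto
  then have "H2_spectral_radius T ^ k \<le> root k (norm (op_power (H2_lift T) k)) ^ k"
    using spectral_radius_ge_1 by (intro power_mono) auto
  then show ?thesis using k by (simp add: real_root_pow_pos2)
qed

lemma spectral_radius_growth:
  assumes t: "H2_spectral_radius T < t"
  shows "\<exists>K. \<forall>k. norm (op_power (H2_lift T) k) \<le> K * t ^ k"
proof (rule op_power_growth[OF H2_lift_complex_ops[OF T] _ t])
  show "0 < H2_spectral_radius T" using spectral_radius_ge_1 by simp
  fix c assume c: "H2_spectral_radius T < cmod c"
  then have "c \<notin> H2_spectrum T"
    using cSUP_upper[OF _ bdd_above_spectrum, of c] unfolding H2_spectral_radius_def by fastforce
  moreover have "c \<noteq> 0" using c spectral_radius_ge_1 by auto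
  ultimately show "op_invertible (scale_op c id_blinfun - H2_lift T)"
    using H2_invertible_iff[OF T] by (simp add: H2_spectrum_def)
qed

end

end

theorem theorem2p9:
  fixes \<phi> :: "('n::finite, 'a::complex_hilbert) op_tuple \<Rightarrow> ('n, 'a) op_tuple"
  assumes separable: "\<exists>D :: 'a set. countable D \<and> closure D = UNIV"
    and infinite_dimensional: "\<not> (\<exists>B :: 'a set. finite B \<and> module.span scaleC B = UNIV)"
    and self_map: "free_holomorphic_self_map \<phi>"
  shows "(\<lambda>k. (1 - norm (scalar_point ((\<phi> ^^ k) (\<lambda>_. 0)))) powr (- 1 / (2 * real k)))
           \<longlonglongrightarrow> H2_spectral_radius (composition_operator \<phi>) \<and>
         (convergent (\<lambda>k. sqrt ((1 - norm (scalar_point ((\<phi> ^^ k) (\<lambda>_. 0)))) /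
                                 (1 - norm (scalar_point ((\<phi> ^^ Suc k) (\<lambda>_. 0)))))) \<longrightarrow>
          (\<lambda>k. sqrt ((1 - norm (scalar_point ((\<phi> ^^ k) (\<lambda>_. 0)))) /
                      (1 - norm (scalar_point ((\<phi> ^^ Suc k) (\<lambda>_. 0))))))
           \<longlonglongrightarrow> H2_spectral_radius (composition_operator \<phi>))"
proof -
  obtain e :: "'n list \<Rightarrow> 'a" where "orthonormal_words e"
    using exists_orthonormal_words[OF infinite_dimensional] by blast
  then interpret orthonormal_words e .
  define p where "p k = norm (scalar_point ((\<phi> ^^ k) (\<lambda>_. 0)))" for k
  define D where "D k = 1 - p k" for k
  define r where "r = H2_spectral_radius (composition_operator \<phi>)"
  define N where "N k = norm (op_power (H2_lift (composition_operator \<phi>)) k)" for k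
  note T = composition_bounded[OF self_map] one_in_spectrum_composition[OF self_map]
  have p: "0 \<le> p k" "p k < 1" for k
    unfolding p_def using norm_point_less_1[OF self_map_power[OF self_map]] by auto
  then have D: "0 < D k" for k by (simp add: D_def)
  have r: "0 < r" using spectral_radius_ge_1[OF T] by (simp add: r_def)
  have N: "N k = norm (H2_lift (composition_operator (\<phi> ^^ k)))" if "0 < k" for k
    using op_power_composition[OF self_map that] by (simp add: N_def)
  \<comment> \<open>The factor 1 + p k lies between 1 and 2 and is the source of both constants 2
    below.\<close>
  have fac: "1 - (p k)\<^sup>2 = D k * (1 + p k)" for k
    by (simp add: D_def power2_eq_square algebra_simps)
  have root: "(\<lambda>k. D k powr (- 1 / (2 * real k))) \<longlonglongrightarrow> r"
  proof (rule powr_root_limit[OF D r])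
    fix k :: nat assume k: "0 < k"
    show "r ^ k \<le> N k" unfolding r_def N_def by (rule spectral_radius_power_le[OF T k])
    have "N k \<le> sqrt (1 - (p k)\<^sup>2) / D k"
      unfolding N[OF k] p_def D_def by (rule norm_lift_composition_le[OF self_map_power[OF self_map]])
    moreover have "0 \<le> N k" by (simp add: N_def)
    ultimately have "(N k)\<^sup>2 \<le> (sqrt (1 - (p k)\<^sup>2) / D k)\<^sup>2" by (rule power_mono)
    also have "\<dots> = (1 + p k) / D k"
      using D[of k] p[of k] by (simp add: power_divide fac power2_eq_square[of "D k"])
    also have "\<dots> \<le> 2 / D k" using D[of k] p[of k] by (intro divide_right_mono) auto
    finally show "(N k)\<^sup>2 \<le> 2 / D k" .
    have "1 / D k = (1 + p k) * (1 / (1 - (p k)\<^sup>2))"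
      using D[of k] p[of k] by (simp add: fac)
    also have "\<dots> \<le> 2 * (1 / (1 - (p k)\<^sup>2))"
      using p[of k] D[of k] by (intro mult_right_mono) (auto simp: fac)
    also have "\<dots> \<le> 2 * (N k)\<^sup>2"
      unfolding N[OF k] p_def
      by (intro mult_left_mono norm_lift_composition_ge[OF self_map_power[OF self_map]]) simp
    finally show "1 / D k \<le> 2 * (N k)\<^sup>2" .
  next
    fix t assume "r < t"
    then show "\<exists>K. \<forall>k. N k \<le> K * t ^ k"
      unfolding r_def N_def by (rule spectral_radius_growth[OF T])
  qed
  moreover have "(\<lambda>k. sqrt (D k / D (Suc k))) \<longlonglongrightarrow> r" if "convergent (\<lambda>k. sqrt (D k / D (Suc k)))"
    using that ratio_limit_eq_root_limit[OF D r root] by (auto simp: convergent_def)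
  ultimately show ?thesis unfolding D_def p_def r_def by blast
qed

end
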